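(* With notation as in the context, let $g_0=(x_0,t_0)\in\widetilde{\mathbb M}\setminus\{o\}$ and let $\theta_0\in\Omega_*$ be a global maximizer of $\phi(g_0;\cdot)$ on $\Omega_*$. Then $d(g_0)^2=\phi(g_0;\theta_0)$, and there exists a unique shortest geodesic joining $o$ to $g_0$, namely $\gamma(s)=(x(s),t(s))$, $0\le s\le1$, with $$x(s)=\frac{\sin(sU(\theta_0))}{\sin U(\theta_0)}e^{(s-1)\widetilde U(\theta_0)}x_0,\quad t(s)=\frac12\int_0^s\langle\mathbb Ux(r),\zeta(r)\rangle dr,\quad \zeta(s)=\frac{U(\theta_0)}{\sin U(\theta_0)}e^{(2s-1)\widetilde U(\theta_0)}x_0.$$ Moreover, if $g_0\in\widetilde{\mathbb M}_2$, this shortest geodesic is abnormal.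
   Context: Let $q,m\ge1$, $U^{(1)},\dots,U^{(m)}$ linearly independent real skew-symmetric $q\times q$ matrices; $\mathbb G=\mathbb R^q\times\mathbb R^m$ with law $(x,t)\cdot(x',t')=(x+x',t+t'+\frac12\langle\mathbb Ux,x'\rangle)$, $\langle\mathbb Ux,x'\rangle=(\langle U^{(j)}x,x'\rangle)_j$, identity $o$. Horizontal curves: absolutely continuous $(x(s),t(s))$ with $t'=\frac12\langle\mathbb Ux,x'\rangle$, length $\int_0^1|x'|$; $d(g)$ is the infimum of lengths from $o$ to $g$; a shortest geodesic from $o$ to $g$ is a horizontal curve from $o$ to $g$ of length $d(g)$. $\widetilde U(\tau)=\sum_j\tau_jU^{(j)}$, $U(\tau)=i\widetilde U(\tau)$, $\Omega_*=\{\tau:\|U(\tau)\|<\pi\}$, $\phi((x,t);\tau)=\langle U(\tau)\cot U(\tau)x,x\rangle+4t\cdot\tau$. $\widetilde{\mathbb M}=\{g:\phi(g;\cdot)$ attains its maximum in $\Omega_*\}$, $\widetilde{\mathbb M}_2=\{g:$ the set of global maximizers of $\phi(g;\cdot)$ in $\Omega_*$ has at least two points$\}$. Normal geodesics: for $(\zeta_0,\theta)\in\mathbb R^q\times\mathbb R^m$, $\gamma(\zeta_0,2\theta;s)=(x(s),t(s))$ with $\zeta(s)=e^{2s\widetilde U(\theta)}\zeta_0$, $x(s)=\int_0^s\zeta$, $t(s)=\frac12\int_0^s\langle\mathbb Ux,\zeta\rangle$; its normal extremal lift is $s\mapsto(\gamma(s),(\zeta(s)-\widetilde U(\theta)x(s),\,2\theta))$.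 A normal geodesic is abnormal if it admits two distinct normal extremal lifts (i.e. it equals $\gamma(\zeta_0,2\theta;\cdot)$ and $\gamma(\zeta_0',2\theta';\cdot)$ with distinct lifts). Conventions: $\frac{\sin(s\cdot0)}{\sin0}=s$, $\frac0{\sin0}=1$.
   Formalization: Uniqueness of the shortest geodesic is stated up to reparametrization: every shortest geodesic is γ∘h with h continuous, nondecreasing, mapping [0,1] onto itself; literal uniqueness fails, since e.g. γ(s²) is also a horizontal curve from o to g₀ of length d(g₀). *)

theory Defs
  imports "HOL-Analysis.Analysis"
begin

definition skew :: "real^'q^'q \<Rightarrow> bool" where
  "skew A \<longleftrightarrow> transpose A = - A"

fun mpow :: "real^'q^'q \<Rightarrow> nat \<Rightarrow> real^'q^'q" where
  "mpow A 0 = mat 1"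
| "mpow A (Suc k) = A ** mpow A k"

definition mexp :: "real^'q^'q \<Rightarrow> real^'q^'q" where
  "mexp A = (\<Sum>k. (1 / fact k) *\<^sub>R mpow A k)"

definition cvec :: "real^'q \<Rightarrow> complex^'q" where
  "cvec x = (\<chi> i. complex_of_real (x $ i))"

definition cinner :: "complex^'q \<Rightarrow> complex^'q \<Rightarrow> complex" where
  "cinner z w = (\<Sum>i\<in>UNIV. z $ i * cnj (w $ i))"

text \<open>Functional calculus for a diagonalizable (here: Hermitian) complex matrix:
  f(A) is the matrix acting as multiplication by f(\<lambda>) on every eigenvector
  with eigenvalue \<lambda>.\<close>
definition matfun :: "(complex \<Rightarrow> complex) \<Rightarrow> complex^'q^'q \<Rightarrow> complex^'q^'q" where
  "matfun f A = (THE B. \<forall>v c. A *v v = c *s v \<longrightarrow> B *v v = f c *s v)"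

definition zcot :: "complex \<Rightarrow> complex" where
  "zcot z = (if z = 0 then 1 else z * cos z / sin z)"

definition sinratio :: "real \<Rightarrow> complex \<Rightarrow> complex" where
  "sinratio s z = (if z = 0 then complex_of_real s else sin (complex_of_real s * z) / sin z)"

definition zsin :: "complex \<Rightarrow> complex" where
  "zsin z = (if z = 0 then 1 else z / sin z)"

definition Ut :: "('m \<Rightarrow> real^'q^'q) \<Rightarrow> real^'m \<Rightarrow> real^'q^'q" where
  "Ut U \<tau> = (\<Sum>j\<in>UNIV. (\<tau> $ j) *\<^sub>R U j)"

definition Uc :: "('m \<Rightarrow> real^'q^'q) \<Rightarrow> real^'m \<Rightarrow> complex^'q^'q" where
  "Uc U \<tau> = (\<chi> i j. \<i> * complex_of_real (Ut U \<tau> $ i $ j))"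

definition bracket :: "('m \<Rightarrow> real^'q^'q) \<Rightarrow> real^'q \<Rightarrow> real^'q \<Rightarrow> real^'m" where
  "bracket U x y = (\<chi> j. (U j *v x) \<bullet> y)"

text \<open>\<open>\<Omega>_* = {\<tau>. \<parallel>U(\<tau>)\<parallel> < \<pi>}\<close>, operator norm (\<open>\<parallel>i A\<parallel> = \<parallel>A\<parallel>\<close> for a real matrix A).\<close>
definition Omega :: "('m \<Rightarrow> real^'q^'q) \<Rightarrow> (real^'m) set" where
  "Omega U = {\<tau>. onorm (\<lambda>x. Ut U \<tau> *v x) < pi}"

definition phi :: "('m \<Rightarrow> real^'q^'q) \<Rightarrow> (real^'q) \<times> (real^'m) \<Rightarrow> real^'m \<Rightarrow> real" where
  "phi U g \<tau> = Re (cinner (matfun zcot (Uc U \<tau>) *v cvec (fst g)) (cvec (fst g)))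
                 + 4 * (snd g \<bullet> \<tau>)"

definition Mt :: "('m \<Rightarrow> real^'q^'q) \<Rightarrow> ((real^'q) \<times> (real^'m)) set" where
  "Mt U = {g. \<exists>\<theta>\<in>Omega U. \<forall>\<tau>\<in>Omega U. phi U g \<tau> \<le> phi U g \<theta>}"

definition maximizers :: "('m \<Rightarrow> real^'q^'q) \<Rightarrow> (real^'q) \<times> (real^'m) \<Rightarrow> (real^'m) set" where
  "maximizers U g = {\<theta>\<in>Omega U. \<forall>\<tau>\<in>Omega U. phi U g \<tau> \<le> phi U g \<theta>}"

definition Mt2 :: "('m \<Rightarrow> real^'q^'q) \<Rightarrow> ((real^'q) \<times> (real^'m)) set" where
  "Mt2 U = {g. \<exists>\<theta>1 \<theta>2. \<theta>1 \<in> maximizers U g \<and> \<theta>2 \<in> maximizers U g \<and> \<theta>1 \<noteq> \<theta>2}"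

definition abs_cont_on :: "real \<Rightarrow> real \<Rightarrow> (real \<Rightarrow> 'a::real_normed_vector) \<Rightarrow> bool" where
  "abs_cont_on a b f \<longleftrightarrow>
     (\<forall>\<epsilon>>0. \<exists>\<delta>>0. \<forall>(n::nat) (l::nat \<Rightarrow> real) (r::nat \<Rightarrow> real).
        (\<forall>i<n. a \<le> l i \<and> l i \<le> r i \<and> r i \<le> b) \<and>
        (\<forall>i<n. \<forall>j<n. i \<noteq> j \<longrightarrow> r i \<le> l j \<or> r j \<le> l i) \<and>
        (\<Sum>i<n. r i - l i) < \<delta>
        \<longrightarrow> (\<Sum>i<n. norm (f (r i) - f (l i))) < \<epsilon>)"

definition horizontal :: "('m \<Rightarrow> real^'q^'q) \<Rightarrow> (real \<Rightarrow> (real^'q) \<times> (real^'m)) \<Rightarrow> (real \<Rightarrow> real^'q) \<Rightarrow> bool" where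
  "horizontal U \<gamma> v \<longleftrightarrow>
     abs_cont_on 0 1 (\<lambda>s. fst (\<gamma> s)) \<and> abs_cont_on 0 1 (\<lambda>s. snd (\<gamma> s)) \<and>
     (\<exists>N. negligible N \<and> (\<forall>s\<in>{0..1} - N.
        ((\<lambda>s. fst (\<gamma> s)) has_vector_derivative v s) (at s within {0..1}) \<and>
        ((\<lambda>s. snd (\<gamma> s)) has_vector_derivative (1/2) *\<^sub>R bracket U (fst (\<gamma> s)) (v s)) (at s within {0..1})))"

definition curve_length :: "(real \<Rightarrow> real^'q) \<Rightarrow> real" where
  "curve_length v = integral {0..1} (\<lambda>s. norm (v s))"

definition origin :: "(real^'q) \<times> (real^'m)" where
  "origin = (0, 0)"

definition dist_cc :: "('m \<Rightarrow> real^'q^'q) \<Rightarrow> (real^'q) \<times> (real^'m) \<Rightarrow> real" where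
  "dist_cc U g = Inf {L. \<exists>\<gamma> v. horizontal U \<gamma> v \<and> \<gamma> 0 = origin \<and> \<gamma> 1 = g \<and> L = curve_length v}"

definition shortest_geodesic :: "('m \<Rightarrow> real^'q^'q) \<Rightarrow> (real^'q) \<times> (real^'m) \<Rightarrow> (real \<Rightarrow> (real^'q) \<times> (real^'m)) \<Rightarrow> bool" where
  "shortest_geodesic U g \<gamma> \<longleftrightarrow>
     (\<exists>v. horizontal U \<gamma> v \<and> \<gamma> 0 = origin \<and> \<gamma> 1 = g \<and> curve_length v = dist_cc U g)"

definition ngz :: "('m \<Rightarrow> real^'q^'q) \<Rightarrow> real^'q \<Rightarrow> real^'m \<Rightarrow> real \<Rightarrow> real^'q" where
  "ngz U \<zeta>0 \<theta> s = mexp ((2 * s) *\<^sub>R Ut U \<theta>) *v \<zeta>0"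

definition ngx :: "('m \<Rightarrow> real^'q^'q) \<Rightarrow> real^'q \<Rightarrow> real^'m \<Rightarrow> real \<Rightarrow> real^'q" where
  "ngx U \<zeta>0 \<theta> s = integral {0..s} (ngz U \<zeta>0 \<theta>)"

definition normal_geodesic :: "('m \<Rightarrow> real^'q^'q) \<Rightarrow> real^'q \<Rightarrow> real^'m \<Rightarrow> real \<Rightarrow> (real^'q) \<times> (real^'m)" where
  "normal_geodesic U \<zeta>0 \<theta> s =
     (ngx U \<zeta>0 \<theta> s,
      (1/2) *\<^sub>R integral {0..s} (\<lambda>r. bracket U (ngx U \<zeta>0 \<theta> r) (ngz U \<zeta>0 \<theta> r)))"

definition normal_lift :: "('m \<Rightarrow> real^'q^'q) \<Rightarrow> real^'q \<Rightarrow> real^'m \<Rightarrow> real \<Rightarrow> ((real^'q) \<times> (real^'m)) \<times> ((real^'q) \<times> (real^'m))" where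
  "normal_lift U \<zeta>0 \<theta> s =
     (normal_geodesic U \<zeta>0 \<theta> s, (ngz U \<zeta>0 \<theta> s - Ut U \<theta> *v ngx U \<zeta>0 \<theta> s, 2 *\<^sub>R \<theta>))"

definition abnormal :: "('m \<Rightarrow> real^'q^'q) \<Rightarrow> (real \<Rightarrow> (real^'q) \<times> (real^'m)) \<Rightarrow> bool" where
  "abnormal U \<gamma> \<longleftrightarrow>
     (\<exists>\<zeta>0 \<theta> \<zeta>0' \<theta>'.
        (\<forall>s\<in>{0..1}. \<gamma> s = normal_geodesic U \<zeta>0 \<theta> s \<and> \<gamma> s = normal_geodesic U \<zeta>0' \<theta>' s) \<and>
        (\<exists>s\<in>{0..1}. normal_lift U \<zeta>0 \<theta> s \<noteq> normal_lift U \<zeta>0' \<theta>' s))"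

end

theory Submission
  imports Defs
begin

text \<open>Put \<open>A = Ut U \<theta>\<close>. Along a horizontal curve from the origin to \<open>(x, t)\<close> the energy
  \<open>\<integral> |x'|\<^sup>2\<close> equals \<open>\<integral> (|x'|\<^sup>2 - 2 \<langle>A x, x'\<rangle>) + 4 \<langle>t, \<theta>\<rangle>\<close>. For \<open>\<theta> \<in> Omega U\<close> the first
  integral, with the end point \<open>x\<close> fixed, is strictly minimized by the projection of a normal geodesic,
  because a Riccati function \<open>w\<close> with \<open>w' = - \<rho>\<^sup>2 - w\<^sup>2\<close>, \<open>\<parallel>A\<parallel> < \<rho> < \<pi>\<close>, turns the second variation
  into a sum of squares; its minimum is \<open>\<langle>U(\<theta>) cot U(\<theta>) x, x\<rangle>\<close>. Hence \<open>phi U (x, t) \<theta>\<close> bounds the squared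
  length of every horizontal curve, after reparametrization by arc length. If \<open>\<theta>\<close> is a maximizer, the
  first-order condition says exactly that the normal geodesic also has vertical end point \<open>t\<close>, so the bound is
  attained; the strictness gives uniqueness. Two distinct maximizers then yield the same curve with
  different covectors.\<close>

text \<open>Horizontal curves are only absolutely continuous and carry no preferred parametrization.
  Derivatives almost everywhere are therefore replaced by the relation \<open>primitive\<close>, a
  statement about increments with its own product and chain rules. The curve itself is not
  reparametrized: its normalized arc length \<open>\<sigma>\<close> may stall, so the geodesic is
  composed with \<open>\<sigma>\<close> instead, and the energy is weighted by \<open>u\<close>, the
  density of \<open>\<sigma>\<close>. The weighted energy is exactly the squared length. The initial
  velocity for the end point \<open>x\<close> is \<open>N *v x\<close>, where \<open>N\<close>
  inverts the integral of exp(2 r A) over [0,1]. Invertibility comes from the energy identity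
  itself, applied against the zero curve, and the boundary term of that identity, as a quadratic
  form in \<open>x\<close>, is the cotangent form in \<open>phi\<close>. \<open>phi\<close> is never
  differentiated in \<open>\<theta>\<close>: the first-order condition follows from a lower bound,
  quadratic in the perturbation, for the energy of the geodesic of a nearby parameter.\<close>

subsection \<open>Spectral theory of the Hermitian matrix\<close>

text \<open>If the eigenvectors did not span, the Rayleigh quotient would attain its maximum on the
  unit sphere of their orthogonal complement, which \<open>f\<close> preserves, and the maximizer
  would be one more eigenvector. Real Euclidean spaces suffice, since complex vectors are used
  through their underlying real structure.\<close>

lemma span_eigenvectors_selfadjoint:
  fixes f :: "'a::euclidean_space \<Rightarrow> 'a"
  assumes lin: "linear f" and sa: "\<And>x y. f x \<bullet> y = x \<bullet> f y"
  shows "span {v. \<exists>r. f v = r *\<^sub>R v} = UNIV"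
proof (rule ccontr)
  let ?E = "{v. \<exists>r. f v = r *\<^sub>R v}"
  define S where "S = {w. \<forall>v\<in>?E. v \<bullet> w = 0}"
  assume neq: "span ?E \<noteq> UNIV"
  then have "span ?E \<subset> span UNIV" by auto
  then obtain a where a: "a \<noteq> 0" "\<And>y. y \<in> span ?E \<Longrightarrow> orthogonal a y"
    using orthogonal_to_subspace_exists_gen[of ?E UNIV] by blast
  have aS: "a \<in> S"
    using a(2) unfolding S_def orthogonal_def by (auto intro: span_base simp: inner_commute)
  have subS: "subspace S"
    unfolding S_def subspace_def by (auto simp: inner_right_distrib)
  have fS: "f w \<in> S" if "w \<in> S" for w
    unfolding S_def
  proof clarsimp
    fix v r assume r: "f v = r *\<^sub>R v"
    then have "v \<bullet> w = 0" using that unfolding S_def by blast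
    then show "v \<bullet> f w = 0" using r by (simp add: sa[symmetric])
  qed
  have cl: "closed S" using subS closed_subspace by blast
  have comp: "compact (sphere 0 1 \<inter> S)" using cl by (simp add: compact_Int_closed)
  have ne: "(1 / norm a) *\<^sub>R a \<in> sphere 0 1 \<inter> S"
    using a(1) aS subS by (simp add: subspace_scale)
  have cont: "continuous_on (sphere 0 1 \<inter> S) (\<lambda>x. f x \<bullet> x)"
    by (intro continuous_intros linear_continuous_on) (simp add: lin linear_conv_bounded_linear[symmetric])
  obtain v where v: "v \<in> sphere 0 1 \<inter> S" "\<And>y. y \<in> sphere 0 1 \<inter> S \<Longrightarrow> f y \<bullet> y \<le> f v \<bullet> v"
    using continuous_attains_sup[OF comp _ cont] ne by blast
  define l where "l = f v \<bullet> v"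
  have v1: "v \<bullet> v = 1" using v(1) by (simp add: dot_square_norm)
  have q: "f w \<bullet> w \<le> l * (w \<bullet> w)" if w: "w \<in> S" for w
  proof (cases "w = 0")
    case True then show ?thesis using lin by (simp add: linear_0)
  next
    case False
    let ?y = "(1 / norm w) *\<^sub>R w"
    have "?y \<in> sphere 0 1 \<inter> S" using False w subS by (simp add: subspace_scale)
    then have "f ?y \<bullet> ?y \<le> l" using v(2) l_def by blast
    moreover have "f ?y \<bullet> ?y = (f w \<bullet> w) / (w \<bullet> w)"
      by (simp add: linear_scale[OF lin] power2_norm_eq_inner[symmetric] power2_eq_square)
    ultimately have "(f w \<bullet> w) / (w \<bullet> w) \<le> l" by linarith
    moreover have "w \<bullet> w > 0" using False by simp
    ultimately show ?thesis by (metis pos_divide_le_eq)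
  qed
  define w where "w = l *\<^sub>R v - f v"
  have vS: "v \<in> S" using v by blast
  have wS: "w \<in> S" unfolding w_def using subS vS fS by (simp add: subspace_diff subspace_scale)
  have vw: "v \<bullet> w = 0" unfolding w_def by (simp add: inner_diff_right v1 l_def inner_commute)
  \<comment> \<open>first variation of the Rayleigh quotient at its maximizer in the direction of the residual\<close>
  have ineq: "2 * e * (w \<bullet> w) \<le> - e\<^sup>2 * (f w \<bullet> w - l * (w \<bullet> w)) " for e
  proof -
    have fv: "f v = l *\<^sub>R v - w" by (simp add: w_def)
    have "v - e *\<^sub>R w \<in> S" using subS vS wS by (simp add: subspace_diff subspace_scale)
    from q[OF this] have "f (v - e *\<^sub>R w) \<bullet> (v - e *\<^sub>R w) \<le> l * ((v - e *\<^sub>R w) \<bullet> (v - e *\<^sub>R w))" .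
    moreover have "f (v - e *\<^sub>R w) \<bullet> (v - e *\<^sub>R w) = l - 2 * e * (f v \<bullet> w) + e\<^sup>2 * (f w \<bullet> w)"
      using sa[of w v] by (simp add: linear_diff[OF lin] linear_scale[OF lin] inner_diff_left inner_diff_right
          l_def inner_commute power2_eq_square algebra_simps)
    moreover have "f v \<bullet> w = - (w \<bullet> w)"
      unfolding fv using vw by (simp add: inner_diff_left)
    moreover have "(v - e *\<^sub>R w) \<bullet> (v - e *\<^sub>R w) = 1 + e\<^sup>2 * (w \<bullet> w)"
      using vw v1 by (simp add: inner_diff_left inner_diff_right inner_commute power2_eq_square)
    ultimately have "l - 2 * e * (- (w \<bullet> w)) + e\<^sup>2 * (f w \<bullet> w) \<le> l * (1 + e\<^sup>2 * (w \<bullet> w))"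
      by metis
    then show ?thesis by (simp add: algebra_simps)
  qed
  have "w = 0"
  proof (rule ccontr)
    assume "w \<noteq> 0"
    define p where "p = w \<bullet> w"
    define c where "c = - (f w \<bullet> w - l * p)"
    have p: "p > 0" using \<open>w \<noteq> 0\<close> by (simp add: p_def)
    have c0: "c \<ge> 0" using q[OF wS] by (simp add: c_def p_def)
    \<comment> \<open>This step size keeps \<open>e * c\<close> below \<open>p\<close>, so the
      linear gain \<open>2 * p\<close> wins; the 1 guards against \<open>c = 0\<close>.\<close>
    define e where "e = p / (c + 1)"
    have e: "e > 0" using p c0 by (simp add: e_def)
    have "2 * e * p \<le> e\<^sup>2 * c" using ineq[of e] e by (simp add: c_def p_def algebra_simps)
    then have "2 * p \<le> e * c" using e by (simp add: power2_eq_square)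
    also have "e * c \<le> p" using p c0 by (simp add: e_def divide_le_eq)
    finally show False using p by simp
  qed
  then have "f v = l *\<^sub>R v" by (simp add: w_def)
  then have "v \<in> ?E" by blast
  then have "v \<bullet> v = 0" using vS unfolding S_def by blast
  then show False using v1 by simp
qed

definition cmat :: "real^'q^'q \<Rightarrow> complex^'q^'q" where
  "cmat A = (\<chi> i j. complex_of_real (A $ i $ j))"

lemma cmat_mult: "cmat (A ** B) = cmat A ** cmat B"
  by (simp add: cmat_def matrix_matrix_mult_def vec_eq_iff)

lemma cmat_mat_1: "cmat (mat 1) = mat 1"
  by (simp add: cmat_def mat_def vec_eq_iff)

lemma cmat_mult_cvec: "cmat A *v cvec x = cvec (A *v x)"
  by (simp add: cmat_def cvec_def matrix_vector_mult_def vec_eq_iff)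

lemma Re_cinner_cvec: "Re (cinner (cvec x) (cvec y)) = x \<bullet> y"
  by (simp add: cinner_def cvec_def inner_vec_def)

lemma bounded_linear_cmat_mult: "bounded_linear (\<lambda>A. cmat A *v v)"
proof -
  have "linear (\<lambda>A. cmat A *v v)"
  proof (rule linearI)
    fix A B :: "real^'a^'a" and r :: real
    show "cmat (A + B) *v v = cmat A *v v + cmat B *v v"
      by (simp add: cmat_def matrix_vector_mult_def vec_eq_iff sum.distrib distrib_right)
    show "cmat (r *\<^sub>R A) *v v = r *\<^sub>R (cmat A *v v)"
      unfolding vec_eq_iff
      by (simp add: cmat_def matrix_vector_mult_def scaleR_sum_right) (simp add: scaleR_conv_of_real[where 'a=complex] mult.assoc)
  qed
  then show ?thesis by (simp add: linear_conv_bounded_linear)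
qed

lemma Uc_mult: "Uc U \<tau> *v v = \<i> *s (cmat (Ut U \<tau>) *v v)"
  by (simp add: Uc_def cmat_def matrix_vector_mult_def vec_eq_iff sum_distrib_left mult.assoc)

text \<open>Dictionary between the two spectra: an eigenvalue \<open>c\<close> of the Hermitian
  matrix appears as \<open>- \<i> * c\<close> in every exponential of the real one.\<close>

lemma Uc_eigen_iff: "Uc U \<tau> *v v = c *s v \<longleftrightarrow> cmat (Ut U \<tau>) *v v = (- \<i> * c) *s v"
proof
  assume "Uc U \<tau> *v v = c *s v"
  then have "(- \<i>) *s (\<i> *s (cmat (Ut U \<tau>) *v v)) = (- \<i>) *s (c *s v)" by (simp add: Uc_mult)
  then show "cmat (Ut U \<tau>) *v v = (- \<i> * c) *s v" by (simp add: vector_smult_assoc)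
qed (simp add: Uc_mult vector_smult_assoc)

lemma uminus_matrix_vector_mult: "(- A) *v x = - (A *v (x::real^'n))"
  by (simp add: matrix_vector_mult_def vec_eq_iff sum_negf)

lemma skew_inner: "skew A \<Longrightarrow> (A *v x) \<bullet> y = - (x \<bullet> (A *v y))"
  by (metis dot_lmul_matrix transpose_matrix_vector skew_def uminus_matrix_vector_mult
      inner_minus_left minus_minus)

lemma skew_entry: "skew A \<Longrightarrow> A $ i $ j = - A $ j $ i"
proof -
  assume "skew A"
  then have "transpose A $ j $ i = (- A) $ j $ i" by (simp only: skew_def)
  then show ?thesis by (simp add: transpose_def)
qed

lemma skew_Ut:
  assumes "\<And>j. skew (U j)"
  shows "skew (Ut U \<tau>)"
proof -
  have "Ut U \<tau> $ j $ i = (- Ut U \<tau>) $ i $ j" for i j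
    unfolding Ut_def
    by (simp add: sum_negf[symmetric], intro sum.cong refl)
      (metis skew_entry[OF assms] mult_minus_right)
  then show ?thesis unfolding skew_def transpose_def by (auto simp only: vec_eq_iff vec_lambda_beta)
qed

text \<open>On complex vectors \<open>\<bullet>\<close> is the real part of the Hermitian product;
  the sign from moving \<i> across it cancels the sign from skewness.\<close>

lemma Uc_selfadjoint:
  assumes "skew (Ut U \<tau>)"
  shows "(Uc U \<tau> *v x) \<bullet> y = x \<bullet> (Uc U \<tau> *v y)"
proof -
  let ?A = "Ut U \<tau>"
  have "(Uc U \<tau> *v x) \<bullet> y = (\<Sum>i\<in>UNIV. \<Sum>j\<in>UNIV. (\<i> * of_real (?A $ i $ j) * x $ j) \<bullet> (y $ i))"
    by (simp add: inner_vec_def matrix_vector_mult_def Uc_def inner_sum_left)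
  also have "\<dots> = (\<Sum>i\<in>UNIV. \<Sum>j\<in>UNIV. x $ j \<bullet> (\<i> * of_real (?A $ j $ i) * y $ i))"
  proof (intro sum.cong refl)
    fix i j
    show "(\<i> * of_real (?A $ i $ j) * x $ j) \<bullet> (y $ i) = x $ j \<bullet> (\<i> * of_real (?A $ j $ i) * y $ i)"
      unfolding skew_entry[OF assms, of i j] by (simp add: inner_complex_def algebra_simps)
  qed
  also have "\<dots> = (\<Sum>j\<in>UNIV. \<Sum>i\<in>UNIV. x $ j \<bullet> (\<i> * of_real (?A $ j $ i) * y $ i))"
    by (rule sum.swap)
  also have "\<dots> = x \<bullet> (Uc U \<tau> *v y)"
    by (simp add: inner_vec_def matrix_vector_mult_def Uc_def inner_sum_right)
  finally show ?thesis .
qed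

lemma linear_matrix_vector_mult_complex: "linear (\<lambda>x::complex^'q. B *v x)"
  by (rule linearI)
    (simp_all add: matrix_vector_mult_def vec_eq_iff scaleR_sum_right distrib_left sum.distrib)

text \<open>The eigenvectors of a Hermitian matrix span, so matrix identities can be checked on one
  eigenvector at a time. Restricting to \<open>v \<noteq> 0\<close> gives access to facts about the
  eigenvalue itself, such as \<open>sin c \<noteq> 0\<close>.\<close>

lemma matrix_eq_on_eigenvectors:
  assumes "skew (Ut U \<tau>)"
    and "\<And>v c. v \<noteq> 0 \<Longrightarrow> Uc U \<tau> *v v = c *s v \<Longrightarrow> B *v v = C *v v"
  shows "B = C"
proof -
  let ?E = "{v. \<exists>r. Uc U \<tau> *v v = r *\<^sub>R v}"
  have sp: "span ?E = UNIV"
    by (rule span_eigenvectors_selfadjoint)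
      (use Uc_selfadjoint[OF assms(1)] linear_matrix_vector_mult_complex in blast)+
  have "B *v x = C *v x" for x
  proof (rule linear_eq_on_span[of "\<lambda>x. B *v x" "\<lambda>x. C *v x" ?E])
    fix v assume "v \<in> ?E"
    then obtain r where "Uc U \<tau> *v v = r *\<^sub>R v" by blast
    moreover have "r *\<^sub>R v = complex_of_real r *s v"
      unfolding vec_eq_iff by (simp add: scaleR_conv_of_real[where 'a = complex])
    ultimately show "B *v v = C *v v" using assms(2)[of v] by (cases "v = 0") auto
  qed (use sp linear_matrix_vector_mult_complex in auto)
  then show ?thesis by (simp add: matrix_eq)
qed

text \<open>Resolves the definite description in \<open>matfun\<close>: a candidate with the right
  eigenvalues exists by assumption and is unique because the eigenvectors span.\<close>

lemma matfun_Uc_eqI: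
  assumes "skew (Ut U \<tau>)"
    and "\<And>v c. v \<noteq> 0 \<Longrightarrow> Uc U \<tau> *v v = c *s v \<Longrightarrow> B *v v = f c *s v"
  shows "matfun f (Uc U \<tau>) = B"
  unfolding matfun_def
proof (rule the_equality)
  show "\<forall>v c. Uc U \<tau> *v v = c *s v \<longrightarrow> B *v v = f c *s v"
  proof (intro allI impI)
    fix v c assume "Uc U \<tau> *v v = c *s v"
    then show "B *v v = f c *s v" using assms(2) by (cases "v = 0") auto
  qed
next
  fix C assume "\<forall>v c. Uc U \<tau> *v v = c *s v \<longrightarrow> C *v v = f c *s v"
  then show "C = B" by (intro matrix_eq_on_eigenvectors[OF assms(1)]) (use assms(2) in auto)
qed

subsection \<open>The matrix exponential\<close>

lemma mpow_scaleR: "mpow (s *\<^sub>R A) k = s ^ k *\<^sub>R mpow A k"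
proof (induction k)
  case (Suc k)
  have "(s *\<^sub>R A) ** (s ^ k *\<^sub>R mpow A k) = (s * s ^ k) *\<^sub>R (A ** mpow A k)"
    unfolding matrix_matrix_mult_def vec_eq_iff by (simp add: sum_distrib_left mult_ac)
  then show ?case by (simp add: Suc)
qed simp

text \<open>The sum of all absolute entries acts as a submultiplicative norm; with it a scalar
  exponential series dominates every entry of the matrix series.\<close>

lemma abs_mpow_entry_le: "\<bar>mpow A k $ i $ j\<bar> \<le> (\<Sum>i\<in>UNIV. \<Sum>j\<in>UNIV. \<bar>A $ i $ j\<bar>) ^ k"
proof (induction k arbitrary: i j)
  case 0
  show ?case by (simp add: mat_def)
next
  case (Suc k)
  let ?K = "\<Sum>i\<in>UNIV. \<Sum>j\<in>UNIV. \<bar>A $ i $ j\<bar>"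
  have K: "?K \<ge> 0" by (simp add: sum_nonneg)
  have "\<bar>mpow A (Suc k) $ i $ j\<bar> \<le> (\<Sum>l\<in>UNIV. \<bar>A $ i $ l\<bar> * \<bar>mpow A k $ l $ j\<bar>)"
    by (simp add: matrix_matrix_mult_def) (metis (no_types, lifting) abs_mult sum.cong sum_abs)
  also have "\<dots> \<le> (\<Sum>l\<in>UNIV. \<bar>A $ i $ l\<bar> * ?K ^ k)"
    by (intro sum_mono mult_left_mono Suc) simp
  also have "\<dots> = (\<Sum>l\<in>UNIV. \<bar>A $ i $ l\<bar>) * ?K ^ k" by (simp add: sum_distrib_right)
  also have "\<dots> \<le> ?K * ?K ^ k"
    by (intro mult_right_mono member_le_sum[where f="\<lambda>i. \<Sum>j\<in>UNIV. \<bar>A $ i $ j\<bar>"])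
      (use K in \<open>auto simp: sum_nonneg\<close>)
  finally show ?case by simp
qed

lemma summable_mpow_entry: "summable (\<lambda>k. (mpow A k $ i $ j / fact k) * s ^ k)"
proof (rule summable_comparison_test')
  let ?K = "\<Sum>i\<in>UNIV. \<Sum>j\<in>UNIV. \<bar>A $ i $ j\<bar>"
  show "summable (\<lambda>k. (?K * \<bar>s\<bar>) ^ k / fact k)"
    using summable_exp[of "?K * \<bar>s\<bar>"] by (simp add: field_simps)
  show "norm ((mpow A k $ i $ j / fact k) * s ^ k) \<le> (?K * \<bar>s\<bar>) ^ k / fact k" for k
    using mult_right_mono[OF abs_mpow_entry_le[of A k i j], of "\<bar>s\<bar> ^ k"]
    by (simp add: abs_mult power_abs power_mult_distrib divide_right_mono)
qed

lemma sums_vecI: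
  assumes "\<And>i. (\<lambda>k. f k $ i) sums (x $ i)"
  shows "f sums (x :: 'a::real_normed_vector^'n)"
  using assms unfolding sums_def by (intro vec_tendstoI) simp

lemma mexp_sums: "(\<lambda>k. (1 / fact k) *\<^sub>R mpow A k) sums mexp A"
proof -
  have "(\<lambda>k. (1 / fact k) *\<^sub>R mpow A k) sums (\<chi> i j. \<Sum>k. mpow A k $ i $ j / fact k)"
    using summable_sums[OF summable_mpow_entry[where s = 1]] by (intro sums_vecI) simp
  then show ?thesis unfolding mexp_def by (simp add: sums_iff)
qed

lemma mexp_scaleR_entry_sums:
  "(\<lambda>k. (mpow A k $ i $ j / fact k) * s ^ k) sums (mexp (s *\<^sub>R A) $ i $ j)"
proof -
  have "bounded_linear (\<lambda>B::real^'a^'a. B $ i $ j)"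
    by (rule bounded_linear_compose[OF bounded_linear_vec_nth bounded_linear_vec_nth])
  from bounded_linear.sums[OF this mexp_sums[of "s *\<^sub>R A"]]
  show ?thesis by (simp add: mpow_scaleR mult.commute)
qed

lemma has_vector_derivative_vecI:
  assumes "\<And>i. ((\<lambda>s. f s $ i) has_vector_derivative (f' $ i)) (at x within S)"
  shows "((f :: real \<Rightarrow> 'a::real_normed_vector^'n) has_vector_derivative f') (at x within S)"
  using assms unfolding has_vector_derivative_def has_derivative_within
  by (auto intro!: vec_tendstoI bounded_linear_scaleR_left)

text \<open>Each entry is a scalar power series in \<open>s\<close>, differentiated term by term;
  the index shift of \<open>diffs\<close> pulls one factor \<open>A\<close> out of
  \<open>mpow A (Suc n)\<close>.\<close>

lemma mexp_has_vector_derivative: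
  "((\<lambda>s. mexp (s *\<^sub>R A)) has_vector_derivative (A ** mexp (s *\<^sub>R A))) (at s within S)"
proof (intro has_vector_derivative_vecI)
  fix i j
  let ?c = "\<lambda>k. mpow A k $ i $ j / fact k"
  have "((\<lambda>x. \<Sum>n. ?c n * x ^ n) has_field_derivative (\<Sum>n. diffs ?c n * s ^ n)) (at s)"
    by (rule termdiffs_strong_converges_everywhere) (rule summable_mpow_entry)
  moreover have "(\<lambda>s. \<Sum>n. ?c n * s ^ n) = (\<lambda>s. mexp (s *\<^sub>R A) $ i $ j)"
    using mexp_scaleR_entry_sums[of A i j] by (auto simp: sums_iff)
  moreover have "(\<Sum>n. diffs ?c n * s ^ n) = (A ** mexp (s *\<^sub>R A)) $ i $ j"
  proof -
    have "diffs ?c n * s ^ n = (\<Sum>l\<in>UNIV. A $ i $ l * ((mpow A n $ l $ j / fact n) * s ^ n))" for n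
    proof -
      have "diffs ?c n = mpow A (Suc n) $ i $ j / fact n"
        by (simp add: diffs_def del: mpow.simps)
      then show ?thesis
        by (simp add: matrix_matrix_mult_def sum_distrib_right sum_divide_distrib mult.assoc)
    qed
    moreover have "(\<lambda>n. \<Sum>l\<in>UNIV. A $ i $ l * ((mpow A n $ l $ j / fact n) * s ^ n))
        sums (\<Sum>l\<in>UNIV. A $ i $ l * mexp (s *\<^sub>R A) $ l $ j)"
      by (intro sums_sum sums_mult mexp_scaleR_entry_sums)
    ultimately show ?thesis by (simp add: sums_iff matrix_matrix_mult_def)
  qed
  ultimately show "((\<lambda>s. mexp (s *\<^sub>R A) $ i $ j) has_vector_derivative
      (A ** mexp (s *\<^sub>R A)) $ i $ j) (at s within S)"
    by (simp add: has_real_derivative_iff_has_vector_derivative[symmetric] has_field_derivative_at_within)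
qed

lemma mexp_0 [simp]: "mexp 0 = mat 1"
proof -
  have "mpow (0::real^'a^'a) k = (if k = 0 then mat 1 else 0)" for k
    by (cases k) (simp_all add: matrix_matrix_mult_def vec_eq_iff)
  then have "(\<lambda>k. (1 / fact k) *\<^sub>R mpow (0::real^'a^'a) k) = (\<lambda>k. if k = 0 then mat 1 else 0)" by auto
  then have "(\<lambda>k. if k = 0 then mat 1 else 0) sums mexp (0::real^'a^'a)"
    using mexp_sums[of "0::real^'a^'a"] by simp
  from sums_unique2[OF this sums_single[of 0 "\<lambda>_. mat 1"]] show ?thesis .
qed

lemma bounded_linear_matrix_vector_left: "bounded_linear (\<lambda>B::real^'n^'m. B *v x)"
  unfolding linear_conv_bounded_linear[symmetric]
  by (rule linearI)
    (simp_all add: matrix_vector_mult_add_rdistrib scaleR_matrix_vector_assoc)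

lemma mexp_mult_has_vector_derivative:
  "((\<lambda>s. mexp ((2 * s) *\<^sub>R A) *v z) has_vector_derivative
     2 *\<^sub>R (A *v (mexp ((2 * s) *\<^sub>R A) *v z))) (at s within S)"
proof -
  have "((\<lambda>s. mexp (s *\<^sub>R (2 *\<^sub>R A)) *v z) has_vector_derivative
      ((2 *\<^sub>R A) ** mexp (s *\<^sub>R (2 *\<^sub>R A))) *v z) (at s within S)"
    by (rule bounded_linear.has_vector_derivative[OF bounded_linear_matrix_vector_left mexp_has_vector_derivative])
  then show ?thesis
    by (simp add: mult.commute matrix_vector_mul_assoc[symmetric] scaleR_matrix_vector_assoc[symmetric])
qed

lemma continuous_on_mexp: "continuous_on S (\<lambda>s. mexp (s *\<^sub>R A))"
  using has_vector_derivative_continuous[OF mexp_has_vector_derivative]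
  unfolding continuous_on_eq_continuous_within by blast

lemma continuous_on_mexp2: "continuous_on S (\<lambda>s. mexp ((2 * s) *\<^sub>R A))"
  using continuous_on_mexp[of S "2 *\<^sub>R A"] by (simp add: mult.commute)

lemma cmat_mpow_eigen:
  assumes "cmat A *v v = d *s v"
  shows "cmat (mpow A k) *v v = d ^ k *s v"
proof (induction k)
  case (Suc k)
  have "cmat (mpow A (Suc k)) *v v = cmat A *v (d ^ k *s v)"
    by (simp add: cmat_mult matrix_vector_mul_assoc[symmetric] Suc)
  also have "\<dots> = d ^ k *s (cmat A *v v)" by (simp add: vector_scalar_commute)
  finally show ?case using assms by (simp add: mult.commute)
qed (simp add: cmat_mat_1)

lemma cmat_mexp_eigen:
  assumes "cmat A *v v = d *s v"
  shows "cmat (mexp (s *\<^sub>R A)) *v v = exp (of_real s * d) *s v"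
proof -
  have e: "cmat (s *\<^sub>R A) *v v = (of_real s * d) *s v"
    using assms by (simp add: cmat_def matrix_vector_mult_def vec_eq_iff mult.assoc flip: sum_distrib_left)
  have "(\<lambda>k. cmat ((1 / fact k) *\<^sub>R mpow (s *\<^sub>R A) k) *v v) sums (cmat (mexp (s *\<^sub>R A)) *v v)"
    by (rule bounded_linear.sums[OF bounded_linear_cmat_mult mexp_sums])
  moreover have "cmat ((1 / fact k) *\<^sub>R mpow (s *\<^sub>R A) k) *v v = ((of_real s * d) ^ k /\<^sub>R fact k) *s v" for k
    using cmat_mpow_eigen[OF e, of k]
    by (simp add: linear_scale[OF bounded_linear.linear[OF bounded_linear_cmat_mult]] vec_eq_iff divide_inverse)
  ultimately have *: "(\<lambda>k. ((of_real s * d) ^ k /\<^sub>R fact k) *s v) sums (cmat (mexp (s *\<^sub>R A)) *v v)"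
    by simp
  have "(\<lambda>k. ((of_real s * d) ^ k /\<^sub>R fact k) *s v) sums (exp (of_real s * d) *s v)"
    by (intro sums_vecI) (simp add: sums_mult2[OF exp_converges] del: mult_scaleR_left)
  then show ?thesis using * sums_unique2 by blast
qed

text \<open>The linear map from the initial velocity of a normal geodesic to its horizontal position
  at time \<open>s\<close>. The integral form is used because \<open>A\<close> may be singular,
  which rules out dividing by \<open>2 A\<close>.\<close>

definition mexp_int :: "real^'q^'q \<Rightarrow> real \<Rightarrow> real^'q^'q" where
  "mexp_int A s = integral {0..s} (\<lambda>r. mexp ((2 * r) *\<^sub>R A))"

lemma mexp_int_has_integral:
  "((\<lambda>r. mexp ((2 * r) *\<^sub>R A)) has_integral mexp_int A s) {0..s}"
  unfolding mexp_int_def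
  by (rule integrable_integral[OF integrable_continuous_interval[OF continuous_on_mexp2]])

lemma mexp_int_mult: "mexp_int A s *v z = integral {0..s} (\<lambda>r. mexp ((2 * r) *\<^sub>R A) *v z)"
  using has_integral_linear[OF mexp_int_has_integral bounded_linear_matrix_vector_left[of z], of A s]
  by (simp add: o_def integral_unique)

lemma cmat_mexp_int_eigen:
  assumes "cmat A *v v = d *s v" and "s \<ge> 0"
  shows "cmat (mexp_int A s) *v v = (if d = 0 then of_real s else (exp (2 * of_real s * d) - 1) / (2 * d)) *s v"
    (is "_ = ?m s *s v")
proof -
  have *: "((\<lambda>r. cmat (mexp ((2 * r) *\<^sub>R A)) *v v) has_integral (cmat (mexp_int A s) *v v)) {0..s}"
    using has_integral_linear[OF mexp_int_has_integral bounded_linear_cmat_mult[of v], of A s]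
    by (simp add: o_def)
  have eq: "cmat (mexp ((2 * r) *\<^sub>R A)) *v v = exp (2 * of_real r * d) *s v" for r
    using cmat_mexp_eigen[OF assms(1), of "2 * r"] by simp
  have d: "(?m has_vector_derivative exp (2 * of_real r * d)) (at r within {0..s})" for r
  proof (cases "d = 0")
    case True
    then show ?thesis by (auto intro!: derivative_eq_intros)
  next
    case False
    have "((\<lambda>z. (exp (2 * z * d) - 1) / (2 * d)) has_field_derivative exp (2 * of_real r * d)) (at (of_real r))"
      using False by (auto intro!: derivative_eq_intros)
    then show ?thesis using False has_vector_derivative_real_field by fastforce
  qed
  have "((\<lambda>r. exp (2 * of_real r * d) *s v) has_integral (?m s *s v - ?m 0 *s v)) {0..s}"
    using assms(2)
    by (intro fundamental_theorem_of_calculus has_vector_derivative_vecI)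
      (auto intro!: has_vector_derivative_mult_left d simp: vector_smult_component simp del: divide_complex_def)
  from has_integral_unique[OF *[unfolded eq] this] show ?thesis by simp
qed

subsection \<open>Functional calculus in terms of real matrices\<close>

lemma cmat_eq_iff: "cmat A = cmat B \<longleftrightarrow> A = B"
  by (simp add: cmat_def vec_eq_iff)

lemma cmat_inverse_eigen:
  assumes "N ** M = mat 1" "cmat M *v v = m *s v" "v \<noteq> 0"
  shows "m \<noteq> 0" "cmat N *v v = inverse m *s v"
proof -
  have "v = cmat (N ** M) *v v" by (simp add: assms(1) cmat_mat_1)
  also have "\<dots> = m *s (cmat N *v v)"
    by (simp add: cmat_mult matrix_vector_mul_assoc[symmetric] assms(2) vector_scalar_commute)
  finally have *: "v = m *s (cmat N *v v)" .
  show "m \<noteq> 0" using * assms(3) by auto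
  then have "inverse m *s v = cmat N *v v"
    by (subst *) (simp add: vector_smult_assoc)
  then show "cmat N *v v = inverse m *s v" by simp
qed

text \<open>Half of the phase is pulled out of exp(-2isc) - 1, which leaves a sine; this is the
  source of all sines in the final formulas.\<close>

lemma mexp_int_eigen_Uc:
  assumes "Uc U \<tau> *v v = c *s v" "s \<ge> 0" "c \<noteq> 0"
  shows "cmat (mexp_int (Ut U \<tau>) s) *v v = (exp (- \<i> * of_real s * c) * sin (of_real s * c) / c) *s v"
proof -
  define p where "p = exp (\<i> * (of_real s * c))"
  have p: "p \<noteq> 0" "exp (- (\<i> * (of_real s * c))) = inverse p"
    by (simp_all add: p_def exp_minus)
  have "exp (2 * of_real s * (- \<i> * c)) = (exp (- (\<i> * (of_real s * c))))\<^sup>2"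
    by (simp add: exp_double[symmetric] algebra_simps)
  then have e: "exp (2 * of_real s * (- \<i> * c)) = inverse p ^ 2"
    by (simp add: p)
  have "(exp (2 * of_real s * (- \<i> * c)) - 1) / (2 * (- \<i> * c))
      = exp (- \<i> * of_real s * c) * sin (of_real s * c) / c"
    unfolding e sin_exp_eq using assms(3) p
    by (simp add: p_def[symmetric] mult.assoc) (simp add: field_simps power2_eq_square)
  then show ?thesis
    using cmat_mexp_int_eigen[of "Ut U \<tau>" v "- \<i> * c" s] assms by (simp add: Uc_eigen_iff)
qed

lemma mexp_int_eigen_Uc_0:
  assumes "Uc U \<tau> *v v = 0 *s v" "s \<ge> 0"
  shows "cmat (mexp_int (Ut U \<tau>) s) *v v = of_real s *s v"
  using cmat_mexp_int_eigen[of "Ut U \<tau>" v 0 s] assms Uc_eigen_iff[of U \<tau> v 0] by simp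

lemma mexp_eigen_Uc:
  assumes "Uc U \<tau> *v v = c *s v"
  shows "cmat (mexp (s *\<^sub>R Ut U \<tau>)) *v v = exp (- \<i> * of_real s * c) *s v"
  using cmat_mexp_eigen[of "Ut U \<tau>" v "- \<i> * c" s] assms
  by (simp add: Uc_eigen_iff mult_ac)

context
  fixes U :: "'m::finite \<Rightarrow> real^'q::finite^'q" and \<tau> :: "real^'m" and N :: "real^'q^'q"
  assumes sk: "skew (Ut U \<tau>)"
    and inv: "N ** mexp_int (Ut U \<tau>) 1 = mat 1"
begin

text \<open>Invertibility excludes nonzero eigenvalues in pi Z, where exp(-ic) sin(c)/c vanishes;
  hence the quotient in \<open>zsin\<close> is a genuine one on the spectrum.\<close>

lemma inverse_mexp_int_eigen_Uc:
  assumes "Uc U \<tau> *v v = c *s v" "v \<noteq> 0"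
  shows "c \<noteq> 0 \<Longrightarrow> sin c \<noteq> 0"
    and "cmat N *v v = (exp (\<i> * c) * zsin c) *s v"
proof -
  have "c \<noteq> 0 \<Longrightarrow> sin c \<noteq> 0 \<and> cmat N *v v = (exp (\<i> * c) * (c / sin c)) *s v"
  proof -
    assume c: "c \<noteq> 0"
    have "cmat (mexp_int (Ut U \<tau>) 1) *v v = (exp (- \<i> * c) * sin c / c) *s v"
      using mexp_int_eigen_Uc[OF assms(1) _ c, of 1] by simp
    from cmat_inverse_eigen[OF inv this assms(2)]
    show ?thesis using c by (simp add: exp_minus field_simps)
  qed
  moreover have "c = 0 \<Longrightarrow> cmat N *v v = v"
    using cmat_inverse_eigen(2)[OF inv mexp_int_eigen_Uc_0[where s = 1] assms(2)] assms(1) by simp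
  ultimately show "c \<noteq> 0 \<Longrightarrow> sin c \<noteq> 0" "cmat N *v v = (exp (\<i> * c) * zsin c) *s v"
    by (auto simp: zsin_def)
qed

text \<open>The real matrix on the right sends an end point \<open>x\<close> to
  \<open>Z 1 - A *v x\<close>, with \<open>Z 1\<close> the final velocity of the geodesic that
  reaches \<open>x\<close>; this is the boundary term of the energy identity. On an eigenvector,
  Euler's formula turns exp(-ic) c/sin(c) + ic into c cot(c).\<close>

lemma matfun_zcot: "matfun zcot (Uc U \<tau>) = cmat (mexp (2 *\<^sub>R Ut U \<tau>) ** N - Ut U \<tau>)"
proof (rule matfun_Uc_eqI[OF sk])
  fix v c assume v: "v \<noteq> 0" and e: "Uc U \<tau> *v v = c *s v"
  have "cmat (mexp (2 *\<^sub>R Ut U \<tau>) ** N - Ut U \<tau>) *v v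
      = (exp (\<i> * c) * zsin c * exp (- \<i> * 2 * c) + \<i> * c) *s v"
  proof -
    have "cmat (mexp (2 *\<^sub>R Ut U \<tau>) ** N - Ut U \<tau>) *v v
        = cmat (mexp (2 *\<^sub>R Ut U \<tau>)) *v (cmat N *v v) - cmat (Ut U \<tau>) *v v"
      by (simp add: linear_diff[OF bounded_linear.linear[OF bounded_linear_cmat_mult]] cmat_mult
          matrix_vector_mul_assoc)
    also have "\<dots> = (exp (\<i> * c) * zsin c) *s (exp (- \<i> * of_real 2 * c) *s v) - (- \<i> * c) *s v"
      using mexp_eigen_Uc[OF e, of 2] e
      unfolding inverse_mexp_int_eigen_Uc(2)[OF e v] Uc_eigen_iff vector_scalar_commute by simp
    finally show ?thesis by (simp add: vec_eq_iff algebra_simps)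
  qed
  also have "exp (\<i> * c) * zsin c * exp (- \<i> * 2 * c) + \<i> * c = zcot c"
  proof (cases "c = 0")
    case False
    then have s: "sin c \<noteq> 0" using inverse_mexp_int_eigen_Uc(1)[OF e v] by simp
    have "exp (\<i> * c) * exp (- \<i> * 2 * c) = exp (- \<i> * c)"
      by (simp add: exp_add[symmetric])
    also have "\<dots> = cos c - \<i> * sin c" using exp_Euler[of "- c"] by simp
    finally have "exp (\<i> * c) * zsin c * exp (- \<i> * 2 * c) = (cos c - \<i> * sin c) * zsin c"
      by (simp add: mult_ac)
    then show ?thesis using False s by (simp add: zsin_def zcot_def field_simps)
  qed (simp add: zsin_def zcot_def)
  finally show "cmat (mexp (2 *\<^sub>R Ut U \<tau>) ** N - Ut U \<tau>) *v v = zcot c *s v" .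
qed

lemma matfun_zsin: "matfun zsin (Uc U \<tau>) = cmat (mexp (Ut U \<tau>) ** N)"
proof (rule matfun_Uc_eqI[OF sk])
  fix v c assume v: "v \<noteq> 0" and e: "Uc U \<tau> *v v = c *s v"
  have "exp (\<i> * c) * exp (- \<i> * c) = 1" by (simp add: exp_add[symmetric])
  then show "cmat (mexp (Ut U \<tau>) ** N) *v v = zsin c *s v"
    using mexp_eigen_Uc[OF e, of 1] inverse_mexp_int_eigen_Uc(2)[OF e v]
    by (simp add: cmat_mult matrix_vector_mul_assoc[symmetric] vector_scalar_commute)
qed

text \<open>The phases of the three factors, exp(-isc), exp(ic) and exp(-i(1-s)c), multiply to 1, so
  only the quotient of sines remains.\<close>

lemma matfun_sinratio:
  assumes "s \<ge> 0"
  shows "matfun (sinratio s) (Uc U \<tau>) = cmat (mexp_int (Ut U \<tau>) s ** N ** mexp ((1 - s) *\<^sub>R Ut U \<tau>))"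
proof (rule matfun_Uc_eqI[OF sk])
  fix v c assume v: "v \<noteq> 0" and e: "Uc U \<tau> *v v = c *s v"
  define m where "m = (if c = 0 then of_real s else exp (- \<i> * of_real s * c) * sin (of_real s * c) / c)"
  have m: "cmat (mexp_int (Ut U \<tau>) s) *v v = m *s v"
    using mexp_int_eigen_Uc[OF e assms] mexp_int_eigen_Uc_0[of U \<tau> v s] assms e by (auto simp: m_def)
  have "cmat (mexp_int (Ut U \<tau>) s ** N ** mexp ((1 - s) *\<^sub>R Ut U \<tau>)) *v v
      = (exp (- \<i> * of_real (1 - s) * c) * (exp (\<i> * c) * zsin c) * m) *s v"
    using mexp_eigen_Uc[OF e, of "1 - s"] inverse_mexp_int_eigen_Uc(2)[OF e v] m
    by (simp add: cmat_mult matrix_vector_mul_assoc[symmetric] vector_scalar_commute mult_ac)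
  also have "exp (- \<i> * of_real (1 - s) * c) * (exp (\<i> * c) * zsin c) * m = sinratio s c"
  proof (cases "c = 0")
    case False
    have "exp (- \<i> * of_real (1 - s) * c) * exp (\<i> * c) * exp (- \<i> * of_real s * c) = 1"
      by (simp add: exp_add[symmetric] algebra_simps)
    moreover have ac: "a * (b * z) * (d * t / e) = (a * b * d) * (z * (t / e))" for a b z d t e :: complex
      by (simp add: mult_ac)
    ultimately have "exp (- \<i> * of_real (1 - s) * c) * (exp (\<i> * c) * zsin c) *
        (exp (- \<i> * of_real s * c) * sin (of_real s * c) / c) = zsin c * (sin (of_real s * c) / c)"
      using ac[of "exp (- \<i> * of_real (1 - s) * c)" "exp (\<i> * c)" "zsin c"
          "exp (- \<i> * of_real s * c)" "sin (of_real s * c)" c] by simp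
    then show ?thesis using False by (simp add: m_def zsin_def sinratio_def)
  qed (simp add: zsin_def sinratio_def m_def)
  finally show "cmat (mexp_int (Ut U \<tau>) s ** N ** mexp ((1 - s) *\<^sub>R Ut U \<tau>)) *v v = sinratio s c *s v" .
qed

text \<open>Checked on eigenvectors, where it is the scalar addition law; no Cauchy product of
  matrix series is formed.\<close>

lemma mexp_mult_mexp: "mexp (a *\<^sub>R Ut U \<tau>) ** mexp (b *\<^sub>R Ut U \<tau>) = mexp ((a + b) *\<^sub>R Ut U \<tau>)"
proof -
  have "cmat (mexp (a *\<^sub>R Ut U \<tau>) ** mexp (b *\<^sub>R Ut U \<tau>)) = cmat (mexp ((a + b) *\<^sub>R Ut U \<tau>))"
  proof (rule matrix_eq_on_eigenvectors[OF sk])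
    fix v c assume e: "Uc U \<tau> *v v = c *s v"
    have "exp (- \<i> * of_real b * c) * exp (- \<i> * of_real a * c) = exp (- \<i> * of_real (a + b) * c)"
      by (simp add: exp_add[symmetric] algebra_simps)
    then show "cmat (mexp (a *\<^sub>R Ut U \<tau>) ** mexp (b *\<^sub>R Ut U \<tau>)) *v v = cmat (mexp ((a + b) *\<^sub>R Ut U \<tau>)) *v v"
      using mexp_eigen_Uc[OF e, of a] mexp_eigen_Uc[OF e, of b] mexp_eigen_Uc[OF e, of "a + b"]
      by (simp add: cmat_mult matrix_vector_mul_assoc[symmetric] vector_scalar_commute)
  qed
  then show ?thesis by (simp add: cmat_eq_iff)
qed

lemma inverse_mexp_int_commute: "N ** mexp (a *\<^sub>R Ut U \<tau>) = mexp (a *\<^sub>R Ut U \<tau>) ** N"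
proof -
  have "cmat (N ** mexp (a *\<^sub>R Ut U \<tau>)) = cmat (mexp (a *\<^sub>R Ut U \<tau>) ** N)"
  proof (rule matrix_eq_on_eigenvectors[OF sk])
    fix v c assume v: "v \<noteq> 0" and e: "Uc U \<tau> *v v = c *s v"
    show "cmat (N ** mexp (a *\<^sub>R Ut U \<tau>)) *v v = cmat (mexp (a *\<^sub>R Ut U \<tau>) ** N) *v v"
      using mexp_eigen_Uc[OF e, of a] inverse_mexp_int_eigen_Uc(2)[OF e v]
      by (simp add: cmat_mult matrix_vector_mul_assoc[symmetric] vector_scalar_commute mult_ac)
  qed
  then show ?thesis by (simp add: cmat_eq_iff)
qed

lemma matfun_sinratio_mexp:
  assumes "s \<ge> 0"
  shows "matfun (sinratio s) (Uc U \<tau>) *v cvec (mexp ((s - 1) *\<^sub>R Ut U \<tau>) *v x)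
    = cvec (mexp_int (Ut U \<tau>) s *v (N *v x))"
proof -
  have "mexp ((1 - s) *\<^sub>R Ut U \<tau>) *v (mexp ((s - 1) *\<^sub>R Ut U \<tau>) *v x) = x"
    by (simp add: matrix_vector_mul_assoc mexp_mult_mexp)
  then show ?thesis
    by (simp add: matfun_sinratio[OF assms] cmat_mult_cvec matrix_vector_mul_assoc[symmetric])
qed

lemma matfun_zsin_mexp:
  "matfun zsin (Uc U \<tau>) *v cvec (mexp ((2 * s - 1) *\<^sub>R Ut U \<tau>) *v x)
    = cvec (mexp ((2 * s) *\<^sub>R Ut U \<tau>) *v (N *v x))"
proof -
  have "mexp (Ut U \<tau>) ** N ** mexp ((2 * s - 1) *\<^sub>R Ut U \<tau>) = mexp ((2 * s) *\<^sub>R Ut U \<tau>) ** N"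
    using mexp_mult_mexp[of 1 "2 * s - 1"]
    by (simp add: inverse_mexp_int_commute matrix_mul_assoc[symmetric])
      (simp add: matrix_mul_assoc)
  then show ?thesis by (simp add: matfun_zsin cmat_mult_cvec matrix_vector_mul_assoc)
qed

lemma phi_eq:
  "phi U (x, t) \<tau> = (mexp (2 *\<^sub>R Ut U \<tau>) *v (N *v x) - Ut U \<tau> *v x) \<bullet> x + 4 * (t \<bullet> \<tau>)"
  by (simp add: phi_def matfun_zcot cmat_mult_cvec Re_cinner_cvec matrix_vector_mult_diff_rdistrib
      matrix_vector_mul_assoc)

end

subsection \<open>The fundamental theorem of calculus for absolutely continuous functions\<close>

text \<open>The definition of absolute continuity indexes its intervals by initial segments of the
  naturals, whereas divisions and tagged divisions are finite sets; an enumeration bridges the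
  two.\<close>

lemma abs_cont_on_finite_family:
  fixes f :: "real \<Rightarrow> 'a::real_normed_vector"
  assumes "abs_cont_on a b f" "\<epsilon> > 0"
  shows "\<exists>\<delta>>0. \<forall>(J::'i set) l r. finite J \<longrightarrow> (\<forall>i\<in>J. a \<le> l i \<and> l i \<le> r i \<and> r i \<le> b) \<longrightarrow>
      (\<forall>i\<in>J. \<forall>j\<in>J. i \<noteq> j \<longrightarrow> r i \<le> l j \<or> r j \<le> l i) \<longrightarrow> (\<Sum>i\<in>J. r i - l i) < \<delta> \<longrightarrow>
      (\<Sum>i\<in>J. norm (f (r i) - f (l i))) < \<epsilon>"
proof -
  obtain \<delta> where \<delta>: "\<delta> > 0" and
    H: "\<forall>(n::nat) l r. (\<forall>i<n. a \<le> l i \<and> l i \<le> r i \<and> r i \<le> b) \<and>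
        (\<forall>i<n. \<forall>j<n. i \<noteq> j \<longrightarrow> r i \<le> l j \<or> r j \<le> l i) \<and>
        (\<Sum>i<n. r i - l i) < \<delta> \<longrightarrow> (\<Sum>i<n. norm (f (r i) - f (l i))) < \<epsilon>"
    using assms(1)[unfolded abs_cont_on_def, rule_format, OF assms(2)] by (elim exE conjE)
  show ?thesis
  proof (intro exI[of _ \<delta>] conjI \<delta> allI impI)
    fix J :: "'i set" and l r
    assume fin: "finite J" and 1: "\<forall>i\<in>J. a \<le> l i \<and> l i \<le> r i \<and> r i \<le> b"
      and 2: "\<forall>i\<in>J. \<forall>j\<in>J. i \<noteq> j \<longrightarrow> r i \<le> l j \<or> r j \<le> l i" and 3: "(\<Sum>i\<in>J. r i - l i) < \<delta>"
    obtain h where h: "bij_betw h {0..<card J} J" using ex_bij_betw_nat_finite[OF fin] by blast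
    then have hJ: "\<And>i. i < card J \<Longrightarrow> h i \<in> J" and inj: "inj_on h {0..<card J}"
      by (auto simp: bij_betw_def)
    have S: "(\<Sum>i\<in>J. g i) = (\<Sum>i<card J. g (h i))" for g :: "'i \<Rightarrow> real"
      using sum.reindex_bij_betw[OF h, of g] by (simp add: atLeast0LessThan)
    show "(\<Sum>i\<in>J. norm (f (r i) - f (l i))) < \<epsilon>"
      unfolding S
    proof (rule H[THEN spec, of "card J", THEN spec, of "\<lambda>i. l (h i)", THEN spec, of "\<lambda>i. r (h i)", THEN mp], intro conjI)
      show "\<forall>i<card J. \<forall>j<card J. i \<noteq> j \<longrightarrow> r (h i) \<le> l (h j) \<or> r (h j) \<le> l (h i)"
      proof (intro allI impI)
        fix i j assume "i < card J" "j < card J" "i \<noteq> j"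
        then show "r (h i) \<le> l (h j) \<or> r (h j) \<le> l (h i)"
          using 2 hJ inj_onD[OF inj, of i j] by auto
      qed
    qed (use 1 3 hJ S in auto)
  qed
qed

lemma intervals_separated:
  fixes l r l' r' :: real
  assumes "interior {l..r} \<inter> interior {l'..r'} = {}" "l < r" "l' < r'"
  shows "r \<le> l' \<or> r' \<le> l"
proof (rule ccontr)
  assume "\<not> ?thesis"
  then have "max l l' < min r r'" using assms by auto
  then obtain x where "max l l' < x" "x < min r r'" using dense by blast
  then have "x \<in> interior {l..r} \<inter> interior {l'..r'}" by (simp add: interior_atLeastAtMost_real)
  then show False using assms(1) by blast
qed

text \<open>Gauge argument. A tag in \<open>N\<close> gets a ball inside an open set
  \<open>W\<close> of measure below \<open>\<delta>\<close>, so absolute continuity makes the total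
  increment over such intervals small. At every other tag the ball comes from differentiability,
  with an error proportional to the length of the interval.\<close>

theorem abs_cont_on_has_integral:
  fixes f :: "real \<Rightarrow> 'a::real_normed_vector"
  assumes ac: "abs_cont_on a b f" and neg: "negligible N" and ab: "a \<le> b"
    and der: "\<And>s. s \<in> {a..b} - N \<Longrightarrow> (f has_vector_derivative v s) (at s within {a..b})"
  shows "(v has_integral f b - f a) {a..b}"
proof -
  \<comment> \<open>With value 0 on \<open>N\<close>, a tag in \<open>N\<close> contributes nothing
    but the increment of \<open>f\<close>.\<close>
  define v' where "v' s = (if s \<in> N then 0 else v s)" for s
  have "(v' has_integral f b - f a) {a..b}"
    unfolding has_integral_real
  proof (intro allI impI)
    fix e :: real assume e: "e > 0"
    obtain \<delta> where \<delta>: "\<delta> > 0" and D: "\<forall>(J::(real \<times> real set) set) l r. finite J \<longrightarrow>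
        (\<forall>i\<in>J. a \<le> l i \<and> l i \<le> r i \<and> r i \<le> b) \<longrightarrow>
        (\<forall>i\<in>J. \<forall>j\<in>J. i \<noteq> j \<longrightarrow> r i \<le> l j \<or> r j \<le> l i) \<longrightarrow> (\<Sum>i\<in>J. r i - l i) < \<delta> \<longrightarrow>
        (\<Sum>i\<in>J. norm (f (r i) - f (l i))) < e / 2"
      using abs_cont_on_finite_family[OF ac half_gt_zero[OF e], where ?'i = "real \<times> real set"]
      by (elim exE conjE)
    have N: "N \<in> lmeasurable" "measure lebesgue N = 0"
      using neg by (auto simp: negligible_iff_measure)
    then obtain W where W: "open W" "N \<subseteq> W" "W - N \<in> lmeasurable" "emeasure lebesgue (W - N) < ennreal \<delta>"
      using sets_lebesgue_outer_open[of N \<delta>] \<delta> by (auto simp: fmeasurable_def)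
    have "W = (W - N) \<union> N" using W(2) by blast
    then have Wm: "W \<in> lmeasurable" using fmeasurable.Un[OF W(3) N(1)] by metis
    have "measure lebesgue W \<le> measure lebesgue (W - N) + measure lebesgue N"
      using measure_Un_le[of "W - N" lebesgue N] W(3) N(1) \<open>W = (W - N) \<union> N\<close>
      by (metis fmeasurableD)
    also have "\<dots> < \<delta>"
      using W(4) N(2) \<delta> emeasure_eq_measure2[OF W(3)] by (simp add: ennreal_less_iff)
    finally have W4: "measure lebesgue W < \<delta>" .
    \<comment> \<open>Chosen so that \<open>\<eta> * (b - a) < e / 2\<close>; the added 1 covers
      \<open>a = b\<close>.\<close>
    define \<eta> where "\<eta> = e / (2 * (b - a + 1))"
    have \<eta>: "\<eta> > 0" using e ab by (simp add: \<eta>_def)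
    have "\<exists>d>0. (s \<in> N \<longrightarrow> ball s d \<subseteq> W) \<and> (s \<in> {a..b} - N \<longrightarrow>
        (\<forall>y\<in>{a..b}. \<bar>y - s\<bar> < d \<longrightarrow> norm (f y - f s - (y - s) *\<^sub>R v s) \<le> \<eta> * \<bar>y - s\<bar>))" for s
    proof (cases "s \<in> N")
      case True
      then show ?thesis using W openE[of W s] by blast
    next
      case False
      show ?thesis
      proof (cases "s \<in> {a..b}")
        case True
        then have "(f has_derivative (\<lambda>h. h *\<^sub>R v s)) (at s within {a..b})"
          using der False by (simp add: has_vector_derivative_def)
        then have "\<exists>d>0. \<forall>y\<in>{a..b}. norm (y - s) < d \<longrightarrow> norm (f y - f s - (y - s) *\<^sub>R v s) \<le> \<eta> * norm (y - s)"
          using \<eta> unfolding has_derivative_within_alt by blast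
        then show ?thesis using False by auto
      qed (use False zero_less_one in blast)
    qed
    then obtain d where d: "\<And>s. d s > 0" "\<And>s. s \<in> N \<Longrightarrow> ball s (d s) \<subseteq> W"
      "\<And>s y. s \<in> {a..b} - N \<Longrightarrow> y \<in> {a..b} \<Longrightarrow> \<bar>y - s\<bar> < d s \<Longrightarrow>
         norm (f y - f s - (y - s) *\<^sub>R v s) \<le> \<eta> * \<bar>y - s\<bar>"
      by metis
    show "\<exists>\<gamma>. gauge \<gamma> \<and> (\<forall>\<D>. \<D> tagged_division_of {a..b} \<and> \<gamma> fine \<D> \<longrightarrow>
        norm ((\<Sum>(x, k)\<in>\<D>. measure lborel k *\<^sub>R v' x) - (f b - f a)) < e)"
    proof (intro exI[of _ "\<lambda>s. ball s (d s)"] conjI allI impI)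
      show "gauge (\<lambda>s. ball s (d s))" using d(1) by (simp add: gauge_ball_dependent)
      fix p assume "p tagged_division_of {a..b} \<and> (\<lambda>s. ball s (d s)) fine p"
      then have p: "p tagged_division_of {a..b}" and fine: "(\<lambda>s. ball s (d s)) fine p" by auto
      have finp: "finite p" using p by blast
      have K: "\<exists>l r. k = {l..r} \<and> l \<le> r \<and> Inf k = l \<and> Sup k = r \<and> x \<in> {l..r} \<and> a \<le> l \<and> r \<le> b
          \<and> measure lborel k = r - l \<and> {l..r} \<subseteq> ball x (d x)"
        if xk: "(x, k) \<in> p" for x k
      proof -
        obtain l r where k: "k = cbox l r" using p xk by blast
        have "x \<in> k" "k \<subseteq> {a..b}" using p xk by blast+
        moreover have "k \<subseteq> ball x (d x)" using fine xk by (auto simp: fine_def)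
        ultimately show ?thesis using k by (intro exI[of _ l] exI[of _ r]) auto
      qed
      define T where "T = (\<lambda>(x, k). measure lborel k *\<^sub>R v' x - (f (Sup k) - f (Inf k)))"
      \<comment> \<open>Degenerate intervals are left out: a single point may lie strictly inside
        another interval although the interiors are disjoint, which would destroy the ordering that
        absolute continuity asks for. Their error terms vanish anyway.\<close>
      define Q where "Q = {z\<in>p. fst z \<in> N \<and> measure lborel (snd z) > 0}"
      have "(\<Sum>(x, k)\<in>p. measure lborel k *\<^sub>R v' x) - (f b - f a) = (\<Sum>z\<in>p. T z)"
        unfolding additive_tagged_division_1[OF ab p, of f, symmetric] T_def
        by (simp add: sum_subtractf[symmetric] case_prod_unfold)
      also have "norm \<dots> \<le> (\<Sum>z\<in>p. norm (T z))" by (rule norm_sum)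
      also have "\<dots> = (\<Sum>z\<in>p - Q. norm (T z)) + (\<Sum>z\<in>Q. norm (T z))"
        by (rule sum.subset_diff) (auto simp: Q_def finp)
      also have "(\<Sum>z\<in>p - Q. norm (T z)) \<le> (\<Sum>z\<in>p - Q. \<eta> * measure lborel (snd z))"
      proof (rule sum_mono)
        fix z assume z: "z \<in> p - Q"
        obtain x k where zk: "z = (x, k)" by force
        obtain l r where k: "k = {l..r}" "l \<le> r" "Inf k = l" "Sup k = r" "x \<in> {l..r}" "a \<le> l" "r \<le> b"
          "measure lborel k = r - l" "{l..r} \<subseteq> ball x (d x)"
          using K z zk by blast
        show "norm (T z) \<le> \<eta> * measure lborel (snd z)"
        proof (cases "l = r")
          case True then show ?thesis using k zk by (simp add: T_def)
        next
          case False
          then have "x \<notin> N" using z zk k by (simp add: Q_def)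
          have "\<bar>l - x\<bar> < d x" "\<bar>r - x\<bar> < d x"
            using k(2,9) by (auto simp: subset_iff dist_real_def abs_minus_commute)
          then have "norm (f l - f x - (l - x) *\<^sub>R v x) \<le> \<eta> * (x - l)"
              "norm (f r - f x - (r - x) *\<^sub>R v x) \<le> \<eta> * (r - x)"
            using d(3)[of x l] d(3)[of x r] k \<open>x \<notin> N\<close> by auto
          moreover have "T z = (f l - f x - (l - x) *\<^sub>R v x) - (f r - f x - (r - x) *\<^sub>R v x)"
            using k zk \<open>x \<notin> N\<close> by (simp add: T_def v'_def algebra_simps)
          ultimately have "norm (T z) \<le> \<eta> * (x - l) + \<eta> * (r - x)"
            by (metis (no_types, lifting) add_mono norm_triangle_ineq4 order_trans)
          then show ?thesis using k zk by (simp add: algebra_simps)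
        qed
      qed
      also have "\<dots> \<le> (\<Sum>z\<in>p. \<eta> * measure lborel (snd z))"
        using finp \<eta> by (intro sum_mono2) auto
      also have "\<dots> = \<eta> * (b - a)"
        using additive_content_tagged_division[of p a b] p ab
        by (simp add: sum_distrib_left[symmetric] case_prod_unfold)
      also have "\<dots> < e / 2"
        using e ab by (simp add: \<eta>_def field_simps)
      also have "(\<Sum>z\<in>Q. norm (T z)) < e / 2"
      proof -
        have Qp: "finite Q" "Q \<subseteq> p" using finp by (auto simp: Q_def)
        define l where "l z = Inf (snd z)" for z :: "real \<times> real set"
        define r where "r z = Sup (snd z)" for z :: "real \<times> real set"
        have lr: "snd z = {l z..r z} \<and> l z < r z \<and> a \<le> l z \<and> r z \<le> b \<and> {l z..r z} \<subseteq> W" if "z \<in> Q" for z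
        proof -
          obtain x k where zk: "z = (x, k)" by force
          then have xk: "(x, k) \<in> p" "x \<in> N" "measure lborel k > 0" using that by (auto simp: Q_def)
          show ?thesis using K[OF xk(1)] d(2)[OF xk(2)] xk(3) zk by (auto simp: l_def r_def)
        qed
        have sep: "\<forall>y\<in>Q. \<forall>z\<in>Q. y \<noteq> z \<longrightarrow> r y \<le> l z \<or> r z \<le> l y"
        proof (intro ballI impI)
          fix y z assume yz: "y \<in> Q" "z \<in> Q" "y \<noteq> z"
          have "interior (snd y) \<inter> interior (snd z) = {}"
            using tagged_division_ofD(5)[OF p, of "fst y" "snd y" "fst z" "snd z"] yz Qp by auto
          then show "r y \<le> l z \<or> r z \<le> l y" using lr yz intervals_separated by metis
        qed
        have "(\<Sum>z\<in>Q. r z - l z) = (\<Sum>z\<in>Q. measure lebesgue {l z<..<r z})"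
          using lr by (intro sum.cong) (auto simp: less_imp_le)
        also have "\<dots> = measure lebesgue (\<Union>z\<in>Q. {l z<..<r z})"
        proof (rule measure_finite_Union[symmetric])
          show "disjoint_family_on (\<lambda>z. {l z<..<r z}) Q"
            unfolding disjoint_family_on_def
          proof (intro ballI impI)
            fix y z assume "y \<in> Q" "z \<in> Q" "y \<noteq> z"
            then show "{l y<..<r y} \<inter> {l z<..<r z} = {}" using sep by fastforce
          qed
        next
          fix z assume "z \<in> Q"
          then have "l z \<le> r z" using lr less_imp_le by blast
          then show "emeasure lebesgue {l z<..<r z} \<noteq> \<infinity>" by simp
        qed (use Qp in auto)
        also have "\<dots> \<le> measure lebesgue W"
        proof (rule measure_mono_fmeasurable)
          have "{l z<..<r z} \<subseteq> W" if "z \<in> Q" for z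
            using lr[OF that] greaterThanLessThan_subseteq_atLeastAtMost_iff by fastforce
          then show "(\<Union>z\<in>Q. {l z<..<r z}) \<subseteq> W" by blast
          show "(\<Union>z\<in>Q. {l z<..<r z}) \<in> sets lebesgue"
            using Qp by (intro sets.finite_UN) auto
        qed (rule Wm)
        finally have "(\<Sum>z\<in>Q. r z - l z) < \<delta>" using W4 by simp
        then have "(\<Sum>z\<in>Q. norm (f (r z) - f (l z))) < e / 2"
          using lr sep Qp by (intro D[rule_format]) (auto simp: less_imp_le)
        moreover have "norm (T z) = norm (f (r z) - f (l z))" if "z \<in> Q" for z
          using that by (cases z) (auto simp: T_def v'_def Q_def r_def l_def norm_minus_commute)
        ultimately show ?thesis by simp
      qed
      finally show "norm ((\<Sum>(x, k)\<in>p. measure lborel k *\<^sub>R v' x) - (f b - f a)) < e" by simp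
    qed
  qed
  then show ?thesis
    by (rule has_integral_spike[OF neg, rotated]) (simp add: v'_def)
qed

lemma abs_cont_on_subinterval:
  "abs_cont_on a b f \<Longrightarrow> a \<le> c \<Longrightarrow> d \<le> b \<Longrightarrow> abs_cont_on c d f"
  unfolding abs_cont_on_def
proof (intro allI impI)
  fix \<epsilon> :: real
  assume H: "\<forall>\<epsilon>>0. \<exists>\<delta>>0. \<forall>(n::nat) l r. (\<forall>i<n. a \<le> l i \<and> l i \<le> r i \<and> r i \<le> b) \<and>
      (\<forall>i<n. \<forall>j<n. i \<noteq> j \<longrightarrow> r i \<le> l j \<or> r j \<le> l i) \<and> (\<Sum>i<n. r i - l i) < \<delta> \<longrightarrow>
      (\<Sum>i<n. norm (f (r i) - f (l i))) < \<epsilon>" and "a \<le> c" "d \<le> b" "\<epsilon> > 0"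
  obtain \<delta> where "\<delta> > 0" and
    D: "\<forall>(n::nat) l r. (\<forall>i<n. a \<le> l i \<and> l i \<le> r i \<and> r i \<le> b) \<and>
        (\<forall>i<n. \<forall>j<n. i \<noteq> j \<longrightarrow> r i \<le> l j \<or> r j \<le> l i) \<and>
        (\<Sum>i<n. r i - l i) < \<delta> \<longrightarrow> (\<Sum>i<n. norm (f (r i) - f (l i))) < \<epsilon>"
    using H[rule_format, OF \<open>\<epsilon> > 0\<close>] by (elim exE conjE)
  show "\<exists>\<delta>>0. \<forall>(n::nat) l r. (\<forall>i<n. c \<le> l i \<and> l i \<le> r i \<and> r i \<le> d) \<and>
      (\<forall>i<n. \<forall>j<n. i \<noteq> j \<longrightarrow> r i \<le> l j \<or> r j \<le> l i) \<and> (\<Sum>i<n. r i - l i) < \<delta> \<longrightarrow>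
      (\<Sum>i<n. norm (f (r i) - f (l i))) < \<epsilon>"
  proof (intro exI[of _ \<delta>] conjI \<open>\<delta> > 0\<close> allI impI)
    fix n :: nat and l r :: "nat \<Rightarrow> real"
    assume "(\<forall>i<n. c \<le> l i \<and> l i \<le> r i \<and> r i \<le> d) \<and>
      (\<forall>i<n. \<forall>j<n. i \<noteq> j \<longrightarrow> r i \<le> l j \<or> r j \<le> l i) \<and> (\<Sum>i<n. r i - l i) < \<delta>"
    then show "(\<Sum>i<n. norm (f (r i) - f (l i))) < \<epsilon>"
      using \<open>a \<le> c\<close> \<open>d \<le> b\<close>
      by (intro D[THEN spec, of n, THEN spec, of l, THEN spec, of r, THEN mp]) fastforce
  qed
qed

text \<open>Absolute continuity with tolerance 1 bounds the sum of |integral of \<open>v\<close>|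
  over any division of an interval shorter than \<open>\<delta>\<close> by 1. Bounded variation of
  the indefinite integral gives absolute integrability there, and finitely many such intervals are
  joined.\<close>

theorem abs_cont_on_absolutely_integrable:
  fixes f :: "real \<Rightarrow> 'a::euclidean_space"
  assumes ac: "abs_cont_on a b f" and neg: "negligible N" and ab: "a \<le> b"
    and der: "\<And>s. s \<in> {a..b} - N \<Longrightarrow> (f has_vector_derivative v s) (at s within {a..b})"
  shows "v absolutely_integrable_on {a..b}"
proof -
  have int: "(v has_integral f d - f c) {c..d}" if "a \<le> c" "c \<le> d" "d \<le> b" for c d
    using that
    by (intro abs_cont_on_has_integral[OF abs_cont_on_subinterval[OF ac] neg])
      (auto intro!: has_vector_derivative_within_subset[OF der])
  obtain \<delta> where \<delta>: "\<delta> > 0" and D: "\<forall>(J::(real set) set) l r. finite J \<longrightarrow>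
      (\<forall>i\<in>J. a \<le> l i \<and> l i \<le> r i \<and> r i \<le> b) \<longrightarrow>
      (\<forall>i\<in>J. \<forall>j\<in>J. i \<noteq> j \<longrightarrow> r i \<le> l j \<or> r j \<le> l i) \<longrightarrow> (\<Sum>i\<in>J. r i - l i) < \<delta> \<longrightarrow>
      (\<Sum>i\<in>J. norm (f (r i) - f (l i))) < 1"
    using abs_cont_on_finite_family[OF ac zero_less_one, where ?'i = "real set"]
    by (elim exE conjE)
  have short: "v absolutely_integrable_on {c..d}" if cd: "a \<le> c" "c \<le> d" "d \<le> b" "d - c < \<delta>" for c d
    unfolding box_real[symmetric]
  proof (rule bounded_variation_absolutely_integrable_interval[where B = 1])
    show "v integrable_on cbox c d" using int[of c d] cd by auto
    fix \<D> assume div: "\<D> division_of cbox c d"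
    define J where "J = {K\<in>\<D>. measure lborel K > 0}"
    have fin: "finite \<D>" using div by blast
    have K: "\<exists>l r. K = {l..r} \<and> l \<le> r \<and> Inf K = l \<and> Sup K = r \<and> c \<le> l \<and> r \<le> d \<and> measure lborel K = r - l
        \<and> integral K v = f r - f l" if KD: "K \<in> \<D>" for K
    proof -
      obtain l r where k: "K = cbox l r" using division_ofD(4)[OF div KD] by blast
      have "K \<noteq> {}" "K \<subseteq> {c..d}"
        using division_ofD(2,3)[OF div KD] by auto
      then have lr: "l \<le> r" "c \<le> l" "r \<le> d" using k by auto
      then have "integral K v = f r - f l" using k int[of l r] cd by (simp add: integral_unique)
      then show ?thesis using k lr by (intro exI[of _ l] exI[of _ r]) simp
    qed
    have JK: "K = {Inf K..Sup K} \<and> Inf K < Sup K \<and> c \<le> Inf K \<and> Sup K \<le> d \<and> measure lborel K = Sup K - Inf K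
        \<and> integral K v = f (Sup K) - f (Inf K)" if "K \<in> J" for K
    proof -
      have "K \<in> \<D>" "measure lborel K > 0" using that by (auto simp: J_def)
      with K obtain l r where "K = {l..r}" "Inf K = l" "Sup K = r" "c \<le> l" "r \<le> d"
        "measure lborel K = r - l" "integral K v = f r - f l" by force
      with \<open>measure lborel K > 0\<close> show ?thesis by simp
    qed
    have "(\<Sum>K\<in>J. norm (f (Sup K) - f (Inf K))) < 1"
    proof (rule D[THEN spec, THEN spec, THEN spec, THEN mp, THEN mp, THEN mp, THEN mp])
      have "(\<Sum>K\<in>J. Sup K - Inf K) = (\<Sum>K\<in>J. measure lborel K)"
        using JK by (intro sum.cong) auto
      also have "\<dots> \<le> (\<Sum>K\<in>\<D>. measure lborel K)" using fin by (intro sum_mono2) (auto simp: J_def)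
      also have "\<dots> = d - c" using additive_content_division[OF div] cd by simp
      finally show "(\<Sum>K\<in>J. Sup K - Inf K) < \<delta>" using cd by simp
      show "\<forall>i\<in>J. \<forall>j\<in>J. i \<noteq> j \<longrightarrow> Sup i \<le> Inf j \<or> Sup j \<le> Inf i"
      proof (intro ballI impI)
        fix i j assume ij: "i \<in> J" "j \<in> J" "i \<noteq> j"
        have "interior i \<inter> interior j = {}"
          using division_ofD(5)[OF div, of i j] ij by (auto simp: J_def)
        then show "Sup i \<le> Inf j \<or> Sup j \<le> Inf i"
          using JK[OF ij(1)] JK[OF ij(2)] intervals_separated by metis
      qed
    qed (use JK fin cd in \<open>auto simp: J_def intro: less_imp_le order_trans\<close>)
    moreover have "(\<Sum>K\<in>\<D>. norm (integral K v)) = (\<Sum>K\<in>J. norm (f (Sup K) - f (Inf K)))"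
    proof -
      have "(\<Sum>K\<in>J. norm (f (Sup K) - f (Inf K))) = (\<Sum>K\<in>J. norm (integral K v))"
        using JK by (intro sum.cong) auto
      also have "\<dots> = (\<Sum>K\<in>\<D>. norm (integral K v))"
      proof (rule sum.mono_neutral_left[OF fin])
        show "\<forall>i\<in>\<D> - J. norm (integral i v) = 0"
        proof
          fix i assume "i \<in> \<D> - J"
          then show "norm (integral i v) = 0" using K[of i] by (auto simp: J_def)
        qed
      qed (auto simp: J_def)
      finally show ?thesis by simp
    qed
    ultimately show "(\<Sum>K\<in>\<D>. norm (integral K v)) \<le> 1" by simp
  qed
  define h where "h = \<delta> / 2"
  have "v absolutely_integrable_on {a..min b (a + real n * h)}" for n
  proof (induction n)
    case 0
    show ?case using short[of a a] ab \<delta> by simp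
  next
    case (Suc n)
    let ?c = "min b (a + real n * h)" and ?d = "min b (a + real (Suc n) * h)"
    have "h > 0" using \<delta> by (simp add: h_def)
    have "v absolutely_integrable_on {?c..?d}"
      using ab \<delta> by (intro short) (auto simp: h_def min_def field_simps)
    from absolutely_integrable_on_combine[OF Suc this] show ?case
      using ab \<open>h > 0\<close> by (simp add: min_def distrib_right)
  qed
  moreover obtain n where "(b - a) / h < real n" using reals_Archimedean2 by blast
  then have "min b (a + real n * h) = b" using \<delta> by (simp add: h_def field_simps)
  ultimately show ?thesis by metis
qed

lemma abs_cont_on_lipschitz:
  fixes f :: "real \<Rightarrow> 'a::real_normed_vector"
  assumes "\<And>x y. x \<in> {a..b} \<Longrightarrow> y \<in> {a..b} \<Longrightarrow> norm (f y - f x) \<le> C * \<bar>y - x\<bar>"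
  shows "abs_cont_on a b f"
  unfolding abs_cont_on_def
proof (intro allI impI)
  fix \<epsilon> :: real assume e: "\<epsilon> > 0"
  define D where "D = \<bar>C\<bar> + 1"
  have D: "D > 0" "C \<le> D" by (auto simp: D_def)
  show "\<exists>\<delta>>0. \<forall>(n::nat) l r. (\<forall>i<n. a \<le> l i \<and> l i \<le> r i \<and> r i \<le> b) \<and>
      (\<forall>i<n. \<forall>j<n. i \<noteq> j \<longrightarrow> r i \<le> l j \<or> r j \<le> l i) \<and> (\<Sum>i<n. r i - l i) < \<delta> \<longrightarrow>
      (\<Sum>i<n. norm (f (r i) - f (l i))) < \<epsilon>"
  proof (intro exI[of _ "\<epsilon> / D"] conjI allI impI)
    fix n :: nat and l r :: "nat \<Rightarrow> real"
    assume *: "(\<forall>i<n. a \<le> l i \<and> l i \<le> r i \<and> r i \<le> b) \<and>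
      (\<forall>i<n. \<forall>j<n. i \<noteq> j \<longrightarrow> r i \<le> l j \<or> r j \<le> l i) \<and> (\<Sum>i<n. r i - l i) < \<epsilon> / D"
    have "(\<Sum>i<n. norm (f (r i) - f (l i))) \<le> (\<Sum>i<n. D * (r i - l i))"
    proof (rule sum_mono)
      fix i assume "i \<in> {..<n}"
      then have i: "a \<le> l i" "l i \<le> r i" "r i \<le> b" using * by auto
      then have "norm (f (r i) - f (l i)) \<le> C * (r i - l i)" using assms[of "l i" "r i"] by simp
      also have "\<dots> \<le> D * (r i - l i)" using i D by (intro mult_right_mono) auto
      finally show "norm (f (r i) - f (l i)) \<le> D * (r i - l i)" .
    qed
    also have "\<dots> = D * (\<Sum>i<n. r i - l i)" by (rule sum_distrib_left[symmetric])
    also have "\<dots> < \<epsilon>" using * D by (simp add: pos_less_divide_eq mult.commute)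
    finally show "(\<Sum>i<n. norm (f (r i) - f (l i))) < \<epsilon>" .
  qed (use e D in auto)
qed

subsection \<open>Calculus of indefinite integrals\<close>

text \<open>Encodes absolute continuity through increments over all subintervals instead of
  derivatives almost everywhere. Absolute integrability of the density is included because the
  product and chain rules multiply it by continuous functions and estimate errors by its
  norm.\<close>

definition primitive :: "(real \<Rightarrow> 'a::euclidean_space) \<Rightarrow> (real \<Rightarrow> 'a) \<Rightarrow> bool" where
  "primitive f f' \<longleftrightarrow> f' absolutely_integrable_on {0..1} \<and>
     (\<forall>a b. 0 \<le> a \<and> a \<le> b \<and> b \<le> 1 \<longrightarrow> (f' has_integral f b - f a) {a..b})"

lemma primitiveD:
  assumes "primitive f f'"
  shows "f' absolutely_integrable_on {0..1}"
    and "\<And>a b. 0 \<le> a \<Longrightarrow> a \<le> b \<Longrightarrow> b \<le> 1 \<Longrightarrow> (f' has_integral f b - f a) {a..b}"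
    and "\<And>a b. 0 \<le> a \<Longrightarrow> a \<le> b \<Longrightarrow> b \<le> 1 \<Longrightarrow> integral {a..b} f' = f b - f a"
  using assms by (auto simp: primitive_def integral_unique)

lemma primitive_continuous_on:
  assumes "primitive f f'"
  shows "continuous_on {0..1} f"
proof -
  have "continuous_on {0..1} (\<lambda>x. f 0 + integral {0..x} f')"
    using primitiveD(1)[OF assms]
    by (intro continuous_intros indefinite_integral_continuous_1) (auto simp: absolutely_integrable_on_def)
  then show ?thesis
    by (rule continuous_on_cong[THEN iffD1, rotated 2]) (auto simp: primitiveD(3)[OF assms])
qed

lemma primitive_of_deriv:
  assumes "\<And>s. s \<in> {0..1} \<Longrightarrow> (f has_vector_derivative f' s) (at s within {0..1})"
    and "continuous_on {0..1} f'"
  shows "primitive f f'"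
  unfolding primitive_def
proof (intro conjI allI impI)
  show "f' absolutely_integrable_on {0..1}" by (rule absolutely_integrable_continuous_real[OF assms(2)])
  show "(f' has_integral f b - f a) {a..b}" if "0 \<le> a \<and> a \<le> b \<and> b \<le> 1" for a b
    using that
    by (intro fundamental_theorem_of_calculus has_vector_derivative_within_subset[OF assms(1)]) auto
qed

lemma abs_cont_on_imp_primitive:
  assumes "abs_cont_on 0 1 f" "negligible N"
    "\<And>s. s \<in> {0..1} - N \<Longrightarrow> (f has_vector_derivative f' s) (at s within {0..1})"
  shows "primitive f f'"
  unfolding primitive_def
proof (intro conjI allI impI)
  show "f' absolutely_integrable_on {0..1}"
    by (rule abs_cont_on_absolutely_integrable[OF assms(1,2) _ assms(3)]) auto
  show "(f' has_integral f b - f a) {a..b}" if "0 \<le> a \<and> a \<le> b \<and> b \<le> 1" for a b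
    using that
    by (intro abs_cont_on_has_integral[OF abs_cont_on_subinterval[OF assms(1)] assms(2)]
        has_vector_derivative_within_subset[OF assms(3)]) auto
qed

lemma primitive_spike:
  assumes "primitive f f'" "negligible N" "\<And>s. s \<in> {0..1} - N \<Longrightarrow> g s = f' s"
  shows "primitive f g"
  unfolding primitive_def
proof (intro conjI allI impI)
  show "g absolutely_integrable_on {0..1}"
    by (rule absolutely_integrable_spike[OF primitiveD(1)[OF assms(1)] assms(2,3)])
  show "(g has_integral f b - f a) {a..b}" if "0 \<le> a \<and> a \<le> b \<and> b \<le> 1" for a b
    by (rule has_integral_spike[OF assms(2) assms(3) primitiveD(2)[OF assms(1)]]) (use that in auto)
qed

lemma primitive_add:
  assumes "primitive f f'" "primitive g g'"
  shows "primitive (\<lambda>s. f s + g s) (\<lambda>s. f' s + g' s)"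
  unfolding primitive_def
proof (intro conjI allI impI)
  show "(\<lambda>s. f' s + g' s) absolutely_integrable_on {0..1}"
    using primitiveD(1)[OF assms(1)] primitiveD(1)[OF assms(2)] by (rule set_integral_add)
  show "((\<lambda>s. f' s + g' s) has_integral f b + g b - (f a + g a)) {a..b}" if "0 \<le> a \<and> a \<le> b \<and> b \<le> 1" for a b
    using has_integral_add[OF primitiveD(2)[OF assms(1), of a b] primitiveD(2)[OF assms(2), of a b]] that
    by (simp add: algebra_simps)
qed

lemma primitive_linear:
  assumes "primitive f f'" "bounded_linear h"
  shows "primitive (\<lambda>s. h (f s)) (\<lambda>s. h (f' s))"
  unfolding primitive_def
proof (intro conjI allI impI)
  show "(\<lambda>s. h (f' s)) absolutely_integrable_on {0..1}"
    using absolutely_integrable_linear[OF primitiveD(1)[OF assms(1)] assms(2)] by (simp add: o_def)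
  show "((\<lambda>s. h (f' s)) has_integral h (f b) - h (f a)) {a..b}" if "0 \<le> a \<and> a \<le> b \<and> b \<le> 1" for a b
    using has_integral_linear[OF primitiveD(2)[OF assms(1), of a b] assms(2)] that
    by (simp add: o_def linear_diff[OF bounded_linear.linear[OF assms(2)]])
qed

lemma primitive_diff:
  assumes "primitive f f'" "primitive g g'"
  shows "primitive (\<lambda>s. f s - g s) (\<lambda>s. f' s - g' s)"
  using primitive_add[OF assms(1) primitive_linear[OF assms(2) bounded_linear_minus[OF bounded_linear_ident]]]
  by simp

text \<open>Increments that agree with an integral up to arbitrarily small multiples of another
  additive interval function agree exactly; this replaces differentiation of integrals almost
  everywhere.\<close>

lemma primitiveI_approx:
  assumes g: "g absolutely_integrable_on {0..1}" and w: "w integrable_on {0..1::real}"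
    and approx: "\<And>\<epsilon>::real. \<epsilon> > 0 \<Longrightarrow> \<exists>\<delta>>0. \<forall>a b. 0 \<le> a \<longrightarrow> a \<le> b \<longrightarrow> b \<le> 1 \<longrightarrow> b - a < \<delta> \<longrightarrow>
        norm (F b - F a - integral {a..b} g) \<le> \<epsilon> * integral {a..b} w"
  shows "primitive F g"
proof -
  have gi: "g integrable_on {a..b}" if "0 \<le> a" "b \<le> 1" for a b
    by (rule integrable_on_subinterval[of g "{0..1}"]) (use g that in \<open>auto simp: absolutely_integrable_on_def\<close>)
  have wi: "w integrable_on {a..b}" if "0 \<le> a" "b \<le> 1" for a b
    by (rule integrable_on_subinterval[OF w]) (use that in auto)
  have bound: "norm (F b - F a - integral {a..b} g) \<le> \<epsilon> * integral {a..b} w"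
    if \<epsilon>: "\<epsilon> > 0" and ab: "0 \<le> a" "a \<le> b" "b \<le> 1" for a b \<epsilon> :: real
  proof -
    obtain \<delta> where \<delta>: "\<delta> > 0" and D: "\<And>a b. 0 \<le> a \<Longrightarrow> a \<le> b \<Longrightarrow> b \<le> 1 \<Longrightarrow> b - a < \<delta> \<Longrightarrow>
        norm (F b - F a - integral {a..b} g) \<le> \<epsilon> * integral {a..b} w"
      using approx[OF \<epsilon>] by blast
    \<comment> \<open>Increments and integrals are additive over adjacent intervals, so the bound
      for short intervals extends in steps of length \<open>\<delta> / 2\<close> with the same
      \<open>\<epsilon>\<close>.\<close>
    have "\<forall>b. a \<le> b \<longrightarrow> b \<le> 1 \<longrightarrow> b - a \<le> real n * (\<delta> / 2) \<longrightarrow>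
        norm (F b - F a - integral {a..b} g) \<le> \<epsilon> * integral {a..b} w" for n
    proof (induction n)
      case 0
      show ?case using D[of a a] ab \<delta> by (metis diff_gt_0_iff_gt diff_self mult_zero_left of_nat_0 antisym diff_le_0_iff_le order_trans)
    next
      case (Suc n)
      show ?case
      proof (intro allI impI)
        fix b assume b: "a \<le> b" "b \<le> 1" "b - a \<le> real (Suc n) * (\<delta> / 2)"
        define c where "c = max a (b - \<delta> / 2)"
        have c: "a \<le> c" "c \<le> b" "b - c < \<delta>" "c - a \<le> real n * (\<delta> / 2)"
          using b \<delta> by (auto simp: c_def max_def field_simps)
        have 1: "norm (F c - F a - integral {a..c} g) \<le> \<epsilon> * integral {a..c} w"
          using Suc c b by simp
        have 2: "norm (F b - F c - integral {c..b} g) \<le> \<epsilon> * integral {c..b} w"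
          using D[of c b] c b ab by simp
        have "integral {a..b} g = integral {a..c} g + integral {c..b} g"
          using Henstock_Kurzweil_Integration.integral_combine[of a c b g] c gi[of a b] b ab by simp
        then have "F b - F a - integral {a..b} g
            = (F c - F a - integral {a..c} g) + (F b - F c - integral {c..b} g)" by simp
        also have "norm \<dots> \<le> \<epsilon> * integral {a..c} w + \<epsilon> * integral {c..b} w"
          using 1 2 by (rule norm_triangle_mono)
        also have "\<dots> = \<epsilon> * integral {a..b} w"
          using Henstock_Kurzweil_Integration.integral_combine[of a c b w] c wi[of a b] b ab
          by (simp add: distrib_left[symmetric])
        finally show "norm (F b - F a - integral {a..b} g) \<le> \<epsilon> * integral {a..b} w" .
      qed
    qed
    moreover obtain n where "(b - a) / (\<delta> / 2) \<le> real n" using real_arch_simple by blast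
    then have "b - a \<le> real n * (\<delta> / 2)" using \<delta> by (simp add: field_simps)
    ultimately show ?thesis using ab by blast
  qed
  have "integral {a..b} g = F b - F a" if ab: "0 \<le> a" "a \<le> b" "b \<le> 1" for a b
  proof -
    let ?W = "integral {a..b} w"
    have "norm (F b - F a - integral {a..b} g) \<le> 0"
    proof (rule field_le_epsilon)
      fix e :: real assume e: "e > 0"
      have "norm (F b - F a - integral {a..b} g) \<le> e / (\<bar>?W\<bar> + 1) * ?W"
        using bound[of "e / (\<bar>?W\<bar> + 1)" a b] e ab by simp
      also have "\<dots> \<le> e / (\<bar>?W\<bar> + 1) * (\<bar>?W\<bar> + 1)"
        using e by (intro mult_left_mono) auto
      also have "\<dots> = e" by (simp add: add_nonneg_pos less_imp_neq[symmetric])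
      finally show "norm (F b - F a - integral {a..b} g) \<le> 0 + e" by simp
    qed
    then show ?thesis by simp
  qed
  then show ?thesis
    unfolding primitive_def using g gi integrable_integral by fastforce
qed

lemma absolutely_integrable_continuous_product:
  fixes h :: "'a::euclidean_space \<Rightarrow> 'b::euclidean_space \<Rightarrow> 'c::euclidean_space"
  assumes "bounded_bilinear h" "continuous_on {0..1::real} f" "g absolutely_integrable_on {0..1}"
  shows "(\<lambda>s. h (f s) (g s)) absolutely_integrable_on {0..1}"
proof (rule absolutely_integrable_bounded_measurable_product[where h = h and f = f and g = g])
  show "bilinear h" using assms(1) by (simp add: bilinear_conv_bounded_bilinear)
  show "f \<in> borel_measurable (lebesgue_on {0..1})"
    by (rule continuous_imp_measurable_on_sets_lebesgue[OF assms(2)]) simp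
  show "bounded (f ` {0..1})"
    by (rule compact_imp_bounded[OF compact_continuous_image[OF assms(2) compact_Icc]])
qed (use assms(3) in auto)

lemma uniformly_close_on_unit_interval:
  fixes f :: "real \<Rightarrow> 'a::metric_space"
  assumes "continuous_on {0..1} f" "\<epsilon> > 0"
  obtains \<delta> where "\<delta> > 0" "\<And>s t. s \<in> {0..1} \<Longrightarrow> t \<in> {0..1} \<Longrightarrow> \<bar>s - t\<bar> < \<delta> \<Longrightarrow> dist (f s) (f t) < \<epsilon>"
proof -
  obtain \<delta> where "\<delta> > 0" "\<forall>x\<in>{0..1}. \<forall>y\<in>{0..1}. dist y x < \<delta> \<longrightarrow> dist (f y) (f x) < \<epsilon>"
    using compact_uniformly_continuous[OF assms(1) compact_Icc] assms(2)
    unfolding uniformly_continuous_on_def by blast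
  then show thesis by (intro that[of \<delta>]) (auto simp: dist_real_def)
qed

text \<open>Freezing \<open>g\<close> at the right end and \<open>f\<close> at the left end makes
  the increment of the product an exact integral. Unfreezing costs, by uniform continuity, a small
  multiple of the integral of \<open>norm (f' s) + norm (g' s)\<close>.\<close>

lemma primitive_bilinear:
  assumes h: "bounded_bilinear h" and f: "primitive f f'" and g: "primitive g g'"
  shows "primitive (\<lambda>s. h (f s) (g s)) (\<lambda>s. h (f s) (g' s) + h (f' s) (g s))"
proof (rule primitiveI_approx[where w = "\<lambda>s. norm (f' s) + norm (g' s)"])
  interpret bounded_bilinear h by (rule h)
  note fc = primitive_continuous_on[OF f] and gc = primitive_continuous_on[OF g]
  have fa: "f' absolutely_integrable_on {0..1}" and ga: "g' absolutely_integrable_on {0..1}"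
    using primitiveD(1) f g by auto
  show int: "(\<lambda>s. h (f s) (g' s) + h (f' s) (g s)) absolutely_integrable_on {0..1}"
    using absolutely_integrable_continuous_product[OF h fc ga]
      absolutely_integrable_continuous_product[OF flip gc fa] by (rule set_integral_add)
  show wint: "(\<lambda>s. norm (f' s) + norm (g' s)) integrable_on {0..1}"
    using fa ga by (intro integrable_add) (auto simp: absolutely_integrable_on_def)
  fix \<epsilon> :: real assume \<epsilon>: "\<epsilon> > 0"
  obtain K where K: "K > 0" "\<And>a b. norm (h a b) \<le> norm a * norm b * K" using pos_bounded by blast
  obtain d1 where d1: "d1 > 0" "\<And>s t. s \<in> {0..1} \<Longrightarrow> t \<in> {0..1} \<Longrightarrow> \<bar>s - t\<bar> < d1 \<Longrightarrow> dist (f s) (f t) < \<epsilon> / K"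
    using uniformly_close_on_unit_interval[OF fc, of "\<epsilon> / K"] \<epsilon> K(1) by (metis divide_pos_pos)
  obtain d2 where d2: "d2 > 0" "\<And>s t. s \<in> {0..1} \<Longrightarrow> t \<in> {0..1} \<Longrightarrow> \<bar>s - t\<bar> < d2 \<Longrightarrow> dist (g s) (g t) < \<epsilon> / K"
    using uniformly_close_on_unit_interval[OF gc, of "\<epsilon> / K"] \<epsilon> K(1) by (metis divide_pos_pos)
  show "\<exists>\<delta>>0. \<forall>a b. 0 \<le> a \<longrightarrow> a \<le> b \<longrightarrow> b \<le> 1 \<longrightarrow> b - a < \<delta> \<longrightarrow>
      norm (h (f b) (g b) - h (f a) (g a) - integral {a..b} (\<lambda>s. h (f s) (g' s) + h (f' s) (g s)))
      \<le> \<epsilon> * integral {a..b} (\<lambda>s. norm (f' s) + norm (g' s))"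
  proof (intro exI[of _ "min d1 d2"] conjI allI impI)
    fix a b :: real assume ab: "0 \<le> a" "a \<le> b" "b \<le> 1" "b - a < min d1 d2"
    have sub: "{a..b} \<subseteq> {0..1}" using ab by auto
    have "((\<lambda>s. h (f' s) (g b)) has_integral h (f b - f a) (g b)) {a..b}"
      using has_integral_linear[OF primitiveD(2)[OF f, of a b] bounded_linear_left[of "g b"]] ab by (simp add: o_def)
    moreover have "((\<lambda>s. h (f a) (g' s)) has_integral h (f a) (g b - g a)) {a..b}"
      using has_integral_linear[OF primitiveD(2)[OF g, of a b] bounded_linear_right[of "f a"]] ab by (simp add: o_def)
    moreover have ii: "(\<lambda>s. h (f s) (g' s) + h (f' s) (g s)) integrable_on {a..b}"
      using absolutely_integrable_on_subinterval[OF int sub] by (simp add: absolutely_integrable_on_def)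
    ultimately have *: "((\<lambda>s. h (f' s) (g b) + h (f a) (g' s) - (h (f s) (g' s) + h (f' s) (g s))) has_integral
       h (f b - f a) (g b) + h (f a) (g b - g a) - integral {a..b} (\<lambda>s. h (f s) (g' s) + h (f' s) (g s))) {a..b}"
      by (intro has_integral_diff has_integral_add) auto
    have "h (f b) (g b) - h (f a) (g a) - integral {a..b} (\<lambda>s. h (f s) (g' s) + h (f' s) (g s))
       = integral {a..b} (\<lambda>s. h (f' s) (g b) + h (f a) (g' s) - (h (f s) (g' s) + h (f' s) (g s)))"
      using integral_unique[OF *] by (simp add: diff_left diff_right)
    also have "norm \<dots> \<le> integral {a..b} (\<lambda>s. \<epsilon> * (norm (f' s) + norm (g' s)))"
    proof (rule Henstock_Kurzweil_Integration.integral_norm_bound_integral)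
      show "(\<lambda>s. h (f' s) (g b) + h (f a) (g' s) - (h (f s) (g' s) + h (f' s) (g s))) integrable_on {a..b}"
        using * by blast
      show "(\<lambda>s. \<epsilon> * (norm (f' s) + norm (g' s))) integrable_on {a..b}"
        using integrable_on_subinterval[OF wint sub] by (rule integrable_on_mult_right)
      fix s assume s: "s \<in> {a..b}"
      have "norm (g b - g s) \<le> \<epsilon> / K" "norm (f a - f s) \<le> \<epsilon> / K"
        using d1(2)[of a s] d2(2)[of b s] s ab by (auto simp: dist_norm)
      then have "norm (h (f' s) (g b - g s)) \<le> \<epsilon> * norm (f' s)" "norm (h (f a - f s) (g' s)) \<le> \<epsilon> * norm (g' s)"
        using order_trans[OF K(2)[of "f' s" "g b - g s"]] order_trans[OF K(2)[of "f a - f s" "g' s"]] K(1)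
          mult_left_mono[of "norm (g b - g s) * K" \<epsilon> "norm (f' s)"] mult_left_mono[of "norm (f a - f s) * K" \<epsilon> "norm (g' s)"]
        by (auto simp: pos_le_divide_eq mult_ac)
      then have "norm (h (f' s) (g b - g s) + h (f a - f s) (g' s)) \<le> \<epsilon> * norm (f' s) + \<epsilon> * norm (g' s)"
        by (rule norm_triangle_mono)
      moreover have "h (f' s) (g b - g s) + h (f a - f s) (g' s)
          = h (f' s) (g b) + h (f a) (g' s) - (h (f s) (g' s) + h (f' s) (g s))"
        by (simp add: diff_left diff_right)
      ultimately show "norm (h (f' s) (g b) + h (f a) (g' s) - (h (f s) (g' s) + h (f' s) (g s)))
          \<le> \<epsilon> * (norm (f' s) + norm (g' s))" by (simp add: distrib_left)
    qed
    also have "\<dots> = \<epsilon> * integral {a..b} (\<lambda>s. norm (f' s) + norm (g' s))" by simp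
    finally show "norm (h (f b) (g b) - h (f a) (g a) - integral {a..b} (\<lambda>s. h (f s) (g' s) + h (f' s) (g s)))
      \<le> \<epsilon> * integral {a..b} (\<lambda>s. norm (f' s) + norm (g' s))" .
  qed (use d1 d2 in auto)
qed

text \<open>\<open>G\<close> is linearized at \<open>\<sigma> a\<close>: the remainder is at most
  \<epsilon>/2 times \<open>\<bar>\<sigma> b - \<sigma> a\<bar>\<close>, hence at most \<epsilon>/2
  times the integral of \<open>\<bar>u s\<bar>\<close>, and replacing \<open>G' (\<sigma> a)\<close>
  by \<open>G' (\<sigma> s)\<close> costs the same again.\<close>

lemma primitive_compose:
  assumes \<sigma>: "primitive \<sigma> u" and range: "\<And>s. s \<in> {0..1} \<Longrightarrow> \<sigma> s \<in> {0..1::real}"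
    and G: "\<And>s. s \<in> {0..1} \<Longrightarrow> (G has_vector_derivative G' s) (at s within {0..1})"
    and G'c: "continuous_on {0..1} G'"
  shows "primitive (\<lambda>s. G (\<sigma> s)) (\<lambda>s. u s *\<^sub>R G' (\<sigma> s))"
proof (rule primitiveI_approx[where w = "\<lambda>s. \<bar>u s\<bar>"])
  note \<sigma>c = primitive_continuous_on[OF \<sigma>]
  have ua: "u absolutely_integrable_on {0..1}" using primitiveD(1)[OF \<sigma>] .
  have c: "continuous_on {0..1} (\<lambda>s. G' (\<sigma> s))"
    by (rule continuous_on_compose2[OF G'c \<sigma>c]) (use range in auto)
  show int: "(\<lambda>s. u s *\<^sub>R G' (\<sigma> s)) absolutely_integrable_on {0..1}"
    by (rule absolutely_integrable_continuous_product[OF bounded_bilinear.flip[OF bounded_bilinear_scaleR] c ua])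
  show wint: "(\<lambda>s. \<bar>u s\<bar>) integrable_on {0..1}"
    using ua by (auto simp: absolutely_integrable_on_def)
  fix \<epsilon> :: real assume \<epsilon>: "\<epsilon> > 0"
  obtain \<eta> where \<eta>: "\<eta> > 0" "\<And>s t. s \<in> {0..1} \<Longrightarrow> t \<in> {0..1} \<Longrightarrow> \<bar>s - t\<bar> < \<eta> \<Longrightarrow> dist (G' s) (G' t) < \<epsilon> / 2"
    using uniformly_close_on_unit_interval[OF G'c half_gt_zero[OF \<epsilon>]] by metis
  obtain \<delta> where \<delta>: "\<delta> > 0" "\<And>s t. s \<in> {0..1} \<Longrightarrow> t \<in> {0..1} \<Longrightarrow> \<bar>s - t\<bar> < \<delta> \<Longrightarrow> dist (\<sigma> s) (\<sigma> t) < \<eta>"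
    using uniformly_close_on_unit_interval[OF \<sigma>c \<eta>(1)] by metis
  show "\<exists>\<delta>>0. \<forall>a b. 0 \<le> a \<longrightarrow> a \<le> b \<longrightarrow> b \<le> 1 \<longrightarrow> b - a < \<delta> \<longrightarrow>
      norm (G (\<sigma> b) - G (\<sigma> a) - integral {a..b} (\<lambda>s. u s *\<^sub>R G' (\<sigma> s))) \<le> \<epsilon> * integral {a..b} (\<lambda>s. \<bar>u s\<bar>)"
  proof (intro exI[of _ \<delta>] conjI \<delta>(1) allI impI)
    fix a b :: real assume ab: "0 \<le> a" "a \<le> b" "b \<le> 1" "b - a < \<delta>"
    have sub: "{a..b} \<subseteq> {0..1}" using ab by auto
    let ?W = "integral {a..b} (\<lambda>s. \<bar>u s\<bar>)"
    have wi: "(\<lambda>s. \<bar>u s\<bar>) integrable_on {a..b}" by (rule integrable_on_subinterval[OF wint sub])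
    have ui: "(u has_integral \<sigma> b - \<sigma> a) {a..b}" using primitiveD(2)[OF \<sigma>] ab by simp
    have uW: "\<bar>\<sigma> b - \<sigma> a\<bar> \<le> ?W"
      using Henstock_Kurzweil_Integration.integral_norm_bound_integral[OF _ wi, of u] ui
      by (auto simp: integral_unique)
    have ra: "\<sigma> a \<in> {0..1}" "\<sigma> b \<in> {0..1}" using range ab by auto
    have seg: "closed_segment (\<sigma> a) (\<sigma> b) \<subseteq> {0..1}"
      using ra by (intro closed_segment_subset) (auto simp: convex_real_interval)
    have "norm (G (\<sigma> b) - G (\<sigma> a) - (\<sigma> b - \<sigma> a) *\<^sub>R G' (\<sigma> a)) \<le> norm (\<sigma> b - \<sigma> a) * (\<epsilon> / 2)"
    proof (rule vector_differentiable_bound_linearization)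
      show "(G has_vector_derivative G' x) (at x within closed_segment (\<sigma> a) (\<sigma> b))"
        if "x \<in> closed_segment (\<sigma> a) (\<sigma> b)" for x
        by (rule has_vector_derivative_within_subset[OF G seg]) (use that seg in auto)
      show "norm (G' x - G' (\<sigma> a)) \<le> \<epsilon> / 2" if "x \<in> closed_segment (\<sigma> a) (\<sigma> b)" for x
      proof -
        have "\<bar>\<sigma> a - \<sigma> b\<bar> < \<eta>" using \<delta>(2)[of a b] ab by (auto simp: dist_real_def)
        moreover have "\<bar>x - \<sigma> a\<bar> \<le> \<bar>\<sigma> a - \<sigma> b\<bar>"
          using that by (auto simp: closed_segment_eq_real_ivl split: if_splits)
        ultimately show ?thesis using \<eta>(2)[of x "\<sigma> a"] that seg ra by (fastforce simp: dist_norm)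
      qed
    qed auto
    then have 1: "norm (G (\<sigma> b) - G (\<sigma> a) - (\<sigma> b - \<sigma> a) *\<^sub>R G' (\<sigma> a)) \<le> \<epsilon> / 2 * ?W"
    proof (rule order_trans)
      show "norm (\<sigma> b - \<sigma> a) * (\<epsilon> / 2) \<le> \<epsilon> / 2 * ?W"
        using mult_right_mono[OF uW, of "\<epsilon> / 2"] \<epsilon> by (simp only: real_norm_def mult.commute)
    qed
    have ii: "(\<lambda>s. u s *\<^sub>R G' (\<sigma> s)) integrable_on {a..b}"
      using absolutely_integrable_on_subinterval[OF int sub] by (simp add: absolutely_integrable_on_def)
    have "((\<lambda>s. u s *\<^sub>R G' (\<sigma> a)) has_integral (\<sigma> b - \<sigma> a) *\<^sub>R G' (\<sigma> a)) {a..b}"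
      using has_integral_linear[OF ui bounded_linear_scaleR_left[of "G' (\<sigma> a)"]] by (simp add: o_def)
    from has_integral_diff[OF this integrable_integral[OF ii]]
    have *: "((\<lambda>s. u s *\<^sub>R (G' (\<sigma> a) - G' (\<sigma> s))) has_integral
        (\<sigma> b - \<sigma> a) *\<^sub>R G' (\<sigma> a) - integral {a..b} (\<lambda>s. u s *\<^sub>R G' (\<sigma> s))) {a..b}"
      by (simp add: scaleR_diff_right)
    have 2: "norm (integral {a..b} (\<lambda>s. u s *\<^sub>R (G' (\<sigma> a) - G' (\<sigma> s)))) \<le> integral {a..b} (\<lambda>s. \<epsilon> / 2 * \<bar>u s\<bar>)"
    proof (rule Henstock_Kurzweil_Integration.integral_norm_bound_integral)
      show "(\<lambda>s. u s *\<^sub>R (G' (\<sigma> a) - G' (\<sigma> s))) integrable_on {a..b}" using * by blast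
      show "(\<lambda>s. \<epsilon> / 2 * \<bar>u s\<bar>) integrable_on {a..b}" using wi by (rule integrable_on_mult_right)
      fix s assume s: "s \<in> {a..b}"
      have "\<bar>\<sigma> a - \<sigma> s\<bar> < \<eta>" using \<delta>(2)[of a s] ab s by (auto simp: dist_real_def)
      then have "norm (G' (\<sigma> a) - G' (\<sigma> s)) \<le> \<epsilon> / 2"
        using \<eta>(2)[of "\<sigma> a" "\<sigma> s"] range[of s] ra s ab by (force simp: dist_norm)
      then show "norm (u s *\<^sub>R (G' (\<sigma> a) - G' (\<sigma> s))) \<le> \<epsilon> / 2 * \<bar>u s\<bar>"
        using mult_left_mono[of "norm (G' (\<sigma> a) - G' (\<sigma> s))" "\<epsilon> / 2" "\<bar>u s\<bar>"] by (simp add: mult.commute)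
    qed
    have "G (\<sigma> b) - G (\<sigma> a) - integral {a..b} (\<lambda>s. u s *\<^sub>R G' (\<sigma> s))
        = (G (\<sigma> b) - G (\<sigma> a) - (\<sigma> b - \<sigma> a) *\<^sub>R G' (\<sigma> a))
          + integral {a..b} (\<lambda>s. u s *\<^sub>R (G' (\<sigma> a) - G' (\<sigma> s)))"
      using integral_unique[OF *] by simp
    also have "norm \<dots> \<le> \<epsilon> / 2 * ?W + integral {a..b} (\<lambda>s. \<epsilon> / 2 * \<bar>u s\<bar>)"
      using 1 2 by (rule norm_triangle_mono)
    also have "\<dots> = \<epsilon> * ?W"
      unfolding Henstock_Kurzweil_Integration.integral_mult_right by simp
    finally show "norm (G (\<sigma> b) - G (\<sigma> a) - integral {a..b} (\<lambda>s. u s *\<^sub>R G' (\<sigma> s))) \<le> \<epsilon> * ?W" .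
  qed
qed

subsection \<open>The energy identity\<close>

lemma skew_inner_self: "skew A \<Longrightarrow> (A *v x) \<bullet> x = 0"
  using skew_inner[of A x x] by (simp add: inner_commute)

text \<open>Completion of the square with deviation \<open>k\<close> and its velocity
  \<open>\<kappa>\<close>. Skewness kills the product of \<open>A *v k\<close> and \<open>k\<close>,
  so absorbing the cross term of \<open>\<kappa>\<close> and \<open>A *v k\<close> into the square
  costs exactly \<open>(norm (A *v k))\<^sup>2\<close>, to be paid for by the term with
  \<open>\<rho>\<close>.\<close>

lemma energy_identity_pointwise:
  fixes X Z k \<kappa> :: "real^'q"
  assumes "skew A"
  shows "(Z - A *v X) \<bullet> Z + (A *v Z) \<bullet> X + 2 * ((Z - A *v X) \<bullet> \<kappa> + (A *v Z) \<bullet> k)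
      + (2 * w * (k \<bullet> \<kappa>) + (- \<rho>\<^sup>2 - w\<^sup>2) * (k \<bullet> k))
    = (Z + \<kappa>) \<bullet> (Z + \<kappa>) - 2 * ((A *v (X + k)) \<bullet> (Z + \<kappa>))
      - ((norm (\<kappa> - A *v k - w *\<^sub>R k))\<^sup>2 + \<rho>\<^sup>2 * (norm k)\<^sup>2 - (norm (A *v k))\<^sup>2)"
proof -
  have 1: "(A *v Z) \<bullet> X = - ((A *v X) \<bullet> Z)" "(A *v Z) \<bullet> k = - ((A *v k) \<bullet> Z)" "(A *v k) \<bullet> k = 0"
    using skew_inner[OF assms, of Z X] skew_inner[OF assms, of Z k] skew_inner_self[OF assms, of k]
    by (auto simp: inner_commute)
  show ?thesis
    unfolding power2_norm_eq_inner matrix_vector_right_distrib inner_diff_left inner_diff_right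
      inner_add_left inner_add_right inner_scaleR_left inner_scaleR_right
    using 1 by (simp add: inner_commute power2_eq_square algebra_simps)
qed

text \<open>Solution of \<open>w' = - \<rho>\<^sup>2 - w\<^sup>2\<close>, finite on \<open>[0,1]\<close> because \<open>\<rho> < \<pi>\<close>. Adding the exact
  differential of \<open>w \<cdot> |k|\<^sup>2\<close> turns the second variation into a square plus a positive multiple
  of \<open>|k|\<^sup>2\<close>.\<close>

definition riccati :: "real \<Rightarrow> real \<Rightarrow> real" where
  "riccati \<rho> s = - \<rho> * tan (\<rho> * (s - 1 / 2))"

text \<open>Centring at 1/2 keeps the argument of the tangent within \<rho>/2 < pi/2 on [0,1]. This
  is where the bound pi in the definition of \<open>Omega\<close> enters.\<close>

lemma riccati_has_derivative:
  assumes "0 < \<rho>" "\<rho> < pi" "s \<in> {0..1}"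
  shows "(riccati \<rho> has_vector_derivative (- \<rho>\<^sup>2 - (riccati \<rho> s)\<^sup>2)) (at s within {0..1})"
proof -
  let ?y = "\<rho> * (s - 1 / 2)"
  have "\<bar>?y\<bar> \<le> \<rho> * (1 / 2)"
    unfolding abs_mult
  proof (rule mult_mono)
    show "\<bar>s - 1 / 2\<bar> \<le> 1 / 2" using assms(3) unfolding abs_le_iff by simp
  qed (use assms in auto)
  then have "cos ?y > 0" using assms by (intro cos_gt_zero_pi) (auto simp: abs_le_iff)
  moreover have "inverse ((cos ?y)\<^sup>2) = 1 + (tan ?y)\<^sup>2"
    using tan_sec[of ?y] \<open>cos ?y > 0\<close> by (simp add: power_inverse)
  ultimately have "(riccati \<rho> has_field_derivative (- \<rho>\<^sup>2 - (riccati \<rho> s)\<^sup>2)) (at s)"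
    unfolding riccati_def
    by (auto intro!: derivative_eq_intros simp: power2_eq_square algebra_simps)
  then show ?thesis
    by (simp add: has_real_derivative_iff_has_vector_derivative has_vector_derivative_at_within)
qed

lemma continuous_on_riccati: "0 < \<rho> \<Longrightarrow> \<rho> < pi \<Longrightarrow> continuous_on {0..1} (riccati \<rho>)"
  by (metis continuous_on_eq_continuous_within has_vector_derivative_continuous riccati_has_derivative)

lemma bounded_linear_matrix_vector: "bounded_linear (\<lambda>x::real^'n. A *v x)"
  using matrix_vector_mul_bounded_linear by blast

text \<open>The curve has velocity \<open>u \<nu>\<close> and its comparison curve, \<open>X\<close>
  composed with \<open>\<sigma>\<close>, has velocity \<open>u Z\<close>; because of the common
  factor the pointwise identity applies at parameter \<open>\<sigma> s\<close>, multiplied by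
  \<open>u\<close>. The deviation vanishes at both ends, so the exact differential leaves only the
  boundary term of \<open>X\<close>.\<close>

lemma energy_identity:
  fixes A :: "real^'q^'q" and X Z x \<nu> :: "real \<Rightarrow> real^'q" and \<sigma> u :: "real \<Rightarrow> real"
  assumes A: "skew A" and \<rho>: "0 < \<rho>" "\<rho> < pi"
    and X: "\<And>s. s \<in> {0..1} \<Longrightarrow> (X has_vector_derivative Z s) (at s within {0..1})"
    and Z: "\<And>s. s \<in> {0..1} \<Longrightarrow> (Z has_vector_derivative 2 *\<^sub>R (A *v Z s)) (at s within {0..1})"
    and X0: "X 0 = 0"
    and \<sigma>: "primitive \<sigma> u" "\<And>s. s \<in> {0..1} \<Longrightarrow> \<sigma> s \<in> {0..1}" "\<sigma> 0 = 0" "\<sigma> 1 = 1"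
    and x: "primitive x (\<lambda>s. u s *\<^sub>R \<nu> s)" "x 0 = 0" "x 1 = X 1"
    and E: "((\<lambda>s. u s * (\<nu> s \<bullet> \<nu> s)) has_integral E) {0..1}"
    and B: "((\<lambda>s. (A *v x s) \<bullet> (u s *\<^sub>R \<nu> s)) has_integral B) {0..1}"
  shows "((\<lambda>s. u s * ((norm (\<nu> s - Z (\<sigma> s) - A *v (x s - X (\<sigma> s)) - riccati \<rho> (\<sigma> s) *\<^sub>R (x s - X (\<sigma> s))))\<^sup>2
        + \<rho>\<^sup>2 * (norm (x s - X (\<sigma> s)))\<^sup>2 - (norm (A *v (x s - X (\<sigma> s))))\<^sup>2))
      has_integral E - 2 * B - (Z 1 - A *v X 1) \<bullet> X 1) {0..1}"
proof -
  define P where "P s = Z s - A *v X s" for s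
  define k where "k s = x s - X (\<sigma> s)" for s
  define w where "w = riccati \<rho>"
  have AX: "((\<lambda>s. A *v X s) has_vector_derivative A *v Z s) (at s within {0..1})" if "s \<in> {0..1}" for s
    by (rule bounded_linear.has_vector_derivative[OF bounded_linear_matrix_vector X[OF that]])
  have P: "(P has_vector_derivative A *v Z s) (at s within {0..1})" if "s \<in> {0..1}" for s
    using has_vector_derivative_diff[OF Z[OF that] AX[OF that]] unfolding P_def by (simp add: scaleR_2)
  have Zc: "continuous_on {0..1} Z"
    by (metis continuous_on_eq_continuous_within has_vector_derivative_continuous Z)
  have AZc: "continuous_on {0..1} (\<lambda>s. A *v Z s)"
    by (rule bounded_linear.continuous_on[OF bounded_linear_matrix_vector Zc])
  have pX: "primitive (\<lambda>s. X (\<sigma> s)) (\<lambda>s. u s *\<^sub>R Z (\<sigma> s))"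
    by (rule primitive_compose[OF \<sigma>(1,2) X Zc])
  have pP: "primitive (\<lambda>s. P (\<sigma> s)) (\<lambda>s. u s *\<^sub>R (A *v Z (\<sigma> s)))"
    by (rule primitive_compose[OF \<sigma>(1,2) P AZc])
  have pw: "primitive (\<lambda>s. w (\<sigma> s)) (\<lambda>s. u s *\<^sub>R (- \<rho>\<^sup>2 - (w (\<sigma> s))\<^sup>2))"
    unfolding w_def
    by (rule primitive_compose[OF \<sigma>(1,2) riccati_has_derivative[OF \<rho>]])
      (auto intro!: continuous_intros continuous_on_riccati \<rho>)
  have pk: "primitive k (\<lambda>s. u s *\<^sub>R \<nu> s - u s *\<^sub>R Z (\<sigma> s))"
    unfolding k_def by (rule primitive_diff[OF x(1) pX])
  \<comment> \<open>The product-rule derivative along \<open>\<sigma>\<close> of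
    \<open>P \<bullet> X + 2 * (P \<bullet> k) + w * (k \<bullet> k)\<close>. The first summand
    carries the reduced energy of the reference curve, the second the first variation, the third the
    Riccati correction.\<close>
  define D where "D s = (P (\<sigma> s) \<bullet> (u s *\<^sub>R Z (\<sigma> s)) + (u s *\<^sub>R (A *v Z (\<sigma> s))) \<bullet> X (\<sigma> s))
      + 2 * (P (\<sigma> s) \<bullet> (u s *\<^sub>R \<nu> s - u s *\<^sub>R Z (\<sigma> s)) + (u s *\<^sub>R (A *v Z (\<sigma> s))) \<bullet> k s)
      + (w (\<sigma> s) * (k s \<bullet> (u s *\<^sub>R \<nu> s - u s *\<^sub>R Z (\<sigma> s)) + (u s *\<^sub>R \<nu> s - u s *\<^sub>R Z (\<sigma> s)) \<bullet> k s)
         + (u s *\<^sub>R (- \<rho>\<^sup>2 - (w (\<sigma> s))\<^sup>2)) * (k s \<bullet> k s))" for s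
  have "primitive (\<lambda>s. P (\<sigma> s) \<bullet> X (\<sigma> s) + 2 * (P (\<sigma> s) \<bullet> k s) + w (\<sigma> s) * (k s \<bullet> k s)) D"
    unfolding D_def
    by (intro primitive_add primitive_linear[OF _ bounded_linear_mult_right]
        primitive_bilinear[OF bounded_bilinear_inner] primitive_bilinear[OF bounded_bilinear_mult] pX pP pw pk)
  from primitiveD(2)[OF this, of 0 1]
  have D: "(D has_integral P 1 \<bullet> X 1) {0..1}"
    by (simp add: k_def \<sigma>(3,4) x(2,3) X0)
  have "((\<lambda>s. u s * (\<nu> s \<bullet> \<nu> s) - 2 * ((A *v x s) \<bullet> (u s *\<^sub>R \<nu> s)) - D s) has_integral E - 2 * B - P 1 \<bullet> X 1) {0..1}"
    by (intro has_integral_diff E has_integral_mult_right B D)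
  moreover have "u s * (\<nu> s \<bullet> \<nu> s) - 2 * ((A *v x s) \<bullet> (u s *\<^sub>R \<nu> s)) - D s
     = u s * ((norm (\<nu> s - Z (\<sigma> s) - A *v k s - w (\<sigma> s) *\<^sub>R k s))\<^sup>2 + \<rho>\<^sup>2 * (norm (k s))\<^sup>2 - (norm (A *v k s))\<^sup>2)" for s
  proof -
    let ?Z = "Z (\<sigma> s)" and ?X = "X (\<sigma> s)" and ?w = "w (\<sigma> s)"
    define \<kappa> where "\<kappa> = \<nu> s - ?Z"
    have D': "D s = u s * ((?Z - A *v ?X) \<bullet> ?Z + (A *v ?Z) \<bullet> ?X + 2 * ((?Z - A *v ?X) \<bullet> \<kappa> + (A *v ?Z) \<bullet> k s)
      + (2 * ?w * (k s \<bullet> \<kappa>) + (- \<rho>\<^sup>2 - ?w\<^sup>2) * (k s \<bullet> k s)))"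
      unfolding D_def P_def \<kappa>_def scaleR_diff_right[symmetric]
      by (simp add: inner_commute algebra_simps)
    have n: "\<nu> s = ?Z + \<kappa>" "x s = ?X + k s" by (simp_all add: \<kappa>_def k_def)
    show ?thesis
      unfolding D' energy_identity_pointwise[OF A] unfolding n
      by (simp add: algebra_simps)
  qed
  ultimately show ?thesis by (simp add: P_def k_def w_def)
qed

subsection \<open>Normal geodesics\<close>

lemma ngz_has_vector_derivative:
  "(ngz U \<zeta> \<theta> has_vector_derivative 2 *\<^sub>R (Ut U \<theta> *v ngz U \<zeta> \<theta> s)) (at s within S)"
  unfolding ngz_def by (rule mexp_mult_has_vector_derivative)

lemma continuous_on_ngz: "continuous_on S (ngz U \<zeta> \<theta>)"
  using has_vector_derivative_continuous[OF ngz_has_vector_derivative]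
  unfolding continuous_on_eq_continuous_within by blast

lemma ngx_has_vector_derivative:
  "s \<in> {0..1} \<Longrightarrow> (ngx U \<zeta> \<theta> has_vector_derivative ngz U \<zeta> \<theta> s) (at s within {0..1})"
  unfolding ngx_def by (rule integral_has_vector_derivative[OF continuous_on_ngz])

lemma continuous_on_ngx: "continuous_on {0..1} (ngx U \<zeta> \<theta>)"
  unfolding ngx_def
  by (intro indefinite_integral_continuous_1 integrable_continuous_interval continuous_on_ngz)

lemma ngz_0 [simp]: "ngz U \<zeta> \<theta> 0 = \<zeta>"
  by (simp add: ngz_def)

lemma ngx_0 [simp]: "ngx U \<zeta> \<theta> 0 = 0"
  by (simp add: ngx_def)

lemma ngx_eq_mexp_int: "ngx U \<zeta> \<theta> s = mexp_int (Ut U \<theta>) s *v \<zeta>"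
  by (simp add: ngx_def mexp_int_mult ngz_def[abs_def])

lemma norm_ngz:
  assumes "skew (Ut U \<theta>)" "s \<in> {0..1}"
  shows "norm (ngz U \<zeta> \<theta> s) = norm \<zeta>"
proof -
  let ?Z = "ngz U \<zeta> \<theta>" and ?A = "Ut U \<theta>"
  have "((\<lambda>s. ?Z s \<bullet> ?Z s) has_vector_derivative ?Z s \<bullet> (2 *\<^sub>R (?A *v ?Z s)) + (2 *\<^sub>R (?A *v ?Z s)) \<bullet> ?Z s)
      (at s within {0..1})" for s
    by (rule bounded_bilinear.has_vector_derivative[OF bounded_bilinear_inner ngz_has_vector_derivative ngz_has_vector_derivative])
  then have "((\<lambda>s. ?Z s \<bullet> ?Z s) has_vector_derivative 0) (at s within {0..1})" for s
    using skew_inner_self[OF assms(1)] by (simp add: inner_commute)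
  then have "?Z s \<bullet> ?Z s = ?Z 0 \<bullet> ?Z 0"
    using has_vector_derivative_zero_constant[of "{0..1}" "\<lambda>s. ?Z s \<bullet> ?Z s"] assms(2)
    by (metis (mono_tags, lifting) atLeastAtMost_iff convex_real_interval(5) order_refl zero_le_one)
  then show ?thesis by (simp add: norm_eq_sqrt_inner)
qed

lemma primitive_ngx: "primitive (ngx U \<zeta> \<theta>) (ngz U \<zeta> \<theta>)"
  by (rule primitive_of_deriv[OF ngx_has_vector_derivative continuous_on_ngz])

lemma primitive_ident: "primitive (\<lambda>s. s) (\<lambda>s. 1)"
  by (rule primitive_of_deriv) (auto intro!: derivative_eq_intros)

lemma continuous_on_matrix_vector:
  "continuous_on S f \<Longrightarrow> continuous_on S (\<lambda>s. (A::real^'n^'m) *v f s)"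
  by (rule bounded_linear.continuous_on[OF bounded_linear_matrix_vector])

lemma ngx_ngz_energy_has_integral:
  "((\<lambda>s. 1 * (ngz U \<zeta> \<theta> s \<bullet> ngz U \<zeta> \<theta> s)) has_integral
     integral {0..1} (\<lambda>s. ngz U \<zeta> \<theta> s \<bullet> ngz U \<zeta> \<theta> s)) {0..1}"
  "((\<lambda>s. (B *v ngx U \<zeta> \<theta> s) \<bullet> (1 *\<^sub>R ngz U \<zeta> \<theta> s)) has_integral
     integral {0..1} (\<lambda>s. (B *v ngx U \<zeta> \<theta> s) \<bullet> ngz U \<zeta> \<theta> s)) {0..1}"
  by (simp_all, auto intro!: integrable_integral integrable_continuous_interval continuous_intros
      continuous_on_ngz continuous_on_ngx continuous_on_matrix_vector)

text \<open>The case \<open>\<sigma> s = s\<close>, \<open>u = 1\<close>, comparing two normal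
  geodesics with the same horizontal end point but possibly different parameters; it gives both
  nondegeneracy and the first-order condition.\<close>

lemma ngx_energy_identity:
  assumes A: "skew (Ut U \<theta>)" and \<rho>: "0 < \<rho>" "\<rho> < pi"
    and eq: "ngx U \<zeta>' \<tau> 1 = ngx U \<zeta> \<theta> 1"
  shows "((\<lambda>s. (norm (ngz U \<zeta>' \<tau> s - ngz U \<zeta> \<theta> s - Ut U \<theta> *v (ngx U \<zeta>' \<tau> s - ngx U \<zeta> \<theta> s)
            - riccati \<rho> s *\<^sub>R (ngx U \<zeta>' \<tau> s - ngx U \<zeta> \<theta> s)))\<^sup>2
        + \<rho>\<^sup>2 * (norm (ngx U \<zeta>' \<tau> s - ngx U \<zeta> \<theta> s))\<^sup>2 - (norm (Ut U \<theta> *v (ngx U \<zeta>' \<tau> s - ngx U \<zeta> \<theta> s)))\<^sup>2)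
      has_integral integral {0..1} (\<lambda>s. ngz U \<zeta>' \<tau> s \<bullet> ngz U \<zeta>' \<tau> s)
        - 2 * integral {0..1} (\<lambda>s. (Ut U \<theta> *v ngx U \<zeta>' \<tau> s) \<bullet> ngz U \<zeta>' \<tau> s)
        - (ngz U \<zeta> \<theta> 1 - Ut U \<theta> *v ngx U \<zeta> \<theta> 1) \<bullet> ngx U \<zeta> \<theta> 1) {0..1}"
proof -
  have "primitive (ngx U \<zeta>' \<tau>) (\<lambda>s. 1 *\<^sub>R ngz U \<zeta>' \<tau> s)" using primitive_ngx by simp
  from energy_identity[OF A \<rho> ngx_has_vector_derivative ngz_has_vector_derivative ngx_0 primitive_ident _ refl refl
      this ngx_0 eq ngx_ngz_energy_has_integral]
  show ?thesis by simp
qed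

text \<open>A normal geodesic is compared with itself, so the deviation is zero and the identity
  reduces to its boundary term. Here \<open>\<rho>\<close> is merely some number in (0, pi); 1 is
  taken.\<close>

lemma ngx_energy:
  assumes A: "skew (Ut U \<theta>)"
  shows "integral {0..1} (\<lambda>s. ngz U \<zeta> \<theta> s \<bullet> ngz U \<zeta> \<theta> s)
      - 2 * integral {0..1} (\<lambda>s. (Ut U \<theta> *v ngx U \<zeta> \<theta> s) \<bullet> ngz U \<zeta> \<theta> s)
    = (ngz U \<zeta> \<theta> 1 - Ut U \<theta> *v ngx U \<zeta> \<theta> 1) \<bullet> ngx U \<zeta> \<theta> 1"
proof -
  have "((\<lambda>s. 0) has_integral integral {0..1} (\<lambda>s. ngz U \<zeta> \<theta> s \<bullet> ngz U \<zeta> \<theta> s)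
      - 2 * integral {0..1} (\<lambda>s. (Ut U \<theta> *v ngx U \<zeta> \<theta> s) \<bullet> ngz U \<zeta> \<theta> s)
      - (ngz U \<zeta> \<theta> 1 - Ut U \<theta> *v ngx U \<zeta> \<theta> 1) \<bullet> ngx U \<zeta> \<theta> 1) {0..1::real}"
    using ngx_energy_identity[OF A zero_less_one _ refl, of \<zeta>] pi_gt3 by simp
  from has_integral_unique[OF this has_integral_0] show ?thesis by simp
qed

text \<open>The midpoint between the operator norm and pi serves as \<open>\<rho>\<close>: small
  enough for the Riccati function to stay finite, yet strictly above the norm, so that a positive
  multiple of the squared deviation is left over. It is positive even for the zero matrix.\<close>

lemma Omega_bound:
  assumes "\<theta> \<in> Omega U"
  obtains \<alpha> \<rho> where "0 \<le> \<alpha>" "\<alpha> < \<rho>" "0 < \<rho>" "\<rho> < pi" "\<And>x. norm (Ut U \<theta> *v x) \<le> \<alpha> * norm x"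
    "\<And>x. (norm (Ut U \<theta> *v x))\<^sup>2 \<le> \<alpha>\<^sup>2 * (norm x)\<^sup>2" "\<alpha>\<^sup>2 < \<rho>\<^sup>2"
proof -
  let ?\<alpha> = "onorm (\<lambda>x. Ut U \<theta> *v x)"
  have 0: "0 \<le> ?\<alpha>" by (rule onorm_pos_le[OF bounded_linear_matrix_vector])
  have p: "?\<alpha> < pi" using assms by (simp add: Omega_def)
  have le: "norm (Ut U \<theta> *v x) \<le> ?\<alpha> * norm x" for x by (rule onorm[OF bounded_linear_matrix_vector])
  have "(norm (Ut U \<theta> *v x))\<^sup>2 \<le> ?\<alpha>\<^sup>2 * (norm x)\<^sup>2" for x
    using power_mono[OF le, of x 2] by (simp add: power_mult_distrib)
  moreover have "?\<alpha>\<^sup>2 < ((?\<alpha> + pi) / 2)\<^sup>2" using 0 p by (intro power_strict_mono) auto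
  ultimately show thesis using 0 p le by (intro that[of ?\<alpha> "(?\<alpha> + pi) / 2"]) auto
qed

text \<open>Absence of conjugate points. A normal geodesic returning to 0 has zero reduced energy by
  \<open>ngx_energy\<close>; compared with the zero curve, its nonnegative continuous integrand must
  vanish, and at \<open>s = 0\<close> that integrand is
  \<open>(norm \<zeta>)\<^sup>2\<close>.\<close>

lemma ngx_nondegenerate:
  assumes A: "skew (Ut U \<theta>)" and \<theta>: "\<theta> \<in> Omega U" and z: "ngx U \<zeta> \<theta> 1 = 0"
  shows "\<zeta> = 0"
proof -
  obtain \<alpha> \<rho> where \<alpha>: "0 \<le> \<alpha>" "\<alpha> < \<rho>" "0 < \<rho>" "\<rho> < pi"
    "\<And>x. (norm (Ut U \<theta> *v x))\<^sup>2 \<le> \<alpha>\<^sup>2 * (norm x)\<^sup>2" "\<alpha>\<^sup>2 < \<rho>\<^sup>2"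
    using Omega_bound[OF \<theta>] by metis
  let ?X = "ngx U \<zeta> \<theta>" and ?Z = "ngz U \<zeta> \<theta>" and ?A = "Ut U \<theta>"
  define f where "f s = (norm (?Z s - ?A *v ?X s - riccati \<rho> s *\<^sub>R ?X s))\<^sup>2
      + \<rho>\<^sup>2 * (norm (?X s))\<^sup>2 - (norm (?A *v ?X s))\<^sup>2" for s
  have "ngx U 0 \<theta> s = 0" "ngz U 0 \<theta> s = 0" for s
    by (simp_all add: ngx_eq_mexp_int ngz_def)
  then have "(f has_integral 0) {0..1}"
    using ngx_energy_identity[OF A \<alpha>(3,4), of \<zeta> \<theta> 0] ngx_energy[OF A, of \<zeta>] z
    by (simp add: f_def[abs_def])
  moreover have ge: "f s \<ge> 0" for s
    using \<alpha>(5)[of "?X s"] mult_right_mono[OF less_imp_le[OF \<alpha>(6)] zero_le_power2[of "norm (?X s)"]]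
      zero_le_power2[of "norm (?Z s - ?A *v ?X s - riccati \<rho> s *\<^sub>R ?X s)"] unfolding f_def by linarith
  moreover have "continuous_on {0..1} f"
    unfolding f_def
    by (intro continuous_intros continuous_on_ngz continuous_on_ngx continuous_on_matrix_vector
        continuous_on_riccati \<alpha>)
  ultimately have f0: "f s = 0" if "s \<in> {0..1}" for s
    using integral_eq_0_iff[of 0 1 f] that by (auto simp: integral_unique)
  have "f 0 = (norm \<zeta>)\<^sup>2" by (simp add: f_def)
  then show ?thesis using f0[of 0] by simp
qed

lemma mexp_int_left_inverse:
  assumes "skew (Ut U \<theta>)" "\<theta> \<in> Omega U"
  obtains N where "N ** mexp_int (Ut U \<theta>) 1 = mat 1" "\<And>x. ngx U (N *v x) \<theta> 1 = x"
proof -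
  have "\<forall>\<zeta>. mexp_int (Ut U \<theta>) 1 *v \<zeta> = 0 \<longrightarrow> \<zeta> = 0"
    using ngx_nondegenerate[OF assms] by (simp add: ngx_eq_mexp_int)
  then obtain N where N: "N ** mexp_int (Ut U \<theta>) 1 = mat 1"
    using matrix_left_invertible_ker by blast
  then have "mexp_int (Ut U \<theta>) 1 ** N = mat 1" using matrix_left_right_inverse by blast
  then have "ngx U (N *v x) \<theta> 1 = x" for x
    by (simp add: ngx_eq_mexp_int matrix_vector_mul_assoc)
  with N show thesis by (rule that)
qed

text \<open>Reads the cotangent form as the boundary term of the energy identity; together with
  \<open>ngx_energy\<close> it shows \<open>phi\<close> to be the reduced energy of the geodesic
  ending over \<open>x\<close>, plus the multiplier term.\<close>

lemma phi_eq_energy: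
  assumes A: "skew (Ut U \<theta>)" and N: "N ** mexp_int (Ut U \<theta>) 1 = mat 1" "ngx U (N *v x) \<theta> 1 = x"
  shows "phi U (x, t) \<theta> = (ngz U (N *v x) \<theta> 1 - Ut U \<theta> *v x) \<bullet> x + 4 * (t \<bullet> \<theta>)"
  using phi_eq[OF A N(1), of x t] by (simp add: ngz_def)

text \<open>Pairing the vertical equation with a covector yields the bilinear term of the energy, so
  the parameter acts as a Lagrange multiplier for the vertical end point.\<close>

lemma bracket_inner: "bracket U x y \<bullet> \<tau> = (Ut U \<tau> *v x) \<bullet> y"
proof -
  have "Ut U \<tau> *v x = (\<Sum>j\<in>UNIV. \<tau> $ j *\<^sub>R (U j *v x))"
    unfolding Ut_def
    by (simp add: linear_sum[OF bounded_linear.linear[OF bounded_linear_matrix_vector_left]] scaleR_matrix_vector_assoc)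
  then show ?thesis
    by (simp add: bracket_def inner_vec_def[of "vec_lambda _"] inner_sum_left mult.commute)
qed

subsection \<open>First-order condition at a maximizer\<close>

text \<open>Half of \<open>c\<close> absorbs the mixed term, using \<open>e * h \<le> c / 2\<close>.
  The other half completes a square in each variable, centred at 2ehB/c; the two squares give the
  constant 4.\<close>

lemma quadratic_absorbs_linear:
  fixes a b :: real
  assumes "c > 0" "0 \<le> e" "e * h \<le> c / 2" "h \<ge> 0"
  shows "- (4 * h\<^sup>2 * B\<^sup>2 / c) * e\<^sup>2 \<le> c * (a\<^sup>2 + b\<^sup>2) - 2 * e * h * (B * a + B * b + b * a)"
proof -
  have sq: "- (2 * h\<^sup>2 * B\<^sup>2 / c) * e\<^sup>2 \<le> c / 2 * x\<^sup>2 - 2 * e * h * (B * x)" for x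
  proof -
    have "0 \<le> c / 2 * (x - 2 * e * h * B / c)\<^sup>2" using assms by simp
    also have "\<dots> = c / 2 * x\<^sup>2 - 2 * e * h * (B * x) + (2 * h\<^sup>2 * B\<^sup>2 / c) * e\<^sup>2"
      using assms(1) by (simp add: power2_eq_square field_simps)
    finally show ?thesis by simp
  qed
  have "2 * e * h * (b * a) = e * h * (2 * a * b)" by simp
  also have "\<dots> \<le> e * h * (a\<^sup>2 + b\<^sup>2)"
    using assms(2,4) by (intro mult_left_mono sum_squares_bound) auto
  also have "\<dots> \<le> c / 2 * (a\<^sup>2 + b\<^sup>2)" using assms(3) by (intro mult_right_mono) auto
  finally have "2 * e * h * (b * a) \<le> c / 2 * (a\<^sup>2 + b\<^sup>2)" .
  then show ?thesis using sq[of a] sq[of b] by (simp add: algebra_simps)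
qed

text \<open>From |\<kappa>|^2 \<le> 2 |\<kappa> - y|^2 + 2 M^2 |k|^2, the claim needs
  \<open>2 * c \<le> 1\<close> and \<open>c * (2 * M\<^sup>2 + 1) \<le> g\<close>; the minimum
  secures both.\<close>

lemma coercive_bound:
  fixes k \<kappa> y :: "'a::real_inner"
  assumes "g > 0" "M \<ge> 0" "norm y \<le> M * norm k"
  defines "c \<equiv> min (1 / 2) (g / (2 * M\<^sup>2 + 1))"
  shows "c * ((norm \<kappa>)\<^sup>2 + (norm k)\<^sup>2) \<le> (norm (\<kappa> - y))\<^sup>2 + g * (norm k)\<^sup>2"
proof -
  let ?q = "norm (\<kappa> - y)"
  have d: "2 * M\<^sup>2 + 1 > 0" by (simp add: add_nonneg_pos)
  have c: "0 \<le> c" "c \<le> 1 / 2" "c * (2 * M\<^sup>2 + 1) \<le> g"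
    using assms(1) d unfolding c_def pos_le_divide_eq[OF d, symmetric] by (simp_all only: min.cobounded1 min.cobounded2) simp_all
  have "norm \<kappa> \<le> ?q + M * norm k"
    using norm_triangle_ineq[of "\<kappa> - y" y] assms(3) by simp
  then have "(norm \<kappa>)\<^sup>2 \<le> (?q + M * norm k)\<^sup>2" by (intro power_mono) auto
  also have "\<dots> \<le> 2 * ?q\<^sup>2 + 2 * M\<^sup>2 * (norm k)\<^sup>2"
    using sum_squares_bound[of ?q "M * norm k"] by (simp add: power2_sum power_mult_distrib)
  finally have "c * ((norm \<kappa>)\<^sup>2 + (norm k)\<^sup>2) \<le> c * (2 * ?q\<^sup>2 + 2 * M\<^sup>2 * (norm k)\<^sup>2 + (norm k)\<^sup>2)"
    using c by (intro mult_left_mono) auto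
  also have "\<dots> = (2 * c) * ?q\<^sup>2 + (c * (2 * M\<^sup>2 + 1)) * (norm k)\<^sup>2" by (simp add: algebra_simps)
  also have "\<dots> \<le> 1 * ?q\<^sup>2 + g * (norm k)\<^sup>2" using c by (intro add_mono mult_right_mono) auto
  finally show ?thesis by simp
qed

lemma bilinear_perturbation:
  fixes H :: "real^'q^'q"
  assumes H: "\<And>x. norm (H *v x) \<le> h * norm x" "h \<ge> 0" and B: "norm X \<le> B" "norm Z \<le> B"
  shows "(H *v (X + k)) \<bullet> (Z + \<kappa>) \<le> (H *v X) \<bullet> Z + h * (B * norm \<kappa> + B * norm k + norm k * norm \<kappa>)"
proof -
  have b: "(H *v x) \<bullet> y \<le> h * (norm x * norm y)" for x y
    using order_trans[OF norm_cauchy_schwarz mult_right_mono[OF H(1) norm_ge_zero]] by (metis mult.assoc)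
  have "(H *v X) \<bullet> \<kappa> \<le> h * (B * norm \<kappa>)"
    using order_trans[OF b[of X \<kappa>] mult_left_mono[OF mult_right_mono[OF B(1) norm_ge_zero] H(2)]] .
  moreover have "(H *v k) \<bullet> Z \<le> h * (B * norm k)"
    using order_trans[OF b[of k Z] mult_left_mono[OF mult_left_mono[OF B(2) norm_ge_zero] H(2)]]
    by (simp add: mult.commute)
  ultimately show ?thesis
    using b[of k \<kappa>] by (simp add: matrix_vector_right_distrib inner_add_left inner_add_right distrib_left)
qed

lemma Ut_add_scaleR: "Ut U (\<theta> + e *\<^sub>R \<eta>) = Ut U \<theta> + e *\<^sub>R Ut U \<eta>"
  by (simp add: Ut_def scaleR_add_left sum.distrib scaleR_sum_right)

lemma Omega_perturb:
  assumes "\<theta> \<in> Omega U"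
  obtains e0 where "e0 > 0" "\<And>e. 0 \<le> e \<Longrightarrow> e \<le> e0 \<Longrightarrow> \<theta> + e *\<^sub>R \<eta> \<in> Omega U"
proof -
  let ?a = "onorm (\<lambda>x. Ut U \<theta> *v x)" and ?h = "onorm (\<lambda>x. Ut U \<eta> *v x)"
  have h: "?h \<ge> 0" by (rule onorm_pos_le[OF bounded_linear_matrix_vector])
  have a: "?a < pi" using assms by (simp add: Omega_def)
  define e0 where "e0 = (pi - ?a) / (2 * (?h + 1))"
  have e0: "e0 > 0" using a h by (simp add: e0_def)
  have "\<theta> + e *\<^sub>R \<eta> \<in> Omega U" if e: "0 \<le> e" "e \<le> e0" for e
  proof -
    have "onorm (\<lambda>x. Ut U (\<theta> + e *\<^sub>R \<eta>) *v x) = onorm (\<lambda>x. Ut U \<theta> *v x + e *\<^sub>R (Ut U \<eta> *v x))"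
      by (simp add: Ut_add_scaleR matrix_vector_mult_add_rdistrib scaleR_matrix_vector_assoc)
    also have "\<dots> \<le> ?a + onorm (\<lambda>x. e *\<^sub>R (Ut U \<eta> *v x))"
      by (intro onorm_triangle bounded_linear_matrix_vector bounded_linear_const_scaleR)
    also have "\<dots> = ?a + e * ?h"
      using e by (simp add: onorm_scaleR[OF bounded_linear_matrix_vector])
    also have "\<dots> \<le> ?a + e0 * (?h + 1)"
      using e h by (intro add_left_mono mult_mono) auto
    also have "\<dots> = ?a + (pi - ?a) / 2" using h by (simp add: e0_def field_simps)
    also have "\<dots> < pi" using a by (simp add: field_simps)
    finally show ?thesis by (simp add: Omega_def)
  qed
  with e0 show thesis by (rule that)
qed

lemma continuous_on_bounded_norm:
  fixes f :: "real \<Rightarrow> 'a::real_normed_vector"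
  assumes "continuous_on {0..1} f"
  obtains B where "B \<ge> 0" "\<And>s. s \<in> {0..1} \<Longrightarrow> norm (f s) \<le> B"
proof -
  have "bounded (f ` {0..1})" by (rule compact_imp_bounded[OF compact_continuous_image[OF assms compact_Icc]])
  then obtain B where "B > 0" "\<forall>y\<in>f ` {0..1}. norm y \<le> B" using bounded_pos by metis
  then show thesis by (intro that[of B]) auto
qed

lemma continuous_on_bracket:
  "continuous_on S f \<Longrightarrow> continuous_on S g \<Longrightarrow> continuous_on S (\<lambda>s. bracket U (f s) (g s))"
  unfolding bracket_def
  by (intro continuous_on_vec_lambda continuous_on_inner continuous_on_matrix_vector)

text \<open>The envelope argument: perturbing a maximizer in the direction of the endpoint defect
  increases \<open>phi\<close> to first order unless the defect vanishes.\<close>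

lemma maximizer_endpoint:
  fixes U :: "'m::finite \<Rightarrow> real^'q::finite^'q"
  assumes skewU: "\<And>j. skew (U j)" and max: "\<theta> \<in> maximizers U (x0, t0)"
    and N: "N ** mexp_int (Ut U \<theta>) 1 = mat 1" "ngx U (N *v x0) \<theta> 1 = x0"
  shows "t0 = (1/2) *\<^sub>R integral {0..1} (\<lambda>r. bracket U (ngx U (N *v x0) \<theta> r) (ngz U (N *v x0) \<theta> r))"
proof -
  have sk: "skew (Ut U \<tau>)" for \<tau> by (rule skew_Ut[OF skewU])
  have \<theta>: "\<theta> \<in> Omega U" and le: "\<And>\<tau>. \<tau> \<in> Omega U \<Longrightarrow> phi U (x0, t0) \<tau> \<le> phi U (x0, t0) \<theta>"
    using max by (auto simp: maximizers_def)
  define \<zeta> where "\<zeta> = N *v x0"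
  define X where "X = ngx U \<zeta> \<theta>"
  define Z where "Z = ngz U \<zeta> \<theta>"
  define p where "p = (1/2) *\<^sub>R integral {0..1} (\<lambda>r. bracket U (X r) (Z r))"
  define \<eta> where "\<eta> = t0 - p"
  define A where "A = Ut U \<theta>"
  define H where "H = Ut U \<eta>"
  have Xc: "continuous_on {0..1} X" and Zc: "continuous_on {0..1} Z"
    by (auto simp: X_def Z_def continuous_on_ngx continuous_on_ngz)
  define I where "I = integral {0..1} (\<lambda>s. (H *v X s) \<bullet> Z s)"
  have I: "I = 2 * (p \<bullet> \<eta>)"
  proof -
    have "(\<lambda>r. bracket U (X r) (Z r)) integrable_on {0..1}"
      by (intro integrable_continuous_interval continuous_on_bracket Xc Zc)
    from integral_linear[OF this bounded_linear_inner_left[of \<eta>]]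
    show ?thesis by (simp add: I_def p_def o_def bracket_inner H_def)
  qed
  obtain \<alpha> \<rho> where \<alpha>: "0 \<le> \<alpha>" "0 < \<rho>" "\<rho> < pi" "\<And>x. norm (A *v x) \<le> \<alpha> * norm x"
    "\<And>x. (norm (A *v x))\<^sup>2 \<le> \<alpha>\<^sup>2 * (norm x)\<^sup>2" "\<alpha>\<^sup>2 < \<rho>\<^sup>2"
    using Omega_bound[OF \<theta>] unfolding A_def by metis
  obtain W where W: "W \<ge> 0" "\<And>s. s \<in> {0..1} \<Longrightarrow> norm (riccati \<rho> s) \<le> W"
    using continuous_on_bounded_norm[OF continuous_on_riccati[OF \<alpha>(2,3)]] by metis
  obtain B1 where B1: "B1 \<ge> 0" "\<And>s. s \<in> {0..1} \<Longrightarrow> norm (X s) \<le> B1"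
    using continuous_on_bounded_norm[OF Xc] by metis
  obtain B2 where B2: "B2 \<ge> 0" "\<And>s. s \<in> {0..1} \<Longrightarrow> norm (Z s) \<le> B2"
    using continuous_on_bounded_norm[OF Zc] by metis
  define B where "B = max B1 B2"
  have BX: "norm (X s) \<le> B" and BZ: "norm (Z s) \<le> B" if "s \<in> {0..1}" for s
    using B1(2)[OF that] B2(2)[OF that] by (auto simp: B_def)
  define h where "h = onorm (\<lambda>x. H *v x)"
  have h: "h \<ge> 0" "\<And>x. norm (H *v x) \<le> h * norm x"
    unfolding h_def by (auto intro: onorm_pos_le onorm bounded_linear_matrix_vector)
  define M where "M = \<alpha> + W"
  define g where "g = \<rho>\<^sup>2 - \<alpha>\<^sup>2"
  define c where "c = min (1 / 2) (g / (2 * M\<^sup>2 + 1))"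
  have g: "g > 0" using \<alpha> by (simp add: g_def)
  have c: "c > 0" using g by (simp add: c_def add_nonneg_pos)
  define C where "C = 4 * h\<^sup>2 * B\<^sup>2 / c"
  obtain e0 where e0: "e0 > 0" "\<And>e. 0 \<le> e \<Longrightarrow> e \<le> e0 \<Longrightarrow> \<theta> + e *\<^sub>R \<eta> \<in> Omega U"
    using Omega_perturb[OF \<theta>] by metis
  \<comment> \<open>Small enough both to stay in \<open>Omega U\<close> and to guarantee
    \<open>e * h \<le> c / 2\<close>, the condition for absorbing the mixed term.\<close>
  define e1 where "e1 = min e0 (c / (2 * (h + 1)))"
  have e1: "e1 > 0" using e0 c h by (simp add: e1_def)
  \<comment> \<open>The geodesic of the perturbed parameter deviates from the reference one, but
    \<open>R\<close> penalizes the deviation quadratically, so a perturbation of size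
    \<open>e\<close> gains only order \<open>e\<^sup>2\<close> from it. Maximality then bounds the
    linear coefficient by \<open>C * e\<close>.\<close>
  have key: "4 * (t0 \<bullet> \<eta>) - 2 * I \<le> C * e" if e: "0 < e" "e \<le> e1" for e
  proof -
    define \<tau> where "\<tau> = \<theta> + e *\<^sub>R \<eta>"
    have \<tau>: "\<tau> \<in> Omega U" using e0(2)[of e] e by (simp add: \<tau>_def e1_def)
    have eh: "e * h \<le> c / 2"
    proof -
      have "e * h \<le> e * (h + 1)" using e by simp
      also have "\<dots> \<le> c / (2 * (h + 1)) * (h + 1)" using e h by (intro mult_right_mono) (auto simp: e1_def)
      also have "\<dots> = c / 2" using h by (simp add: field_simps)
      finally show ?thesis .
    qed
    obtain N' where N': "N' ** mexp_int (Ut U \<tau>) 1 = mat 1" "\<And>x. ngx U (N' *v x) \<tau> 1 = x"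
      using mexp_int_left_inverse[OF sk \<tau>] by metis
    define x where "x = ngx U (N' *v x0) \<tau>"
    define z where "z = ngz U (N' *v x0) \<tau>"
    have xc: "continuous_on {0..1} x" and zc: "continuous_on {0..1} z"
      by (auto simp: x_def z_def continuous_on_ngx continuous_on_ngz)
    define R where "R s = (norm (z s - Z s - A *v (x s - X s) - riccati \<rho> s *\<^sub>R (x s - X s)))\<^sup>2
        + \<rho>\<^sup>2 * (norm (x s - X s))\<^sup>2 - (norm (A *v (x s - X s)))\<^sup>2" for s
    define E where "E = integral {0..1} (\<lambda>s. z s \<bullet> z s)"
    define F where "F = integral {0..1} (\<lambda>s. (A *v x s) \<bullet> z s)"
    define G where "G = integral {0..1} (\<lambda>s. (H *v x s) \<bullet> z s)"
    define Q where "Q = (Z 1 - A *v x0) \<bullet> x0"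
    have "ngx U (N' *v x0) \<tau> 1 = ngx U \<zeta> \<theta> 1" using N N' by (simp add: \<zeta>_def)
    from ngx_energy_identity[OF sk \<alpha>(2,3) this]
    have R: "(R has_integral E - 2 * F - Q) {0..1}"
      using N(2) by (simp add: R_def[abs_def] E_def F_def Q_def x_def z_def X_def Z_def A_def \<zeta>_def)
    have Gi: "((\<lambda>s. (H *v x s) \<bullet> z s) has_integral G) {0..1}"
      unfolding G_def
      by (intro integrable_integral integrable_continuous_interval continuous_on_inner
          continuous_on_matrix_vector xc zc)
    have Fi: "((\<lambda>s. (A *v x s) \<bullet> z s) has_integral F) {0..1}"
      unfolding F_def
      by (intro integrable_integral integrable_continuous_interval continuous_on_inner
          continuous_on_matrix_vector xc zc)
    have Ii: "((\<lambda>s. (H *v X s) \<bullet> Z s) has_integral I) {0..1}"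
      unfolding I_def
      by (intro integrable_integral integrable_continuous_interval continuous_on_inner
          continuous_on_matrix_vector Xc Zc)
    have U\<tau>: "Ut U \<tau> *v y = A *v y + e *\<^sub>R (H *v y)" for y
      by (simp add: \<tau>_def Ut_add_scaleR A_def H_def matrix_vector_mult_add_rdistrib scaleR_matrix_vector_assoc)
    have "integral {0..1} (\<lambda>s. (Ut U \<tau> *v x s) \<bullet> z s) = F + e * G"
      using has_integral_add[OF Fi has_integral_mult_right[OF Gi, of e]]
      by (intro integral_unique) (simp add: U\<tau> inner_add_left)
    then have "phi U (x0, t0) \<tau> = E - 2 * (F + e * G) + 4 * (t0 \<bullet> \<tau>)"
      using phi_eq_energy[OF sk N'(1) N'(2)[of x0], of t0] ngx_energy[OF sk, where \<zeta> = "N' *v x0" and \<theta> = \<tau>] N'(2)[of x0]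
      by (simp add: E_def x_def z_def)
    moreover have "phi U (x0, t0) \<theta> = Q + 4 * (t0 \<bullet> \<theta>)"
      using phi_eq_energy[OF sk N, of t0] by (simp add: Q_def Z_def A_def \<zeta>_def)
    ultimately have ineq: "E - 2 * F - Q - 2 * e * G + 4 * e * (t0 \<bullet> \<eta>) \<le> 0"
      using le[OF \<tau>] by (simp add: \<tau>_def inner_add_right algebra_simps)
    \<comment> \<open>By the energy identity, \<open>E - 2 * F - Q\<close> is the integral of
      \<open>R\<close>; the comparison is then pointwise, coercivity of \<open>R\<close> against the
      perturbation of the bilinear form.\<close>
    have "- (2 * e) * I - C * e\<^sup>2 \<le> (E - 2 * F - Q) - (2 * e) * G"
    proof (rule has_integral_le)
      show "((\<lambda>s. - (2 * e) * ((H *v X s) \<bullet> Z s) - C * e\<^sup>2) has_integral - (2 * e) * I - C * e\<^sup>2) {0..1}"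
        using has_integral_diff[OF has_integral_mult_right[OF Ii, of "- (2 * e)"] has_integral_const_real[of "C * e\<^sup>2" 0 1]]
        by simp
      show "((\<lambda>s. R s - (2 * e) * ((H *v x s) \<bullet> z s)) has_integral (E - 2 * F - Q) - (2 * e) * G) {0..1}"
        by (intro has_integral_diff has_integral_mult_right R Gi)
      fix s :: real assume s: "s \<in> {0..1}"
      define k where "k = x s - X s"
      define \<kappa> where "\<kappa> = z s - Z s"
      have "norm (A *v k + riccati \<rho> s *\<^sub>R k) \<le> M * norm k"
        using norm_triangle_mono[OF \<alpha>(4)[of k], of "riccati \<rho> s *\<^sub>R k" "W * norm k"] W(2)[OF s]
        by (simp add: M_def distrib_right mult_right_mono)
      from coercive_bound[OF g _ this, of \<kappa>] \<alpha>(1) W(1)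
      have "c * ((norm \<kappa>)\<^sup>2 + (norm k)\<^sup>2) \<le> (norm (\<kappa> - (A *v k + riccati \<rho> s *\<^sub>R k)))\<^sup>2 + g * (norm k)\<^sup>2"
        by (simp add: M_def c_def)
      also have "\<dots> \<le> R s"
        using \<alpha>(5)[of k] by (simp add: R_def k_def \<kappa>_def g_def left_diff_distrib diff_diff_eq add.assoc)
      finally have 1: "c * ((norm \<kappa>)\<^sup>2 + (norm k)\<^sup>2) \<le> R s" .
      have "(H *v x s) \<bullet> z s \<le> (H *v X s) \<bullet> Z s + h * (B * norm \<kappa> + B * norm k + norm k * norm \<kappa>)"
        using bilinear_perturbation[OF h(2) h(1) BX[OF s] BZ[OF s], of k \<kappa>] by (simp add: k_def \<kappa>_def)
      then have "2 * e * ((H *v x s) \<bullet> z s)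
          \<le> 2 * e * ((H *v X s) \<bullet> Z s + h * (B * norm \<kappa> + B * norm k + norm k * norm \<kappa>))"
        using e by (intro mult_left_mono) auto
      moreover have "- C * e\<^sup>2 \<le> c * ((norm \<kappa>)\<^sup>2 + (norm k)\<^sup>2) - 2 * e * h * (B * norm \<kappa> + B * norm k + norm k * norm \<kappa>)"
        unfolding C_def using quadratic_absorbs_linear[OF c _ eh h(1)] e by simp
      ultimately show "- (2 * e) * ((H *v X s) \<bullet> Z s) - C * e\<^sup>2 \<le> R s - (2 * e) * ((H *v x s) \<bullet> z s)"
        using 1 by (simp add: algebra_simps)
    qed
    with ineq have "e * (4 * (t0 \<bullet> \<eta>) - 2 * I) \<le> e * (C * e)"
      by (simp add: algebra_simps power2_eq_square)
    then show ?thesis using e by simp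
  qed
  have C: "C \<ge> 0" using c by (simp add: C_def)
  have "4 * (t0 \<bullet> \<eta>) - 2 * I \<le> 0"
  proof (rule field_le_epsilon)
    fix d :: real assume d: "d > 0"
    define e where "e = min e1 (d / (C + 1))"
    have "e > 0" "e \<le> e1" using e1 d C by (auto simp: e_def)
    then have "4 * (t0 \<bullet> \<eta>) - 2 * I \<le> C * e" by (rule key)
    also have "\<dots> \<le> (C + 1) * (d / (C + 1))"
      using C \<open>e > 0\<close> by (intro mult_mono) (auto simp: e_def)
    also have "\<dots> = d" using C by simp
    finally show "4 * (t0 \<bullet> \<eta>) - 2 * I \<le> 0 + d" by simp
  qed
  \<comment> \<open>Since \<open>I = 2 * (p \<bullet> \<eta>)\<close> and
    \<open>\<eta> = t0 - p\<close>, the left side of the preceding bound is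
    \<open>4 * (\<eta> \<bullet> \<eta>)\<close>.\<close>
  then have "\<eta> \<bullet> \<eta> \<le> 0" using I by (simp add: \<eta>_def inner_diff_left inner_diff_right inner_commute)
  then have "\<eta> = 0" by (metis inner_eq_zero_iff inner_ge_zero order_antisym)
  then show ?thesis by (simp add: \<eta>_def p_def X_def Z_def \<zeta>_def)
qed

subsection \<open>Length of horizontal curves\<close>

lemma has_integral_0_nonneg_imp_negligible:
  fixes f :: "real \<Rightarrow> real"
  assumes "(f has_integral 0) S" "\<And>s. s \<in> S \<Longrightarrow> f s \<ge> 0"
  shows "negligible {s\<in>S. f s \<noteq> 0}"
proof -
  have a: "f absolutely_integrable_on S"
    using assms by (intro nonnegative_absolutely_integrable_1) auto
  then have i: "integrable lebesgue (\<lambda>s. indicator S s *\<^sub>R f s)" by (simp add: set_integrable_def)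
  have "integral\<^sup>L lebesgue (\<lambda>s. indicator S s *\<^sub>R f s) = 0"
    using set_lebesgue_integral_eq_integral(2)[OF a] assms(1)
    by (simp add: set_lebesgue_integral_def integral_unique)
  then have "AE s in lebesgue. indicator S s *\<^sub>R f s = 0"
    using integral_nonneg_eq_0_iff_AE[OF i] assms(2) by (auto simp: indicator_def)
  then obtain N where N: "N \<in> null_sets lebesgue" "{s. indicator S s *\<^sub>R f s \<noteq> 0} \<subseteq> N"
    unfolding eventually_ae_filter by auto
  then have "negligible N" by (simp add: negligible_iff_null_sets)
  moreover have "{s\<in>S. f s \<noteq> 0} \<subseteq> N" using N(2) by (auto simp: indicator_def)
  ultimately show ?thesis using negligible_subset by blast
qed

lemma primitive_unique:
  assumes "primitive f h" "primitive g h" "f 0 = g 0" "s \<in> {0..1}"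
  shows "f s = g s"
proof -
  have "f s - f 0 = g s - g 0"
    using primitiveD(3)[OF assms(1), of 0 s] primitiveD(3)[OF assms(2), of 0 s] assms(4) by simp
  then show ?thesis using assms(3) by simp
qed

lemma primitive_indefinite_integral:
  assumes "u absolutely_integrable_on {0..1}"
  shows "primitive (\<lambda>s. integral {0..s} u) u"
  unfolding primitive_def
proof (intro conjI allI impI assms)
  fix a b :: real assume ab: "0 \<le> a \<and> a \<le> b \<and> b \<le> 1"
  have i: "u integrable_on {c..d}" if "0 \<le> c" "d \<le> 1" for c d
    by (rule integrable_on_subinterval[of u "{0..1}"]) (use assms that in \<open>auto simp: absolutely_integrable_on_def\<close>)
  have "integral {0..a} u + integral {a..b} u = integral {0..b} u"
    by (rule Henstock_Kurzweil_Integration.integral_combine) (use ab i in auto)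
  then have "integral {a..b} u = integral {0..b} u - integral {0..a} u" by (simp add: algebra_simps)
  then show "(u has_integral integral {0..b} u - integral {0..a} u) {a..b}"
    using integrable_integral[OF i[of a b]] ab by simp
qed

lemma bracket_scaleR_right: "bracket U x (c *\<^sub>R y) = c *\<^sub>R bracket U x y"
  by (simp add: bracket_def vec_eq_iff)

lemma bracket_zero_right [simp]: "bracket U x 0 = 0"
  by (simp add: bracket_def vec_eq_iff)

lemma horizontal_primitive:
  assumes "horizontal U \<gamma> v"
  shows "primitive (\<lambda>s. fst (\<gamma> s)) v"
    and "primitive (\<lambda>s. snd (\<gamma> s)) (\<lambda>s. (1/2) *\<^sub>R bracket U (fst (\<gamma> s)) (v s))"
proof -
  obtain N where N: "negligible N" "\<And>s. s \<in> {0..1} - N \<Longrightarrow>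
      ((\<lambda>s. fst (\<gamma> s)) has_vector_derivative v s) (at s within {0..1}) \<and>
      ((\<lambda>s. snd (\<gamma> s)) has_vector_derivative (1/2) *\<^sub>R bracket U (fst (\<gamma> s)) (v s)) (at s within {0..1})"
    using assms unfolding horizontal_def by blast
  show "primitive (\<lambda>s. fst (\<gamma> s)) v"
    by (rule abs_cont_on_imp_primitive[OF _ N(1)]) (use assms N(2) in \<open>auto simp: horizontal_def\<close>)
  show "primitive (\<lambda>s. snd (\<gamma> s)) (\<lambda>s. (1/2) *\<^sub>R bracket U (fst (\<gamma> s)) (v s))"
    by (rule abs_cont_on_imp_primitive[OF _ N(1)]) (use assms N(2) in \<open>auto simp: horizontal_def\<close>)
qed

lemma horizontal_norm_integrable:
  assumes "horizontal U \<gamma> v"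
  shows "(\<lambda>s. norm (v s)) absolutely_integrable_on {0..1}"
  using absolutely_integrable_norm[OF primitiveD(1)[OF horizontal_primitive(1)[OF assms]]]
  by (simp add: o_def)

lemma curve_length_has_integral:
  assumes "horizontal U \<gamma> v"
  shows "((\<lambda>s. norm (v s)) has_integral curve_length v) {0..1}"
  unfolding curve_length_def
  using horizontal_norm_integrable[OF assms] by (intro integrable_integral) (simp add: absolutely_integrable_on_def)

lemma curve_length_nonneg: "horizontal U \<gamma> v \<Longrightarrow> curve_length v \<ge> 0"
  by (rule has_integral_nonneg[OF curve_length_has_integral]) auto

text \<open>Zero length makes \<open>v\<close> vanish almost everywhere, and then the vertical
  velocity, linear in \<open>v\<close>, vanishes as well. Positivity allows arc length to be
  normalized.\<close>

lemma curve_length_pos: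
  assumes h: "horizontal U \<gamma> v" and 0: "\<gamma> 0 = origin" and 1: "\<gamma> 1 \<noteq> origin"
  shows "curve_length v > 0"
proof (rule ccontr)
  assume "\<not> ?thesis"
  then have "((\<lambda>s. norm (v s)) has_integral 0) {0..1}"
    using curve_length_has_integral[OF h] curve_length_nonneg[OF h] by simp
  then have neg: "negligible {s\<in>{0..1}. norm (v s) \<noteq> 0}"
    by (rule has_integral_0_nonneg_imp_negligible) simp
  have "primitive (\<lambda>s. fst (\<gamma> s)) (\<lambda>s. 0)"
    by (rule primitive_spike[OF horizontal_primitive(1)[OF h] neg]) auto
  moreover have "primitive (\<lambda>s. snd (\<gamma> s)) (\<lambda>s. 0)"
    by (rule primitive_spike[OF horizontal_primitive(2)[OF h] neg]) auto
  ultimately have "fst (\<gamma> 1) = fst (\<gamma> 0)" "snd (\<gamma> 1) = snd (\<gamma> 0)"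
    by (auto dest: primitiveD(3)[of _ _ 0 1])
  then show False using 0 1 by (simp add: prod_eq_iff)
qed

text \<open>Arc length divided by the total length, so that for a curve of positive length it maps
  [0,1] onto itself. It may be constant where the curve rests; hence a curve is written as a
  geodesic composed with it, never the other way round.\<close>

definition arclen :: "(real \<Rightarrow> real^'q) \<Rightarrow> real \<Rightarrow> real" where
  "arclen v s = integral {0..s} (\<lambda>r. norm (v r) / curve_length v)"

context
  fixes U :: "'m::finite \<Rightarrow> real^'q::finite^'q" and \<gamma> v
  assumes h: "horizontal U \<gamma> v" and pos: "curve_length v > 0"
begin

lemma primitive_arclen: "primitive (arclen v) (\<lambda>s. norm (v s) / curve_length v)"
  unfolding arclen_def[abs_def]
  using absolutely_integrable_linear[OF horizontal_norm_integrable[OF h] bounded_linear_divide, of "curve_length v"]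
  by (intro primitive_indefinite_integral) (simp add: o_def)

lemma arclen_0: "arclen v 0 = 0"
  by (simp add: arclen_def)

lemma arclen_1: "arclen v 1 = 1"
proof -
  have "((\<lambda>s. norm (v s) / curve_length v) has_integral 1) {0..1}"
    using has_integral_divide[OF curve_length_has_integral[OF h], of "curve_length v"] pos by simp
  then show ?thesis unfolding arclen_def by (rule integral_unique)
qed

lemma arclen_mono: "mono_on {0..1} (arclen v)"
proof (rule mono_onI)
  fix a b :: real assume ab: "a \<in> {0..1}" "b \<in> {0..1}" "a \<le> b"
  have "((\<lambda>s. norm (v s) / curve_length v) has_integral arclen v b - arclen v a) {a..b}"
    using primitiveD(2)[OF primitive_arclen, of a b] ab by simp
  then have "0 \<le> arclen v b - arclen v a" by (rule has_integral_nonneg) (use pos in auto)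
  then show "arclen v a \<le> arclen v b" by simp
qed

lemma arclen_range: "s \<in> {0..1} \<Longrightarrow> arclen v s \<in> {0..1}"
  using mono_onD[OF arclen_mono, of 0 s] mono_onD[OF arclen_mono, of s 1] by (simp add: arclen_0 arclen_1)

lemma continuous_on_arclen: "continuous_on {0..1} (arclen v)"
  by (rule primitive_continuous_on[OF primitive_arclen])

lemma arclen_image: "arclen v ` {0..1} = {0..1}"
proof
  show "{0..1} \<subseteq> arclen v ` {0..1}"
  proof
    fix y :: real assume "y \<in> {0..1}"
    then show "y \<in> arclen v ` {0..1}"
      using IVT'[of "arclen v" 0 y 1] continuous_on_arclen by (auto simp: arclen_0 arclen_1)
  qed
qed (use arclen_range in auto)

text \<open>With \<open>u = norm v / L\<close> and \<open>\<nu>\<close> of constant norm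
  \<open>L\<close>, the weighted energy is exactly \<open>L\<^sup>2\<close>, so the identity bounds
  the length directly. In case of equality \<open>u * R\<close> vanishes almost everywhere; where
  \<open>u > 0\<close> the curve and its velocity agree with the geodesic at
  \<open>\<sigma> s\<close>, where \<open>u = 0\<close> both velocities vanish, and integration
  yields both components.\<close>

theorem horizontal_length_bound:
  assumes skewU: "\<And>j. skew (U j)" and \<theta>: "\<theta> \<in> Omega U"
    and ends: "\<gamma> 0 = origin" "\<gamma> 1 = (x0, t0)" and X1: "ngx U \<zeta> \<theta> 1 = x0"
  defines "Q \<equiv> (ngz U \<zeta> \<theta> 1 - Ut U \<theta> *v x0) \<bullet> x0 + 4 * (t0 \<bullet> \<theta>)"
  shows "Q \<le> (curve_length v)\<^sup>2"
    and "(curve_length v)\<^sup>2 = Q \<Longrightarrow> s \<in> {0..1} \<Longrightarrow> \<gamma> s = normal_geodesic U \<zeta> \<theta> (arclen v s)"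
proof -
  define L where "L = curve_length v"
  define A where "A = Ut U \<theta>"
  define x where "x s = fst (\<gamma> s)" for s
  define t where "t s = snd (\<gamma> s)" for s
  define \<sigma> where "\<sigma> = arclen v"
  define u where "u s = norm (v s) / L" for s
  \<comment> \<open>At a zero of \<open>v\<close> the weight \<open>u\<close> is zero too, so the
    default 0 keeps \<open>u s *\<^sub>R \<nu> s = v s\<close> valid everywhere.\<close>
  define \<nu> where "\<nu> s = (if v s = 0 then 0 else (L / norm (v s)) *\<^sub>R v s)" for s
  define X where "X = ngx U \<zeta> \<theta>"
  define Z where "Z = ngz U \<zeta> \<theta>"
  have sk: "skew A" unfolding A_def by (rule skew_Ut[OF skewU])
  have L: "L > 0" using pos by (simp add: L_def)
  have u\<nu>: "u s *\<^sub>R \<nu> s = v s" for s using L by (simp add: u_def \<nu>_def)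
  have u0: "u s \<ge> 0" for s using L by (simp add: u_def)
  have px: "primitive x v" and pt: "primitive t (\<lambda>s. (1/2) *\<^sub>R bracket U (x s) (v s))"
    using horizontal_primitive[OF h] by (simp_all add: x_def[abs_def] t_def[abs_def])
  have p\<sigma>: "primitive \<sigma> u"
    using primitive_arclen by (simp add: \<sigma>_def u_def[abs_def] L_def)
  have \<sigma>: "\<And>s. s \<in> {0..1} \<Longrightarrow> \<sigma> s \<in> {0..1}" "\<sigma> 0 = 0" "\<sigma> 1 = 1"
    by (auto simp: \<sigma>_def arclen_range arclen_0 arclen_1 simp del: atLeastAtMost_iff)
  have e: "x 0 = 0" "t 0 = 0" "x 1 = x0" "t 1 = t0" using ends by (auto simp: x_def t_def origin_def)
  have E: "((\<lambda>s. u s * (\<nu> s \<bullet> \<nu> s)) has_integral L\<^sup>2) {0..1}"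
  proof -
    have "u s * (\<nu> s \<bullet> \<nu> s) = L * norm (v s)" for s
      using L by (simp add: u_def \<nu>_def dot_square_norm power2_eq_square)
    then show ?thesis
      using has_integral_mult_right[OF curve_length_has_integral[OF h], of L] by (simp add: L_def power2_eq_square)
  qed
  have B: "((\<lambda>s. (A *v x s) \<bullet> (u s *\<^sub>R \<nu> s)) has_integral 2 * (t0 \<bullet> \<theta>)) {0..1}"
  proof -
    have "((\<lambda>s. (1/2) *\<^sub>R bracket U (x s) (v s)) has_integral t0) {0..1}"
      using primitiveD(2)[OF pt, of 0 1] e by simp
    from has_integral_mult_right[OF has_integral_linear[OF this bounded_linear_inner_left[of \<theta>]], of 2]
    show ?thesis by (simp add: o_def bracket_inner A_def u\<nu>)
  qed
  obtain \<alpha> \<rho> where \<alpha>: "0 < \<rho>" "\<rho> < pi" "\<And>x. (norm (A *v x))\<^sup>2 \<le> \<alpha>\<^sup>2 * (norm x)\<^sup>2" "\<alpha>\<^sup>2 < \<rho>\<^sup>2"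
    using Omega_bound[OF \<theta>] unfolding A_def by metis
  define k where "k s = x s - X (\<sigma> s)" for s
  define q where "q s = \<nu> s - Z (\<sigma> s) - A *v k s - riccati \<rho> (\<sigma> s) *\<^sub>R k s" for s
  define R where "R s = (norm (q s))\<^sup>2 + \<rho>\<^sup>2 * (norm (k s))\<^sup>2 - (norm (A *v k s))\<^sup>2" for s
  have "((\<lambda>s. u s * R s) has_integral L\<^sup>2 - 2 * (2 * (t0 \<bullet> \<theta>)) - (Z 1 - A *v X 1) \<bullet> X 1) {0..1}"
    unfolding R_def q_def k_def X_def Z_def
  proof (rule energy_identity[OF sk \<alpha>(1,2) ngx_has_vector_derivative _ ngx_0 p\<sigma> \<sigma> _ e(1) _ E B])
    show "primitive x (\<lambda>s. u s *\<^sub>R \<nu> s)" using px by (simp add: u\<nu>)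
    show "x 1 = ngx U \<zeta> \<theta> 1" using e X1 by simp
  qed (simp_all add: A_def ngz_has_vector_derivative)
  then have int: "((\<lambda>s. u s * R s) has_integral L\<^sup>2 - Q) {0..1}"
    using X1 by (simp add: Q_def X_def Z_def A_def algebra_simps)
  \<comment> \<open>The strict margin between \<alpha> and \<rho> is kept: it is what forces
    \<open>k s = 0\<close>, and not only \<open>q s = 0\<close>, in the case of equality.\<close>
  have Rge: "(norm (q s))\<^sup>2 + (\<rho>\<^sup>2 - \<alpha>\<^sup>2) * (norm (k s))\<^sup>2 \<le> R s" for s
    using \<alpha>(3)[of "k s"] by (simp add: R_def left_diff_distrib)
  then have R0: "R s \<ge> 0" for s
    using \<alpha>(4) by (meson add_nonneg_nonneg diff_ge_0_iff_ge less_imp_le mult_nonneg_nonneg order_trans zero_le_power2)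
  show "Q \<le> (curve_length v)\<^sup>2"
    using has_integral_nonneg[OF int] u0 R0 by (simp add: L_def)
  assume eq: "(curve_length v)\<^sup>2 = Q" and s: "s \<in> {0..1}"
  have neg: "negligible {s\<in>{0..1}. u s * R s \<noteq> 0}"
    by (rule has_integral_0_nonneg_imp_negligible) (use int eq u0 R0 in \<open>auto simp: L_def\<close>)
  have vZ: "v s = u s *\<^sub>R Z (\<sigma> s)" if "s \<in> {0..1} - {s\<in>{0..1}. u s * R s \<noteq> 0}" for s
  proof (cases "u s = 0")
    case True
    then show ?thesis using u\<nu>[of s] by simp
  next
    case False
    then have "R s = 0" using that by auto
    then have le: "(norm (q s))\<^sup>2 + (\<rho>\<^sup>2 - \<alpha>\<^sup>2) * (norm (k s))\<^sup>2 \<le> 0" using Rge[of s] by simp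
    moreover have "(\<rho>\<^sup>2 - \<alpha>\<^sup>2) * (norm (k s))\<^sup>2 \<ge> 0" using \<alpha>(4) by simp
    ultimately have "(norm (q s))\<^sup>2 = 0" "(\<rho>\<^sup>2 - \<alpha>\<^sup>2) * (norm (k s))\<^sup>2 = 0"
      using zero_le_power2[of "norm (q s)"] by linarith+
    then have "q s = 0" "k s = 0" using \<alpha>(4) by auto
    then have "\<nu> s = Z (\<sigma> s)" by (simp add: q_def)
    then show ?thesis using u\<nu>[of s] by simp
  qed
  have pX: "primitive (\<lambda>s. X (\<sigma> s)) (\<lambda>s. u s *\<^sub>R Z (\<sigma> s))"
    unfolding X_def Z_def
    by (rule primitive_compose[OF p\<sigma> \<sigma>(1) ngx_has_vector_derivative continuous_on_ngz])
  have xX: "x s = X (\<sigma> s)" if "s \<in> {0..1}" for s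
    by (rule primitive_unique[OF px primitive_spike[OF pX neg vZ] _ that])
      (simp_all add: e \<sigma> X_def)
  define T where "T s = integral {0..s} (\<lambda>r. bracket U (X r) (Z r))" for s
  have bc: "continuous_on {0..1} (\<lambda>r. bracket U (X r) (Z r))"
    unfolding X_def Z_def by (intro continuous_on_bracket continuous_on_ngx continuous_on_ngz)
  have "primitive (\<lambda>s. T (\<sigma> s)) (\<lambda>s. u s *\<^sub>R bracket U (X (\<sigma> s)) (Z (\<sigma> s)))"
    unfolding T_def
    by (rule primitive_compose[OF p\<sigma> \<sigma>(1) integral_has_vector_derivative[OF bc] bc])
  from primitive_linear[OF this bounded_linear_scaleR_right[of "1/2"]]
  have pT: "primitive (\<lambda>s. (1/2) *\<^sub>R T (\<sigma> s)) (\<lambda>s. (1/2) *\<^sub>R (u s *\<^sub>R bracket U (X (\<sigma> s)) (Z (\<sigma> s))))" .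
  have "t s = (1/2) *\<^sub>R T (\<sigma> s)"
  proof (rule primitive_unique[OF pt primitive_spike[OF pT neg] _ s])
    fix s assume s: "s \<in> {0..1} - {s\<in>{0..1}. u s * R s \<noteq> 0}"
    then show "(1/2) *\<^sub>R bracket U (x s) (v s) = (1/2) *\<^sub>R (u s *\<^sub>R bracket U (X (\<sigma> s)) (Z (\<sigma> s)))"
      using vZ[OF s] xX[of s] by (simp add: bracket_scaleR_right)
  qed (simp add: e \<sigma> T_def)
  then show "\<gamma> s = normal_geodesic U \<zeta> \<theta> (arclen v s)"
    using xX[OF s]
    by (simp add: prod_eq_iff normal_geodesic_def x_def t_def X_def Z_def T_def \<sigma>_def)
qed

end

subsection \<open>Shortest geodesics\<close>

lemma abs_cont_on_of_deriv:
  fixes f :: "real \<Rightarrow> 'a::euclidean_space"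
  assumes "\<And>s. s \<in> {0..1} \<Longrightarrow> (f has_vector_derivative f' s) (at s within {0..1})"
    and "continuous_on {0..1} f'"
  shows "abs_cont_on 0 1 f"
proof -
  obtain B where B: "B \<ge> 0" "\<And>s. s \<in> {0..1} \<Longrightarrow> norm (f' s) \<le> B"
    using continuous_on_bounded_norm[OF assms(2)] by metis
  have p: "primitive f f'" by (rule primitive_of_deriv[OF assms])
  have le: "norm (f b - f a) \<le> B * (b - a)" if "0 \<le> a" "a \<le> b" "b \<le> 1" for a b
    using has_integral_bound[OF B(1), of f' "f b - f a" a b] primitiveD(2)[OF p, of a b] that B(2) by simp
  show ?thesis
  proof (rule abs_cont_on_lipschitz[where C = B])
    fix x y :: real assume "x \<in> {0..1}" "y \<in> {0..1}"
    then show "norm (f y - f x) \<le> B * \<bar>y - x\<bar>"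
      using le[of x y] le[of y x] by (cases "x \<le> y") (auto simp: norm_minus_commute)
  qed
qed

lemma normal_geodesic_snd_has_vector_derivative:
  "s \<in> {0..1} \<Longrightarrow> ((\<lambda>s. snd (normal_geodesic U \<zeta> \<theta> s)) has_vector_derivative
     (1/2) *\<^sub>R bracket U (ngx U \<zeta> \<theta> s) (ngz U \<zeta> \<theta> s)) (at s within {0..1})"
  unfolding normal_geodesic_def snd_conv
  by (intro bounded_linear.has_vector_derivative[OF bounded_linear_scaleR_right]
      integral_has_vector_derivative continuous_on_bracket continuous_on_ngx continuous_on_ngz)

lemma horizontal_normal_geodesic:
  "horizontal U (normal_geodesic U \<zeta> \<theta>) (ngz U \<zeta> \<theta>)"
proof -
  have f: "(\<lambda>s. fst (normal_geodesic U \<zeta> \<theta> s)) = ngx U \<zeta> \<theta>" by (simp add: normal_geodesic_def)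
  show ?thesis
    unfolding horizontal_def f
  proof (intro conjI exI[of _ "{}"] ballI)
    show "abs_cont_on 0 1 (ngx U \<zeta> \<theta>)"
      by (rule abs_cont_on_of_deriv[OF ngx_has_vector_derivative continuous_on_ngz])
    show "abs_cont_on 0 1 (\<lambda>s. snd (normal_geodesic U \<zeta> \<theta> s))"
      by (rule abs_cont_on_of_deriv[OF normal_geodesic_snd_has_vector_derivative])
        (auto intro!: continuous_intros continuous_on_bracket continuous_on_ngx continuous_on_ngz)
  qed (auto simp: normal_geodesic_def ngx_has_vector_derivative normal_geodesic_snd_has_vector_derivative[unfolded normal_geodesic_def, simplified])
qed

lemma curve_length_ngz: "skew (Ut U \<theta>) \<Longrightarrow> curve_length (ngz U \<zeta> \<theta>) = norm \<zeta>"
  unfolding curve_length_def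
  using integral_cong[of "{0..1}" "\<lambda>s. norm (ngz U \<zeta> \<theta> s)" "\<lambda>s. norm \<zeta>"] norm_ngz[of U \<theta> _ \<zeta>] by simp

text \<open>Normal geodesics have constant speed, so equality up to reparametrization becomes
  pointwise equality when two of them are compared.\<close>

lemma arclen_ngz:
  assumes "skew (Ut U \<theta>)" "\<zeta> \<noteq> 0" "s \<in> {0..1}"
  shows "arclen (ngz U \<zeta> \<theta>) s = s"
proof -
  have "arclen (ngz U \<zeta> \<theta>) s = integral {0..s} (\<lambda>r. 1)"
    unfolding arclen_def curve_length_ngz[OF assms(1)]
    by (rule integral_cong) (use assms norm_ngz[OF assms(1)] in auto)
  then show ?thesis using assms(3) by simp
qed

text \<open>Collects for one maximizer what distance, uniqueness and abnormality require. The lower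
  bound \<open>phi\<close> is attained because the first-order condition puts the vertical end point
  of the geodesic at \<open>t0\<close>.\<close>

lemma maximizer_geodesic:
  fixes U :: "'m::finite \<Rightarrow> real^'q::finite^'q"
  assumes skewU: "\<And>j. skew (U j)" and ne: "(x0, t0) \<noteq> origin"
    and max: "\<theta> \<in> maximizers U (x0, t0)"
    and N: "N ** mexp_int (Ut U \<theta>) 1 = mat 1" "ngx U (N *v x0) \<theta> 1 = x0"
  shows "normal_geodesic U (N *v x0) \<theta> 0 = origin"
    and "normal_geodesic U (N *v x0) \<theta> 1 = (x0, t0)"
    and "(norm (N *v x0))\<^sup>2 = phi U (x0, t0) \<theta>"
    and "N *v x0 \<noteq> 0"
    and "horizontal U \<gamma> v \<Longrightarrow> \<gamma> 0 = origin \<Longrightarrow> \<gamma> 1 = (x0, t0) \<Longrightarrow> norm (N *v x0) \<le> curve_length v"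
    and "horizontal U \<gamma> v \<Longrightarrow> \<gamma> 0 = origin \<Longrightarrow> \<gamma> 1 = (x0, t0) \<Longrightarrow> curve_length v = norm (N *v x0) \<Longrightarrow>
      s \<in> {0..1} \<Longrightarrow> \<gamma> s = normal_geodesic U (N *v x0) \<theta> (arclen v s)"
proof -
  have sk: "skew (Ut U \<theta>)" by (rule skew_Ut[OF skewU])
  have \<theta>: "\<theta> \<in> Omega U" using max by (simp add: maximizers_def)
  let ?\<zeta> = "N *v x0"
  show start: "normal_geodesic U ?\<zeta> \<theta> 0 = origin" by (simp add: normal_geodesic_def origin_def)
  have t0: "t0 = (1/2) *\<^sub>R integral {0..1} (\<lambda>r. bracket U (ngx U ?\<zeta> \<theta> r) (ngz U ?\<zeta> \<theta> r))"
    by (rule maximizer_endpoint[OF skewU max N])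
  then show stop: "normal_geodesic U ?\<zeta> \<theta> 1 = (x0, t0)" using N by (simp add: normal_geodesic_def)
  show nz: "?\<zeta> \<noteq> 0"
  proof
    assume "?\<zeta> = 0"
    then have "ngx U ?\<zeta> \<theta> s = 0" "ngz U ?\<zeta> \<theta> s = 0" for s by (simp_all add: ngx_eq_mexp_int ngz_def)
    then have "normal_geodesic U ?\<zeta> \<theta> 1 = origin" by (simp add: normal_geodesic_def origin_def)
    then show False using stop ne by simp
  qed
  \<comment> \<open>As \<open>t0\<close> is the actual vertical end point, the multiplier term of
    \<open>phi\<close> cancels against this integral in \<open>ngx_energy\<close>; only the plain
    energy, the squared constant speed, is left.\<close>
  have "integral {0..1} (\<lambda>s. (Ut U \<theta> *v ngx U ?\<zeta> \<theta> s) \<bullet> ngz U ?\<zeta> \<theta> s) = 2 * (t0 \<bullet> \<theta>)"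
  proof -
    have "(\<lambda>r. bracket U (ngx U ?\<zeta> \<theta> r) (ngz U ?\<zeta> \<theta> r)) integrable_on {0..1}"
      by (intro integrable_continuous_interval continuous_on_bracket continuous_on_ngx continuous_on_ngz)
    from integral_linear[OF this bounded_linear_inner_left[of \<theta>]]
    show ?thesis by (subst t0) (simp add: o_def bracket_inner)
  qed
  moreover have "integral {0..1} (\<lambda>s. ngz U ?\<zeta> \<theta> s \<bullet> ngz U ?\<zeta> \<theta> s) = (norm ?\<zeta>)\<^sup>2"
    using integral_cong[of "{0..1}" "\<lambda>s. ngz U ?\<zeta> \<theta> s \<bullet> ngz U ?\<zeta> \<theta> s" "\<lambda>s. (norm ?\<zeta>)\<^sup>2"] norm_ngz[OF sk]
    by (simp add: dot_square_norm)
  ultimately show norm: "(norm ?\<zeta>)\<^sup>2 = phi U (x0, t0) \<theta>"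
    using ngx_energy[OF sk, of ?\<zeta>] phi_eq_energy[OF sk N, of t0] N(2) by simp
  fix \<gamma> v assume h: "horizontal U \<gamma> v" and ends: "\<gamma> 0 = origin" "\<gamma> 1 = (x0, t0)"
  have pos: "curve_length v > 0" using curve_length_pos[OF h ends(1)] ends(2) ne by simp
  note b = horizontal_length_bound[OF h pos skewU \<theta> ends N(2), folded phi_eq_energy[OF sk N], folded norm]
  show "norm ?\<zeta> \<le> curve_length v" using power2_le_imp_le[OF b(1)] pos by simp
  show "curve_length v = norm ?\<zeta> \<Longrightarrow> s \<in> {0..1} \<Longrightarrow> \<gamma> s = normal_geodesic U ?\<zeta> \<theta> (arclen v s)"
    using b(2) by simp
qed

text \<open>Length does not see the parametrization, so uniqueness is expressed through a continuous
  monotone surjection \<open>h\<close>; it need not be injective, since a shortest curve may rest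
  for some time.\<close>

theorem theorem2p7:
  fixes U :: "'m::finite \<Rightarrow> real^'q::finite^'q"
    and x0 :: "real^'q" and t0 :: "real^'m" and \<theta>0 :: "real^'m"
  assumes skewU: "\<And>j. skew (U j)"
    and injU: "inj U" and indepU: "independent (range U)"
    and g0M: "(x0, t0) \<in> Mt U" and g0ne: "(x0, t0) \<noteq> origin"
    and \<theta>0max: "\<theta>0 \<in> maximizers U (x0, t0)"
  shows "(dist_cc U (x0, t0))\<^sup>2 = phi U (x0, t0) \<theta>0
    \<and> (\<exists>\<gamma>0 \<zeta>.
         (\<forall>s\<in>{0..1}.
            cvec (fst (\<gamma>0 s)) = matfun (sinratio s) (Uc U \<theta>0)
                                   *v cvec (mexp ((s - 1) *\<^sub>R Ut U \<theta>0) *v x0)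
          \<and> cvec (\<zeta> s) = matfun zsin (Uc U \<theta>0)
                                   *v cvec (mexp ((2 * s - 1) *\<^sub>R Ut U \<theta>0) *v x0)
          \<and> snd (\<gamma>0 s) = (1/2) *\<^sub>R integral {0..s} (\<lambda>r. bracket U (fst (\<gamma>0 r)) (\<zeta> r)))
       \<and> shortest_geodesic U (x0, t0) \<gamma>0
       \<and> (\<forall>\<gamma>. shortest_geodesic U (x0, t0) \<gamma> \<longrightarrow>
            (\<exists>h. continuous_on {0..1} h \<and> mono_on {0..1} h \<and> h ` {0..1} = {0..1}
                 \<and> (\<forall>s\<in>{0..1}. \<gamma> s = \<gamma>0 (h s))))
       \<and> ((x0, t0) \<in> Mt2 U \<longrightarrow> abnormal U \<gamma>0))"
proof -
  have sk: "skew (Ut U \<tau>)" for \<tau> by (rule skew_Ut[OF skewU])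
  have inverse: "\<exists>N. N ** mexp_int (Ut U \<theta>) 1 = mat 1 \<and> ngx U (N *v x0) \<theta> 1 = x0"
    if "\<theta> \<in> maximizers U (x0, t0)" for \<theta>
    using mexp_int_left_inverse[OF sk, of \<theta>] that unfolding maximizers_def by blast
  obtain N where N: "N ** mexp_int (Ut U \<theta>0) 1 = mat 1" "ngx U (N *v x0) \<theta>0 1 = x0"
    using inverse[OF \<theta>0max] by blast
  let ?\<zeta> = "N *v x0"
  let ?\<gamma> = "normal_geodesic U ?\<zeta> \<theta>0"
  note G = maximizer_geodesic[OF skewU g0ne \<theta>0max N]
  have dist: "dist_cc U (x0, t0) = norm ?\<zeta>"
    unfolding dist_cc_def
  proof (rule cInf_eq_minimum)
    show "norm ?\<zeta> \<in> {L. \<exists>\<gamma> v. horizontal U \<gamma> v \<and> \<gamma> 0 = origin \<and> \<gamma> 1 = (x0, t0) \<and> L = curve_length v}"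
      using horizontal_normal_geodesic[of U ?\<zeta> \<theta>0] G(1,2) curve_length_ngz[OF sk[of \<theta>0], of ?\<zeta>] by force
  qed (use G(5) in blast)
  have formulas: "cvec (fst (?\<gamma> s)) = matfun (sinratio s) (Uc U \<theta>0) *v cvec (mexp ((s - 1) *\<^sub>R Ut U \<theta>0) *v x0)
      \<and> cvec (ngz U ?\<zeta> \<theta>0 s) = matfun zsin (Uc U \<theta>0) *v cvec (mexp ((2 * s - 1) *\<^sub>R Ut U \<theta>0) *v x0)
      \<and> snd (?\<gamma> s) = (1/2) *\<^sub>R integral {0..s} (\<lambda>r. bracket U (fst (?\<gamma> r)) (ngz U ?\<zeta> \<theta>0 r))"
    if "s \<in> {0..1}" for s
    using that matfun_sinratio_mexp[OF sk N(1), of s x0] matfun_zsin_mexp[OF sk N(1), of s x0]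
    by (simp add: normal_geodesic_def ngx_eq_mexp_int ngz_def)
  have shortest: "shortest_geodesic U (x0, t0) ?\<gamma>"
    unfolding shortest_geodesic_def dist
    using horizontal_normal_geodesic[of U ?\<zeta> \<theta>0] G(1,2) curve_length_ngz[OF sk[of \<theta>0], of ?\<zeta>] by blast
  have unique: "\<exists>h. continuous_on {0..1} h \<and> mono_on {0..1} h \<and> h ` {0..1} = {0..1} \<and> (\<forall>s\<in>{0..1}. \<gamma> s = ?\<gamma> (h s))"
    if sg: "shortest_geodesic U (x0, t0) \<gamma>" for \<gamma>
  proof -
    obtain v where v: "horizontal U \<gamma> v" "\<gamma> 0 = origin" "\<gamma> 1 = (x0, t0)" "curve_length v = norm ?\<zeta>"
      using sg unfolding shortest_geodesic_def dist by blast
    have pos: "curve_length v > 0" using v(4) G(4) by simp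
    show ?thesis
      using continuous_on_arclen[OF v(1) pos] arclen_mono[OF v(1) pos] arclen_image[OF v(1) pos] G(6)[OF v]
      by blast
  qed
  \<comment> \<open>All maximizers share the same value of \<open>phi\<close>, so their geodesics
    have the same minimal length; the equality case for \<open>\<theta>0\<close> identifies each
    with the geodesic of \<open>\<theta>0\<close>, pointwise because of constant speed.\<close>
  have coincide: "?\<gamma> s = normal_geodesic U (N' *v x0) \<theta> s"
    if \<theta>: "\<theta> \<in> maximizers U (x0, t0)" and N': "N' ** mexp_int (Ut U \<theta>) 1 = mat 1" "ngx U (N' *v x0) \<theta> 1 = x0"
      and s: "s \<in> {0..1}" for \<theta> N' s
  proof -
    note G' = maximizer_geodesic[OF skewU g0ne \<theta> N']
    have "phi U (x0, t0) \<theta> = phi U (x0, t0) \<theta>0"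
      using \<theta> \<theta>0max by (auto simp: maximizers_def intro: antisym)
    then have "(norm (N' *v x0))\<^sup>2 = (norm ?\<zeta>)\<^sup>2" using G(3) G'(3) by simp
    then have "curve_length (ngz U (N' *v x0) \<theta>) = norm ?\<zeta>"
      using curve_length_ngz[OF sk] by (simp add: power2_eq_iff_nonneg)
    from G(6)[OF horizontal_normal_geodesic G'(1,2) this s] show ?thesis
      using arclen_ngz[OF sk G'(4) s] by simp
  qed
  have abn: "abnormal U ?\<gamma>" if g2: "(x0, t0) \<in> Mt2 U"
  proof -
    obtain \<theta>1 \<theta>2 where \<theta>: "\<theta>1 \<in> maximizers U (x0, t0)" "\<theta>2 \<in> maximizers U (x0, t0)" "\<theta>1 \<noteq> \<theta>2"
      using g2 unfolding Mt2_def by blast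
    obtain N1 where N1: "N1 ** mexp_int (Ut U \<theta>1) 1 = mat 1" "ngx U (N1 *v x0) \<theta>1 1 = x0"
      using inverse[OF \<theta>(1)] by blast
    obtain N2 where N2: "N2 ** mexp_int (Ut U \<theta>2) 1 = mat 1" "ngx U (N2 *v x0) \<theta>2 1 = x0"
      using inverse[OF \<theta>(2)] by blast
    \<comment> \<open>The covector contains the constant component
      \<open>2 *\<^sub>R \<theta>\<close>, so the two lifts differ at every time; 0 is as good as
      any.\<close>
    have "normal_lift U (N1 *v x0) \<theta>1 0 \<noteq> normal_lift U (N2 *v x0) \<theta>2 0"
      using \<theta>(3) by (simp add: normal_lift_def)
    then show ?thesis
      unfolding abnormal_def using coincide[OF \<theta>(1) N1] coincide[OF \<theta>(2) N2]
      by (metis atLeastAtMost_iff order_refl zero_le_one)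
  qed
  have "(dist_cc U (x0, t0))\<^sup>2 = phi U (x0, t0) \<theta>0" using dist G(3) by simp
  then show ?thesis using formulas shortest unique abn by blast
qed

end
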